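(* \textsc{Set TEXP}, parameterized by the lifetime $L$ of the input temporal graph, is $\mathsf{W}[2]$-hard.
   Context: A temporal graph $\mathcal{G}=\langle G_1,\dots,G_L\rangle$ with underlying simple undirected graph $G=(V,E)$ and lifetime $L$ is a sequence of graphs $G_t=(V,E_t)$ with $E_t\subseteq E$ for $t\in[L]$. A strict temporal walk is a start time $t_0$ together with an alternating sequence $v_1,(e_1,t_1),v_2,\dots,(e_{l-1},t_{l-1}),v_l$ with $e_i=\{v_i,v_{i+1}\}\in E_{t_i}$ and $1\le t_0\le t_1<\dots<t_{l-1}\le L$; it starts at $v_1$ at time $t_0$ and visits every $v_i$. An instance of \textsc{Set TEXP} is $(\mathcal{G},s,\mathcal{X})$ with $s\in V$ and $\mathcal{X}=\{X_1,\dots,X_m\}$ a family of subsets of $V$; it is a yes-instance iff there is a strict temporal walk starting at $s$ with start time $1$ that visits at least one vertex of each $X_i$, $i\in[m]$. *)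

theory Defs
  imports Main
begin

text \<open>Problems are over the binary alphabet (bool list). A parameterized problem
 (in the Downey--Fellows style) is a set of pairs (instance string, parameter).\<close>

type_synonym pproblem = "(bool list \<times> nat) set"

text \<open>Self-delimiting binary encoding of naturals (LSB first, each bit doubled,
 terminated by False True).\<close>
fun enc_nat :: "nat \<Rightarrow> bool list" where
  "enc_nat 0 = [False, True]"
| "enc_nat (Suc n) = odd (Suc n) # odd (Suc n) # enc_nat (Suc n div 2)"

definition enc_list :: "('a \<Rightarrow> bool list) \<Rightarrow> 'a list \<Rightarrow> bool list" where
  "enc_list e xs = enc_nat (length xs) @ concat (map e xs)"

datatype dir = MoveL | MoveR | Stay

text \<open>A machine is a transition function; state 0 is the start state, state 1 the
 halting state. Tape symbol 0 is the blank. A configuration is (state, reversed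
 left part of the tape, tape from the head position on).\<close>
type_synonym tm = "nat \<Rightarrow> nat \<Rightarrow> nat \<times> nat \<times> dir"
type_synonym config = "nat \<times> nat list \<times> nat list"

text \<open>Finiteness: finitely many states and tape symbols (at least the 4 symbols
 used for input/output encodings).\<close>
definition tm_valid :: "tm \<Rightarrow> bool" where
  "tm_valid M \<longleftrightarrow> (\<exists>NQ NS. 2 \<le> NQ \<and> 4 \<le> NS \<and>
     (\<forall>q<NQ. \<forall>a<NS. fst (M q a) < NQ \<and> fst (snd (M q a)) < NS))"

definition tm_step :: "tm \<Rightarrow> config \<Rightarrow> config" where
  "tm_step M c = (case c of (q, ls, rs) \<Rightarrow>
     (if q = 1 then (q, ls, rs) else
      (let a = (case rs of [] \<Rightarrow> 0 | b # _ \<Rightarrow> b);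
           (q', b, d) = M q a;
           rs' = b # tl rs
       in case d of
            MoveL \<Rightarrow> (case ls of [] \<Rightarrow> (q', [], 0 # rs') | e # ls' \<Rightarrow> (q', ls', e # rs'))
          | MoveR \<Rightarrow> (q', b # ls, tl rs)
          | Stay \<Rightarrow> (q', ls, rs'))))"

definition tm_run :: "tm \<Rightarrow> nat \<Rightarrow> nat list \<Rightarrow> config" where
  "tm_run M t inp = (tm_step M ^^ t) (0, [], inp)"

definition halts_with :: "tm \<Rightarrow> nat \<Rightarrow> nat list \<Rightarrow> nat list \<Rightarrow> bool" where
  "halts_with M t inp out \<longleftrightarrow>
     fst (tm_run M t inp) = 1 \<and> takeWhile (\<lambda>a. a \<noteq> 0) (snd (snd (tm_run M t inp))) = out"

definition code_pair :: "bool list \<times> nat \<Rightarrow> nat list" where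
  "code_pair p = map (\<lambda>b. if b then 2 else 1) (fst p) @ 3 # replicate (snd p) 1"

definition computable_nat :: "(nat \<Rightarrow> nat) \<Rightarrow> bool" where
  "computable_nat f \<longleftrightarrow> (\<exists>M. tm_valid M \<and>
     (\<forall>k. \<exists>t. halts_with M t (code_pair ([], k)) (code_pair ([], f k))))"

section \<open>FPT reductions (Flum--Grohe, Def. 2.1)\<close>

definition fpt_reduction ::
  "(bool list \<times> nat \<Rightarrow> bool list \<times> nat) \<Rightarrow> pproblem \<Rightarrow> pproblem \<Rightarrow> bool" where
  "fpt_reduction R P Q \<longleftrightarrow>
     (\<forall>x k. (x, k) \<in> P \<longleftrightarrow> R (x, k) \<in> Q) \<and>
     (\<exists>M f c. tm_valid M \<and> computable_nat f \<and>
        (\<forall>x k. \<exists>t \<le> f k * (length x + 1) ^ c. halts_with M t (code_pair (x, k)) (code_pair (R (x, k))))) \<and>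
     (\<exists>g. computable_nat g \<and> (\<forall>x k. snd (R (x, k)) \<le> g k))"

definition fpt_reducible :: "pproblem \<Rightarrow> pproblem \<Rightarrow> bool" where
  "fpt_reducible P Q \<longleftrightarrow> (\<exists>R. fpt_reduction R P Q)"

text \<open>Boolean decision circuits of bounded depth, represented as formulas (trees);
 small gates have fan-in at most 2, large gates have larger fan-in.\<close>
datatype circ = Inp nat | NotG circ | AndG "circ list" | OrG "circ list"

fun circ_depth :: "circ \<Rightarrow> nat" where
  "circ_depth (Inp i) = 0"
| "circ_depth (NotG c) = Suc (circ_depth c)"
| "circ_depth (AndG cs) = Suc (fold max (map circ_depth cs) 0)"
| "circ_depth (OrG cs) = Suc (fold max (map circ_depth cs) 0)"

fun circ_weft :: "circ \<Rightarrow> nat" where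
  "circ_weft (Inp i) = 0"
| "circ_weft (NotG c) = circ_weft c"
| "circ_weft (AndG cs) = (if length cs > 2 then 1 else 0) + fold max (map circ_weft cs) 0"
| "circ_weft (OrG cs) = (if length cs > 2 then 1 else 0) + fold max (map circ_weft cs) 0"

fun circ_inputs :: "circ \<Rightarrow> nat set" where
  "circ_inputs (Inp i) = {i}"
| "circ_inputs (NotG c) = circ_inputs c"
| "circ_inputs (AndG cs) = \<Union> (set (map circ_inputs cs))"
| "circ_inputs (OrG cs) = \<Union> (set (map circ_inputs cs))"

fun circ_eval :: "(nat \<Rightarrow> bool) \<Rightarrow> circ \<Rightarrow> bool" where
  "circ_eval \<sigma> (Inp i) = \<sigma> i"
| "circ_eval \<sigma> (NotG c) = (\<not> circ_eval \<sigma> c)"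
| "circ_eval \<sigma> (AndG cs) = list_all id (map (circ_eval \<sigma>) cs)"
| "circ_eval \<sigma> (OrG cs) = list_ex id (map (circ_eval \<sigma>) cs)"

fun enc_circ :: "circ \<Rightarrow> bool list" where
  "enc_circ (Inp i) = enc_nat 0 @ enc_nat i"
| "enc_circ (NotG c) = enc_nat 1 @ enc_circ c"
| "enc_circ (AndG cs) = enc_nat 2 @ enc_nat (length cs) @ concat (map enc_circ cs)"
| "enc_circ (OrG cs) = enc_nat 3 @ enc_nat (length cs) @ concat (map enc_circ cs)"

definition weighted_sat :: "circ \<Rightarrow> nat \<Rightarrow> bool" where
  "weighted_sat C k \<longleftrightarrow> (\<exists>S. S \<subseteq> circ_inputs C \<and> card S = k \<and> circ_eval (\<lambda>i. i \<in> S) C)"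

definition WCS :: "nat \<Rightarrow> nat \<Rightarrow> pproblem" where
  "WCS t h = {(enc_circ C, k) | C k. circ_weft C \<le> t \<and> circ_depth C \<le> h \<and> weighted_sat C k}"

definition W_class :: "nat \<Rightarrow> pproblem set" where
  "W_class t = {P. \<exists>h. fpt_reducible P (WCS t h)}"

definition W_hard :: "nat \<Rightarrow> pproblem \<Rightarrow> bool" where
  "W_hard t Q \<longleftrightarrow> (\<forall>P \<in> W_class t. fpt_reducible P Q)"

text \<open>An instance: vertex set {0..<n}, lifetime L, a list of time-edges (u,v,t)
 meaning {u,v} \<in> E_t, start vertex s, and the family X (sets as lists).\<close>
type_synonym texp_inst = "nat \<times> nat \<times> (nat \<times> nat \<times> nat) list \<times> nat \<times> nat list list"

definition texp_valid :: "texp_inst \<Rightarrow> bool" where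
  "texp_valid I = (case I of (n, L, es, s, Xs) \<Rightarrow>
     (\<forall>(u, v, t) \<in> set es. u < n \<and> v < n \<and> u \<noteq> v \<and> 1 \<le> t \<and> t \<le> L) \<and>
     s < n \<and> (\<forall>X \<in> set Xs. set X \<subseteq> {..<n}))"

definition strict_walk ::
  "nat \<Rightarrow> (nat \<times> nat \<times> nat) list \<Rightarrow> nat \<Rightarrow> nat list \<Rightarrow> nat list \<Rightarrow> bool" where
  "strict_walk L es s vs ts \<longleftrightarrow>
     vs \<noteq> [] \<and> hd vs = s \<and> length ts + 1 = length vs \<and>
     sorted_wrt (<) ts \<and> (\<forall>t \<in> set ts. 1 \<le> t \<and> t \<le> L) \<and>
     (\<forall>i < length ts. (vs ! i, vs ! Suc i, ts ! i) \<in> set es \<or> (vs ! Suc i, vs ! i, ts ! i) \<in> set es)"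

definition texp_yes :: "texp_inst \<Rightarrow> bool" where
  "texp_yes I = (case I of (n, L, es, s, Xs) \<Rightarrow>
     (\<exists>vs ts. strict_walk L es s vs ts \<and> (\<forall>X \<in> set Xs. set vs \<inter> set X \<noteq> {})))"

definition enc_texp :: "texp_inst \<Rightarrow> bool list" where
  "enc_texp I = (case I of (n, L, es, s, Xs) \<Rightarrow>
     enc_nat n @ enc_nat L @
     enc_list (\<lambda>(u, v, t). enc_nat u @ enc_nat v @ enc_nat t) es @
     enc_nat s @ enc_list (enc_list enc_nat) Xs)"

definition SetTEXP_L :: pproblem where
  "SetTEXP_L = {(enc_texp I, fst (snd I)) | I. texp_valid I \<and> texp_yes I}"

end

theory Submission
  imports Defs
begin

text \<open>A bounded-depth circuit of weft 2 can be rewritten in polynomial time as an OR of ANDs of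
  ORs of conjunctions of at most q literals, for a constant q: above, between and below the two
  levels of large gates only boundedly many small gates occur, and these can be multiplied out.

  A weight-k assignment is described by k cells that contain the true variables in increasing
  order. A positive literal is certified by the content of one cell, a negative literal by two
  consecutive cells enclosing the variable, so that a conjunction of literals together with the
  chosen disjunct of the OR at the top is certified by boundedly many cells. The vertices of the
  temporal graph are the possible contents of bounded tuples of cells. All its layers are complete,
  so a walk may visit any set of at most L vertices, and L is the number of tuples of cells, which
  depends only on k. One target set per tuple forces exactly one visited vertex per tuple, further
  sets force agreement between overlapping tuples, and each clause of the chosen disjunct
  becomes the set of the vertices that certify it.

  A parameterized reduction from an arbitrary problem in W[2] is then composed with this one. To
  obtain Turing machines with time bounds, functions on tree-coded data are implemented in a small
  register language that is compiled to Turing machines. Polynomial-time functions are closed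
  under composition, case distinction and iteration with polynomially bounded intermediate
  values. This also yields the simulation of the machine of the given reduction, whose running
  time is not polynomial but bounded by a function of the input and the step count.\<close>

section \<open>A register language and its compilation to Turing machines\<close>

text \<open>Two constraints shape the construction. The parameter may depend on k only, while the
  number of clauses is unbounded. A walk with \<open>L\<close> moves is just a choice of
  \<open>L\<close> vertices, so clauses must be hit as a by-product of describing the assignment,
  and one vertex must contain everything that certifies a term. Hence q = 2 * 2 ^ d + 1: a term has
  at most 2 ^ d literals, each needs at most two cells, and one more cell names the disjunct. With k
  + 3 cells there are (k + 3) ^ q layers, and the number of vertices is polynomial because q depends
  on the depth bound only. The second constraint is formal: hardness quantifies over all problems
  that some Turing machine reduces to \<open>WCS 2 d\<close>, so the composed map needs an actual
  machine again. Time bounds are therefore derived by rules that follow the shape of a defining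
  equation, and circuits are parsed by recursion over their constant depth bound. Numbers are coded
  in unary, so variable names and announced fan-ins, which may be exponential in the input length,
  stay bit strings throughout.\<close>

text \<open>Four registers hold strings over the symbols 1, 2, 3; the tests read the first symbol
  of a register, with 0 standing for the empty string.\<close>

datatype cmd = Skip | Push nat nat | Pop nat | Seq cmd cmd
  | Branch nat "nat set" cmd cmd | Loop nat "nat set" cmd

type_synonym regs = "nat \<Rightarrow> nat list"

definition first :: "nat list \<Rightarrow> nat" where
  "first xs = (case xs of [] \<Rightarrow> 0 | x # _ \<Rightarrow> x)"

lemma first_simps [simp]: "first [] = 0" "first (x # xs) = x"
  by (simp_all add: first_def)

fun cstep :: "cmd list \<times> regs \<Rightarrow> cmd list \<times> regs" where
  "cstep ([], \<sigma>) = ([], \<sigma>)"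
| "cstep (Skip # K, \<sigma>) = (K, \<sigma>)"
| "cstep (Push i a # K, \<sigma>) = (K, \<sigma>(i := a # \<sigma> i))"
| "cstep (Pop i # K, \<sigma>) = (K, \<sigma>(i := tl (\<sigma> i)))"
| "cstep (Seq c d # K, \<sigma>) = (c # d # K, \<sigma>)"
| "cstep (Branch i A c d # K, \<sigma>) = ((if first (\<sigma> i) \<in> A then c else d) # K, \<sigma>)"
| "cstep (Loop i A c # K, \<sigma>) = ((if first (\<sigma> i) \<in> A then c # Loop i A c # K else K), \<sigma>)"

text \<open>Quantifying over all continuations \<open>K\<close> makes runs composable: the command
  consumes itself and leaves untouched whatever is to be executed after it.\<close>

definition runs :: "cmd \<Rightarrow> regs \<Rightarrow> nat \<Rightarrow> regs \<Rightarrow> bool" where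
  "runs c \<sigma> t \<sigma>' \<longleftrightarrow> (\<forall>K. (cstep ^^ t) (c # K, \<sigma>) = (K, \<sigma>'))"

lemma funpow_trans: "(f ^^ m) x = y \<Longrightarrow> (f ^^ n) y = z \<Longrightarrow> (f ^^ (m + n)) x = z"
  by (metis add.commute comp_apply funpow_add)

lemma funpow_one: "f x = y \<Longrightarrow> (f ^^ 1) x = y" for f :: "'a \<Rightarrow> 'a"
  by simp

lemma runs_Skip: "runs Skip \<sigma> 1 \<sigma>"
  and runs_Push: "runs (Push i a) \<sigma> 1 (\<sigma>(i := a # \<sigma> i))"
  and runs_Pop: "runs (Pop i) \<sigma> 1 (\<sigma>(i := tl (\<sigma> i)))"
  by (simp_all add: runs_def)

lemma runs_Seq:
  assumes "runs c \<sigma> s \<tau>" "runs d \<tau> t \<upsilon>"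
  shows "runs (Seq c d) \<sigma> (s + t + 1) \<upsilon>"
  unfolding runs_def
proof
  fix K
  have "(cstep ^^ (1 + (s + t))) (Seq c d # K, \<sigma>) = (K, \<upsilon>)"
    using assms by (intro funpow_trans[OF funpow_one funpow_trans]) (auto simp: runs_def)
  then show "(cstep ^^ (s + t + 1)) (Seq c d # K, \<sigma>) = (K, \<upsilon>)" by (simp add: add.commute)
qed

lemma runs_Branch:
  assumes "runs (if first (\<sigma> i) \<in> A then c else d) \<sigma> t \<tau>"
  shows "runs (Branch i A c d) \<sigma> (t + 1) \<tau>"
  unfolding runs_def
proof
  fix K
  have "(cstep ^^ (1 + t)) (Branch i A c d # K, \<sigma>) = (K, \<tau>)"
    using assms by (intro funpow_trans[OF funpow_one]) (auto simp: runs_def)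
  then show "(cstep ^^ (t + 1)) (Branch i A c d # K, \<sigma>) = (K, \<tau>)" by (simp add: add.commute)
qed

lemma runs_Loop_end: "first (\<sigma> i) \<notin> A \<Longrightarrow> runs (Loop i A c) \<sigma> 1 \<sigma>"
  by (simp add: runs_def)

lemma runs_Loop_step:
  assumes "first (\<sigma> i) \<in> A" "runs c \<sigma> s \<tau>" "runs (Loop i A c) \<tau> t \<upsilon>"
  shows "runs (Loop i A c) \<sigma> (s + t + 1) \<upsilon>"
  unfolding runs_def
proof
  fix K
  have "(cstep ^^ (1 + (s + t))) (Loop i A c # K, \<sigma>) = (K, \<upsilon>)"
    using assms by (intro funpow_trans[OF funpow_one funpow_trans]) (auto simp: runs_def)
  then show "(cstep ^^ (s + t + 1)) (Loop i A c # K, \<sigma>) = (K, \<upsilon>)" by (simp add: add.commute)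
qed

fun wf_cmd :: "cmd \<Rightarrow> bool" where
  "wf_cmd Skip = True"
| "wf_cmd (Push i a) = (i < 4 \<and> a \<in> {1, 2, 3})"
| "wf_cmd (Pop i) = (i < 4)"
| "wf_cmd (Seq c d) = (wf_cmd c \<and> wf_cmd d)"
| "wf_cmd (Branch i A c d) = (i < 4 \<and> wf_cmd c \<and> wf_cmd d)"
| "wf_cmd (Loop i A c) = (i < 4 \<and> wf_cmd c)"

definition ok_regs :: "regs \<Rightarrow> bool" where
  "ok_regs \<sigma> \<longleftrightarrow> (\<forall>i<4. set (\<sigma> i) \<subseteq> {1, 2, 3})"

abbreviation LM :: nat where "LM \<equiv> 4"
abbreviation SP :: nat where "SP \<equiv> 5"
abbreviation DM :: nat where "DM \<equiv> 6"

text \<open>On the tape, \<^term>\<open>LM\<close> marks the left end, each register is followed by \<^term>\<open>SP\<close>, and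
  \<^term>\<open>DM\<close> temporarily marks a symbol that is being deleted.\<close>

datatype mst = I0 | I1 | I2 | I3 nat | At "cmd list" | Seek nat "cmd list"
  | Ins nat "cmd list" | DelR "cmd list" | DelL nat "cmd list" | Ret "cmd list" | F1 | F2 | Halt

text \<open>The action taken once the head stands on the first cell of the register named by the top
  command. Reading \<open>SP\<close> there means that the register is empty, which
  \<open>first\<close> reports as 0. \<open>Push\<close> writes over the old symbol and carries it
  to the right in state \<open>Ins\<close>; \<open>Pop\<close> leaves \<open>DM\<close> behind, so
  that the shift back to the left knows where to stop.\<close>

definition act :: "cmd list \<Rightarrow> nat \<Rightarrow> mst \<times> nat \<times> dir" where
  "act K b = (case K of [] \<Rightarrow> (Halt, b, Stay) | c # K' \<Rightarrow>
     (case c of Skip \<Rightarrow> (At K', b, Stay)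
      | Seq x y \<Rightarrow> (At (x # y # K'), b, Stay)
      | Push i a \<Rightarrow> (Ins b K', a, MoveR)
      | Pop i \<Rightarrow> (if b = SP then (Ret K', b, Stay) else (DelR K', DM, MoveR))
      | Branch i A x y \<Rightarrow> (Ret ((if (if b = SP then 0 else b) \<in> A then x else y) # K'), b, Stay)
      | Loop i A x \<Rightarrow> (Ret (if (if b = SP then 0 else b) \<in> A then x # K else K'), b, Stay)))"

definition locate :: "cmd list \<Rightarrow> nat \<Rightarrow> mst \<times> nat \<times> dir" where
  "locate K b = (case K of [] \<Rightarrow> (F1, b, MoveR) | c # K' \<Rightarrow>
     (case c of Skip \<Rightarrow> (At K', b, Stay)
      | Seq x y \<Rightarrow> (At (x # y # K'), b, Stay)
      | Push i a \<Rightarrow> (Seek i K, b, MoveR)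
      | Pop i \<Rightarrow> (Seek i K, b, MoveR)
      | Branch i A x y \<Rightarrow> (Seek i K, b, MoveR)
      | Loop i A x \<Rightarrow> (Seek i K, b, MoveR)))"

text \<open>\<open>I0\<close> to \<open>I3\<close> frame the input: moving left at the end of the
  tape creates a fresh cell for \<open>LM\<close>, and four separators are appended behind the
  input, which becomes register 0. \<open>Seek n\<close> skips n separators, \<open>Ret\<close>
  walks back to \<open>LM\<close>. \<open>F1\<close> and \<open>F2\<close> blank the first
  separator, so that the output of the machine is exactly register 0.\<close>

fun trans_fun :: "cmd \<Rightarrow> mst \<Rightarrow> nat \<Rightarrow> mst \<times> nat \<times> dir" where
  "trans_fun p I0 b = (I1, b, MoveL)"
| "trans_fun p I1 b = (I2, LM, MoveR)"
| "trans_fun p I2 b = (if b = 0 then (I3 2, SP, MoveR) else (I2, b, MoveR))"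
| "trans_fun p (I3 n) b = (if n = 0 then (Ret [p], SP, Stay) else (I3 (n - 1), SP, MoveR))"
| "trans_fun p (At K) b = locate K b"
| "trans_fun p (Seek n K) b =
     (if n = 0 then act K b else (Seek (if b = SP then n - 1 else n) K, b, MoveR))"
| "trans_fun p (Ins c K) b = (if b = 0 then (Ret K, c, Stay) else (Ins b K, c, MoveR))"
| "trans_fun p (DelR K) b = (if b = 0 then (DelL 0 K, 0, MoveL) else (DelR K, b, MoveR))"
| "trans_fun p (DelL c K) b = (if b = DM then (Ret K, c, Stay) else (DelL b K, c, MoveL))"
| "trans_fun p (Ret K) b = (if b = LM then (At K, b, Stay) else (Ret K, b, MoveL))"
| "trans_fun p F1 b = (if b = SP then (F2, 0, MoveL) else (F1, b, MoveR))"
| "trans_fun p F2 b = (if b = LM then (Halt, b, MoveR) else (F2, b, MoveL))"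
| "trans_fun p Halt b = (Halt, b, Stay)"

type_synonym mconf = "mst \<times> nat list \<times> nat list"

text \<open>The step function of Turing machines with symbolic states in place of numbers; the
  numbering is added at the end, in \<open>mstep_tm\<close>.\<close>

definition mstep :: "cmd \<Rightarrow> mconf \<Rightarrow> mconf" where
  "mstep p c = (case c of (q, ls, rs) \<Rightarrow>
     (if q = Halt then (q, ls, rs) else
      (let (q', b, d) = trans_fun p q (first rs); rs' = b # tl rs
       in case d of
            MoveL \<Rightarrow> (case ls of [] \<Rightarrow> (q', [], 0 # rs') | e # ls' \<Rightarrow> (q', ls', e # rs'))
          | MoveR \<Rightarrow> (q', b # ls, tl rs)
          | Stay \<Rightarrow> (q', ls, rs'))))"

abbreviation msteps :: "cmd \<Rightarrow> nat \<Rightarrow> mconf \<Rightarrow> mconf" where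
  "msteps p n \<equiv> mstep p ^^ n"

lemma mstep_simps:
  "q \<noteq> Halt \<Longrightarrow> trans_fun p q (first rs) = (q', b, MoveR) \<Longrightarrow> mstep p (q, ls, rs) = (q', b # ls, tl rs)"
  "q \<noteq> Halt \<Longrightarrow> trans_fun p q (first rs) = (q', b, Stay) \<Longrightarrow> mstep p (q, ls, rs) = (q', ls, b # tl rs)"
  "q \<noteq> Halt \<Longrightarrow> trans_fun p q (first rs) = (q', b, MoveL) \<Longrightarrow> mstep p (q, e # ls, rs) = (q', ls, e # b # tl rs)"
  "q \<noteq> Halt \<Longrightarrow> trans_fun p q (first rs) = (q', b, MoveL) \<Longrightarrow> mstep p (q, [], rs) = (q', [], 0 # b # tl rs)"
  by (simp_all add: mstep_def)

section \<open>Scanning and shifting on the tape\<close>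

lemma msteps_right:
  assumes "q \<noteq> Halt" "\<And>b. b \<in> set w \<Longrightarrow> trans_fun p q b = (q, b, MoveR)"
  shows "msteps p (length w) (q, ls, w @ rs) = (q, rev w @ ls, rs)"
  using assms(2)
proof (induction w arbitrary: ls)
  case (Cons b w)
  have "mstep p (q, ls, (b # w) @ rs) = (q, b # ls, w @ rs)"
    using Cons.prems[of b] assms(1) by (subst mstep_simps(1)[of _ _ _ q b]) auto
  then show ?case using Cons by (simp add: funpow_swap1 del: funpow.simps add: funpow_Suc_right)
qed simp

lemma msteps_left:
  assumes "q \<noteq> Halt" "\<And>b. b \<in> set (u @ [b0]) \<Longrightarrow> trans_fun p q b = (q, b, MoveL)"
  shows "msteps p (Suc (length u)) (q, rev u @ e # ls, b0 # rs) = (q, ls, e # u @ b0 # rs)"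
  using assms(2)
proof (induction u arbitrary: rs b0 rule: rev_induct)
  case Nil
  then show ?case using assms(1) by (simp add: mstep_simps(3)[where q'=q and b=b0])
next
  case (snoc b u)
  have "mstep p (q, rev (u @ [b]) @ e # ls, b0 # rs) = (q, rev u @ e # ls, b # b0 # rs)"
    using snoc.prems[of b0] assms(1) by (simp add: mstep_simps(3)[where q'=q and b=b0])
  then have "msteps p (1 + Suc (length u)) (q, rev (u @ [b]) @ e # ls, b0 # rs) =
      (q, ls, e # u @ b # b0 # rs)"
    using snoc by (intro funpow_trans[OF funpow_one]) auto
  then show ?case by simp
qed

lemma msteps_Ret:
  assumes "LM \<notin> set u" "b \<noteq> LM"
  shows "msteps p (length u + 2) (Ret K, rev u @ [LM], b # v) = (At K, [], LM # u @ b # v)"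
proof -
  have "msteps p (Suc (length u)) (Ret K, rev u @ LM # [], b # v) = (Ret K, [], LM # u @ b # v)"
    using assms by (intro msteps_left) auto
  from funpow_trans[OF this funpow_one, of "(At K, [], LM # u @ b # v)"]
  show ?thesis by (simp add: mstep_simps(2)[where q'="At K" and b=LM])
qed

text \<open>Shifting a nonempty block one cell to the right, the state carrying the symbol to be written.\<close>

lemma msteps_Ins:
  assumes "0 \<notin> set w" "w' @ [l] = c # w"
  shows "msteps p (Suc (length w)) (Ins c K, ls, w @ replicate z 0) =
     (Ret K, rev w' @ ls, l # replicate (z - 1) 0)"
  using assms
proof (induction w arbitrary: c w' ls)
  case Nil
  have "tl (replicate z 0) = replicate (z - 1) 0" "first (replicate z 0) = 0" by (cases z; simp)+
  with Nil show ?case by (simp add: mstep_simps(2)[where q'="Ret K" and b=c])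
next
  case (Cons b w)
  then obtain w'' where w'': "w' = c # w''" "w'' @ [l] = b # w" by (cases w') auto
  have "mstep p (Ins c K, ls, (b # w) @ replicate z 0) = (Ins b K, c # ls, w @ replicate z 0)"
    using Cons.prems by (simp add: mstep_simps(1)[where q'="Ins b K" and b=c])
  then have "msteps p (1 + Suc (length w)) (Ins c K, ls, (b # w) @ replicate z 0) =
    (Ret K, rev w'' @ c # ls, l # replicate (z - 1) 0)"
    using Cons w'' by (intro funpow_trans[OF funpow_one]) auto
  then show ?case using w'' by simp
qed

text \<open>At each cell on the way left the symbol carried in the state is exchanged for the one
  found there, so every symbol lands one cell further left. The cell marked \<open>DM\<close>
  receives the last carried symbol and closes the gap.\<close>

lemma msteps_DelL:
  assumes "DM \<notin> set (w @ [b])"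
  shows "msteps p (length w + 2) (DelL c K, rev w @ DM # ls, b # rs) =
     (Ret K, ls, (w @ [b]) @ c # rs)"
  using assms
proof (induction w arbitrary: c b rs rule: rev_induct)
  case Nil
  have "msteps p (1 + 1) (DelL c K, rev [] @ DM # ls, b # rs) = (Ret K, ls, ([] @ [b]) @ c # rs)"
    using Nil
    by (intro funpow_trans[OF funpow_one funpow_one, of _ _ "(DelL b K, ls, DM # c # rs)"])
      (simp_all add: mstep_simps(3)[where q'="DelL b K" and b=c] mstep_simps(2)[where q'="Ret K" and b=b])
  then show ?case by simp
next
  case (snoc a w)
  have "mstep p (DelL c K, rev (w @ [a]) @ DM # ls, b # rs) = (DelL b K, rev w @ DM # ls, a # c # rs)"
    using snoc.prems by (simp add: mstep_simps(3)[where q'="DelL b K" and b=c])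
  then have "msteps p (1 + (length w + 2)) (DelL c K, rev (w @ [a]) @ DM # ls, b # rs) =
    (Ret K, ls, (w @ [a]) @ b # c # rs)"
    using snoc by (intro funpow_trans[OF funpow_one]) auto
  then show ?case by simp
qed

text \<open>Of the two new blanks, one is the cell vacated by the shift and the other is the blank
  that told \<open>DelR\<close> it had passed the end. The truncated z - 1 also covers z = 0, where
  that blank was not yet an explicit cell.\<close>

lemma msteps_Del:
  assumes "DM \<notin> set w" "0 \<notin> set w" "w \<noteq> []"
  shows "msteps p (2 * length w + 2) (DelR K, DM # ls, w @ replicate z 0) =
     (Ret K, ls, w @ 0 # 0 # replicate (z - 1) 0)"
proof -
  obtain w0 b where w: "w = w0 @ [b]" using assms(3) by (metis rev_exhaust)
  have tz: "tl (replicate z 0) = replicate (z - 1) 0" "first (replicate z 0) = 0" by (cases z; simp)+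
  have "msteps p (length w) (DelR K, DM # ls, w @ replicate z 0) = (DelR K, rev w @ DM # ls, replicate z 0)"
    using assms(2) by (intro msteps_right) (auto intro!: gr0I)
  moreover have "mstep p (DelR K, rev w @ DM # ls, replicate z 0) =
      (DelL 0 K, rev w0 @ DM # ls, b # 0 # replicate (z - 1) 0)"
    using tz by (simp add: w mstep_simps(3)[where q'="DelL 0 K" and b=0])
  moreover have "msteps p (length w0 + 2) (DelL 0 K, rev w0 @ DM # ls, b # 0 # replicate (z - 1) 0) =
      (Ret K, ls, (w0 @ [b]) @ 0 # 0 # replicate (z - 1) 0)"
    using assms w by (intro msteps_DelL) auto
  ultimately have "msteps p (length w + (1 + (length w0 + 2))) (DelR K, DM # ls, w @ replicate z 0) =
      (Ret K, ls, (w0 @ [b]) @ 0 # 0 # replicate (z - 1) 0)"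
    by (blast intro: funpow_trans funpow_one)
  moreover have "length w + (1 + (length w0 + 2)) = 2 * length w + 2" by (simp add: w)
  ultimately show ?thesis by (simp only: w append_assoc append_Cons append_Nil)
qed

section \<open>Registers on the tape and the simulation of one command\<close>

abbreviation block :: "regs \<Rightarrow> nat \<Rightarrow> nat \<Rightarrow> nat list" where
  "block \<sigma> i j \<equiv> concat (map (\<lambda>i. \<sigma> i @ [SP]) [i..<j])"

abbreviation tape :: "regs \<Rightarrow> nat list" where
  "tape \<sigma> \<equiv> block \<sigma> 0 4"

lemma block_split: "i < 4 \<Longrightarrow> tape \<sigma> = block \<sigma> 0 i @ \<sigma> i @ SP # block \<sigma> (Suc i) 4"
proof -
  assume "i < 4"
  then have "[0..<4] = [0..<i] @ i # [Suc i..<4]"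
    by (metis append_Cons append_Nil le_add_same_cancel1 less_imp_le_nat upt_add_eq_append upt_conv_Cons zero_le add.commute add_diff_inverse_nat less_le_not_le)
  then show ?thesis by simp
qed

lemma set_block: "ok_regs \<sigma> \<Longrightarrow> j \<le> 4 \<Longrightarrow> set (block \<sigma> i j) \<subseteq> {1, 2, 3, SP}"
proof
  fix x assume "ok_regs \<sigma>" "j \<le> 4" "x \<in> set (block \<sigma> i j)"
  then obtain l where "l < j" "x \<in> set (\<sigma> l) \<or> x = SP"
    by (auto split: if_splits)
  then have "l < 4" using \<open>j \<le> 4\<close> by linarith
  with \<open>ok_regs \<sigma>\<close> \<open>x \<in> set (\<sigma> l) \<or> x = SP\<close>
  show "x \<in> {1, 2, 3, SP}" unfolding ok_regs_def by blast
qed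

lemma tape_upd: 
  "i < 4 \<Longrightarrow> tape (\<sigma>(i := x)) = block \<sigma> 0 i @ x @ SP # block \<sigma> (Suc i) 4"
proof -
  assume "i < 4"
  moreover have "block (\<sigma>(i := x)) 0 i = block \<sigma> 0 i" "block (\<sigma>(i := x)) (Suc i) 4 = block \<sigma> (Suc i) 4"
    by (auto intro!: arg_cong[where f=concat] simp del: fun_upd_apply simp add: fun_upd_other)
  ultimately show ?thesis using block_split[of i "\<sigma>(i := x)"] by simp
qed

lemma msteps_Seek:
  assumes "\<forall>i<n. SP \<notin> set (\<sigma> (m + i))"
  shows "msteps p (length (block \<sigma> m (m + n))) (Seek n K, ls, block \<sigma> m (m + n) @ rs) =
    (Seek 0 K, rev (block \<sigma> m (m + n)) @ ls, rs)"
  using assms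
proof (induction n arbitrary: m ls)
  case (Suc n)
  have *: "block \<sigma> m (m + Suc n) = \<sigma> m @ SP # block \<sigma> (Suc m) (Suc m + n)"
    by (simp add: upt_rec[of m])
  have "msteps p (length (\<sigma> m)) (Seek (Suc n) K, ls, \<sigma> m @ SP # block \<sigma> (Suc m) (Suc m + n) @ rs) =
     (Seek (Suc n) K, rev (\<sigma> m) @ ls, SP # block \<sigma> (Suc m) (Suc m + n) @ rs)"
    using Suc.prems[rule_format, of 0] by (intro msteps_right) auto
  moreover have "mstep p (Seek (Suc n) K, rev (\<sigma> m) @ ls, SP # block \<sigma> (Suc m) (Suc m + n) @ rs) =
     (Seek n K, SP # rev (\<sigma> m) @ ls, block \<sigma> (Suc m) (Suc m + n) @ rs)"
    by (simp add: mstep_simps(1)[where q'="Seek n K" and b=SP])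
  moreover have "msteps p (length (block \<sigma> (Suc m) (Suc m + n)))
       (Seek n K, SP # rev (\<sigma> m) @ ls, block \<sigma> (Suc m) (Suc m + n) @ rs) =
     (Seek 0 K, rev (block \<sigma> (Suc m) (Suc m + n)) @ SP # rev (\<sigma> m) @ ls, rs)"
    using Suc.prems by (intro Suc.IH) (metis Suc_less_eq add_Suc_shift)
  ultimately have "msteps p (length (\<sigma> m) + (1 + length (block \<sigma> (Suc m) (Suc m + n))))
     (Seek (Suc n) K, ls, \<sigma> m @ SP # block \<sigma> (Suc m) (Suc m + n) @ rs) =
     (Seek 0 K, rev (block \<sigma> (Suc m) (Suc m + n)) @ SP # rev (\<sigma> m) @ ls, rs)"
    by (blast intro: funpow_trans funpow_one)
  then show ?case unfolding * by simp
qed simp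

text \<open>The number \<open>z\<close> of explicit trailing blanks changes with every insertion and
  deletion and carries no information; the simulation lemmas quantify it existentially.\<close>

abbreviation repr :: "cmd list \<Rightarrow> regs \<Rightarrow> nat \<Rightarrow> mconf" where
  "repr K \<sigma> z \<equiv> (At K, [], LM # tape \<sigma> @ replicate z 0)"

lemma msteps_reach:
  assumes "ok_regs \<sigma>" "i < 4" "\<And>b. locate K b = (Seek i K, b, MoveR)"
  shows "msteps p (1 + length (block \<sigma> 0 i)) (repr K \<sigma> z) =
    (Seek 0 K, rev (block \<sigma> 0 i) @ [LM], \<sigma> i @ SP # block \<sigma> (Suc i) 4 @ replicate z 0)"
proof -
  have "mstep p (repr K \<sigma> z) = (Seek i K, [LM], tape \<sigma> @ replicate z 0)"
    by (subst mstep_simps(1)[where q'="Seek i K" and b=LM]) (simp_all only: assms(3) trans_fun.simps first_simps append_Cons list.sel, simp_all)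
  moreover have "msteps p (length (block \<sigma> 0 (0 + i))) (Seek i K, [LM], block \<sigma> 0 (0 + i) @
      \<sigma> i @ SP # block \<sigma> (Suc i) 4 @ replicate z 0) =
    (Seek 0 K, rev (block \<sigma> 0 (0 + i)) @ [LM], \<sigma> i @ SP # block \<sigma> (Suc i) 4 @ replicate z 0)"
  proof (rule msteps_Seek, intro allI impI)
    fix l assume "l < i"
    then have "set (\<sigma> (0 + l)) \<subseteq> {1, 2, 3}" using assms(1,2) unfolding ok_regs_def by simp
    then show "SP \<notin> set (\<sigma> (0 + l))" by auto
  qed
  moreover have eq: "tape \<sigma> @ replicate z 0 = block \<sigma> 0 (0 + i) @ \<sigma> i @ SP # block \<sigma> (Suc i) 4 @ replicate z 0"
    using block_split[OF assms(2), of \<sigma>] by simp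
  ultimately have "msteps p (1 + length (block \<sigma> 0 (0 + i))) (repr K \<sigma> z) =
    (Seek 0 K, rev (block \<sigma> 0 (0 + i)) @ [LM], \<sigma> i @ SP # block \<sigma> (Suc i) 4 @ replicate z 0)"
    unfolding eq by (blast intro: funpow_trans funpow_one)
  then show ?thesis by simp
qed

lemma ok_regs_cstep:
  assumes "ok_regs \<sigma>" "\<forall>c\<in>set K. wf_cmd c" "cstep (K, \<sigma>) = (K', \<sigma>')"
  shows "ok_regs \<sigma>' \<and> (\<forall>c\<in>set K'. wf_cmd c)"
proof -
  have upd: "ok_regs (\<sigma>(i := w))" if "set w \<subseteq> {1, 2, 3}" for i w
    using assms(1) that by (simp add: ok_regs_def)
  have reg: "set (\<sigma> i) \<subseteq> {1, 2, 3}" if "i < 4" for i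
    using assms(1) that by (simp add: ok_regs_def)
  have tl: "set (tl w) \<subseteq> set w" for w :: "nat list" by (cases w) auto
  show ?thesis
  proof (cases "(K, \<sigma>)" rule: cstep.cases)
    case (3 i a K0 \<sigma>0)
    then show ?thesis using assms reg[of i] upd[of "a # \<sigma> i" i] by auto
  next
    case (4 i K0 \<sigma>0)
    then show ?thesis using assms reg[of i] order.trans[OF tl reg[of i]] upd[of "tl (\<sigma> i)" i] by auto
  qed (use assms in \<open>auto split: if_splits\<close>)
qed

lemma length_tape_cstep:
  assumes "\<forall>c\<in>set K. wf_cmd c" "cstep (K, \<sigma>) = (K', \<sigma>')"
  shows "length (tape \<sigma>') \<le> length (tape \<sigma>) + 1"
proof -
  have L: "length (tape (\<sigma>(i := w))) + length (\<sigma> i) = length (tape \<sigma>) + length w" if "i < 4" for i w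
    by (simp only: tape_upd[OF that] block_split[OF that, of \<sigma>] length_append list.size)
  have "i < 4 \<Longrightarrow> length (tape (\<sigma>(i := a # \<sigma> i))) \<le> length (tape \<sigma>) + 1"
    "i < 4 \<Longrightarrow> length (tape (\<sigma>(i := tl (\<sigma> i)))) \<le> length (tape \<sigma>) + 1" for i a
    using L[of i "a # \<sigma> i"] L[of i "tl (\<sigma> i)"] by (simp_all del: fun_upd_apply length_concat)
  then show ?thesis
    using assms by (cases "(K, \<sigma>)" rule: cstep.cases) (auto simp del: fun_upd_apply split: if_splits)
qed

lemma msteps_Ret':
  assumes "ok_regs \<sigma>" "i < 4" "b # w = \<sigma> i @ SP # block \<sigma> (Suc i) 4"
  shows "msteps p (length (block \<sigma> 0 i) + 2)
     (Ret K, rev (block \<sigma> 0 i) @ [LM], b # w @ replicate z 0) = repr K \<sigma> z"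
proof -
  have "set (tape \<sigma>) \<subseteq> {1, 2, 3, SP}" using set_block[OF assms(1)] by blast
  then have "LM \<notin> set (tape \<sigma>)" by auto
  then have "LM \<notin> set (block \<sigma> 0 i)" "LM \<notin> set (b # w)"
    unfolding block_split[OF assms(2)] assms(3)[symmetric] by auto
  then have "msteps p (length (block \<sigma> 0 i) + 2) (Ret K, rev (block \<sigma> 0 i) @ [LM], b # (w @ replicate z 0)) =
      (At K, [], LM # block \<sigma> 0 i @ b # w @ replicate z 0)"
    by (intro msteps_Ret) auto
  moreover have "block \<sigma> 0 i @ b # w @ replicate z 0 = tape \<sigma> @ replicate z 0"
    unfolding block_split[OF assms(2)] append_assoc append_Cons[symmetric] assms(3) by simp
  ultimately show ?thesis by simp
qed

lemma mstep_one: "mstep p c = c' \<Longrightarrow> msteps p 1 c = c'"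
  by simp

text \<open>Every command that touches a register is one round trip from the left marker:
  \<open>reach\<close> brings the head to the register, \<open>test\<close> treats the commands that
  only inspect its first symbol, and \<open>Push\<close> and \<open>Pop\<close> shift everything to
  the right of it. Each pass is linear in the tape length.\<close>

lemma cstep_sim:
  assumes ok: "ok_regs \<sigma>" and wf: "\<forall>c\<in>set K. wf_cmd c" and ne: "K \<noteq> []"
    and step: "cstep (K, \<sigma>) = (K', \<sigma>')"
  shows "\<exists>n z'. n \<le> 4 * length (tape \<sigma>) + 8 \<and> msteps p n (repr K \<sigma> z) = repr K' \<sigma>' z'"
proof -
  obtain c K0 where K: "K = c # K0" using ne by (cases K) auto
  have tape: "set (tape \<sigma>) \<subseteq> {1, 2, 3, SP}" using set_block[OF ok] by blast
  have reach: "\<exists>b w. b # w = \<sigma> i @ SP # block \<sigma> (Suc i) 4 \<and> (if b = SP then 0 else b) = first (\<sigma> i) \<and>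
      length (tape \<sigma>) = length (block \<sigma> 0 i) + 1 + length w \<and> set (b # w) \<subseteq> {1, 2, 3, SP} \<and>
      LM \<notin> set (block \<sigma> 0 i) \<and>
      msteps p (1 + length (block \<sigma> 0 i)) (repr K \<sigma> z) =
        (Seek 0 K, rev (block \<sigma> 0 i) @ [LM], b # w @ replicate z 0)"
    if i: "i < 4" and l: "\<And>b. locate K b = (Seek i K, b, MoveR)" for i
  proof -
    obtain b w where bw: "b # w = \<sigma> i @ SP # block \<sigma> (Suc i) 4" by (cases "\<sigma> i") auto
    have tp: "tape \<sigma> = block \<sigma> 0 i @ b # w" unfolding bw by (rule block_split[OF i])
    have "set (\<sigma> i) \<subseteq> {1, 2, 3}" using ok i unfolding ok_regs_def by blast
    then have "(if b = SP then 0 else b) = first (\<sigma> i)" using bw by (cases "\<sigma> i") auto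
    moreover have "msteps p (1 + length (block \<sigma> 0 i)) (repr K \<sigma> z) =
        (Seek 0 K, rev (block \<sigma> 0 i) @ [LM], b # w @ replicate z 0)"
      using msteps_reach[OF ok i l, of p z] bw by (metis append_Cons append_assoc)
    moreover have "length (tape \<sigma>) = length (block \<sigma> 0 i) + 1 + length w"
      unfolding tp by simp
    moreover have "set (block \<sigma> 0 i) \<subseteq> {1, 2, 3, SP}" "set (b # w) \<subseteq> {1, 2, 3, SP}"
      using tape unfolding tp set_append by blast+
    moreover from this(1) have "LM \<notin> set (block \<sigma> 0 i)"
      using subsetD[of "set (block \<sigma> 0 i)" "{1, 2, 3, SP}" LM] by (auto simp del: set_concat)
    ultimately show ?thesis using bw by blast
  qed
  have test: "\<exists>n z'. n \<le> 4 * length (tape \<sigma>) + 8 \<and> msteps p n (repr K \<sigma> z) = repr K' \<sigma>' z'"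
    if i: "i < 4" and l: "\<And>b. locate K b = (Seek i K, b, MoveR)" and \<sigma>': "\<sigma>' = \<sigma>"
      and a: "\<And>b. (if b = SP then 0 else b) = first (\<sigma> i) \<Longrightarrow> act K b = (Ret K', b, Stay)" for i
  proof -
    from reach[OF i l] obtain b w where bw: "b # w = \<sigma> i @ SP # block \<sigma> (Suc i) 4"
      "(if b = SP then 0 else b) = first (\<sigma> i)"
      "length (tape \<sigma>) = length (block \<sigma> 0 i) + 1 + length w"
      "msteps p (1 + length (block \<sigma> 0 i)) (repr K \<sigma> z) =
        (Seek 0 K, rev (block \<sigma> 0 i) @ [LM], b # w @ replicate z 0)" by blast
    have "mstep p (Seek 0 K, rev (block \<sigma> 0 i) @ [LM], b # w @ replicate z 0) =
       (Ret K', rev (block \<sigma> 0 i) @ [LM], b # w @ replicate z 0)"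
      using a[OF bw(2)] by (subst mstep_simps(2)[of _ _ _ "Ret K'" b]) simp_all
    note N = funpow_trans[OF bw(4) funpow_trans[OF mstep_one[OF this] msteps_Ret'[OF ok i bw(1)]]]
    have "1 + length (block \<sigma> 0 i) + (1 + (length (block \<sigma> 0 i) + 2)) \<le> 4 * length (tape \<sigma>) + 8"
      using bw(3) by simp
    with N show ?thesis unfolding \<sigma>' by blast
  qed
  show ?thesis
  proof (cases c)
    case Skip
    then show ?thesis using step K
      by (intro exI[of _ 1] exI[of _ z]) (auto simp: mstep_simps(2)[where q'="At K0" and b=LM] locate_def)
  next
    case (Seq x y)
    then show ?thesis using step K
      by (intro exI[of _ 1] exI[of _ z]) (auto simp: mstep_simps(2)[where q'="At (x # y # K0)" and b=LM] locate_def)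
  next
    case (Push i a)
    then have i: "i < 4" and a: "a \<in> {1, 2, 3}" using wf K by auto
    have K': "K' = K0" and \<sigma>': "\<sigma>' = \<sigma>(i := a # \<sigma> i)" using Push step K by auto
    have l: "\<And>b. locate K b = (Seek i K, b, MoveR)" using Push K by (simp add: locate_def)
    from reach[OF i l] obtain b w where bw: "b # w = \<sigma> i @ SP # block \<sigma> (Suc i) 4"
      "(if b = SP then 0 else b) = first (\<sigma> i)"
      "length (tape \<sigma>) = length (block \<sigma> 0 i) + 1 + length w" "set (b # w) \<subseteq> {1, 2, 3, SP}"
      "LM \<notin> set (block \<sigma> 0 i)"
      "msteps p (1 + length (block \<sigma> 0 i)) (repr K \<sigma> z) =
        (Seek 0 K, rev (block \<sigma> 0 i) @ [LM], b # w @ replicate z 0)" by blast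
    \<comment> \<open>After the shift the head stands on the last symbol of the block, so
      \<open>b # w\<close> is split at its end.\<close>
    obtain w' l where w': "w' @ [l] = b # w" by (metis list.distinct(1) rev_exhaust)
    then have lw: "length w' = length w" by (metis length_append_singleton length_Cons Suc_inject)
    have s: "set w' \<union> {l} \<subseteq> {1, 2, 3, SP}" using bw(4) w'[symmetric] by auto
    have 1: "mstep p (Seek 0 K, rev (block \<sigma> 0 i) @ [LM], b # w @ replicate z 0) =
       (Ins b K0, a # rev (block \<sigma> 0 i) @ [LM], w @ replicate z 0)"
      using Push K by (subst mstep_simps(1)[of _ _ _ "Ins b K0" a]) (simp_all add: act_def)
    have 2: "msteps p (Suc (length w)) (Ins b K0, a # rev (block \<sigma> 0 i) @ [LM], w @ replicate z 0) =
       (Ret K0, rev w' @ a # rev (block \<sigma> 0 i) @ [LM], l # replicate (z - 1) 0)"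
      using bw(4) by (intro msteps_Ins w') auto
    have 3: "msteps p (length (block \<sigma> 0 i @ a # w') + 2)
         (Ret K0, rev (block \<sigma> 0 i @ a # w') @ [LM], l # replicate (z - 1) 0) =
       (At K0, [], LM # (block \<sigma> 0 i @ a # w') @ l # replicate (z - 1) 0)"
      using bw(5) a s by (intro msteps_Ret) auto
    have 4: "(block \<sigma> 0 i @ a # w') @ l # replicate (z - 1) 0 = tape \<sigma>' @ replicate (z - 1) 0"
      unfolding \<sigma>' tape_upd[OF i] using bw(1) w' by simp
    have 2: "msteps p (Suc (length w)) (Ins b K0, a # rev (block \<sigma> 0 i) @ [LM], w @ replicate z 0) =
       (Ret K0, rev (block \<sigma> 0 i @ a # w') @ [LM], l # replicate (z - 1) 0)"
      unfolding 2 by simp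
    note N = funpow_trans[OF bw(6) funpow_trans[OF mstep_one[OF 1] funpow_trans[OF 2 3]], unfolded 4]
    have "1 + length (block \<sigma> 0 i) + (1 + (Suc (length w) + (length (block \<sigma> 0 i @ a # w') + 2)))
        \<le> 4 * length (tape \<sigma>) + 8"
      using bw(3) lw by simp
    with N show ?thesis unfolding K' by blast
  next
    case (Pop i)
    then have i: "i < 4" using wf K by auto
    have K': "K' = K0" and \<sigma>': "\<sigma>' = \<sigma>(i := tl (\<sigma> i))" using Pop step K by auto
    have l: "\<And>b. locate K b = (Seek i K, b, MoveR)" using Pop K by (simp add: locate_def)
    show ?thesis
    proof (cases "\<sigma> i")
      case Nil
      have "act K b = (Ret K', b, Stay)" if "(if b = SP then 0 else b) = first (\<sigma> i)" "b \<noteq> 0" for b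
        using that Pop K K' Nil by (auto simp: act_def split: if_splits)
      from reach[OF i l] obtain b w where bw: "b # w = \<sigma> i @ SP # block \<sigma> (Suc i) 4"
        "length (tape \<sigma>) = length (block \<sigma> 0 i) + 1 + length w"
        "msteps p (1 + length (block \<sigma> 0 i)) (repr K \<sigma> z) =
          (Seek 0 K, rev (block \<sigma> 0 i) @ [LM], b # w @ replicate z 0)" by blast
      have "b = SP" using bw(1) Nil by simp
      then have "mstep p (Seek 0 K, rev (block \<sigma> 0 i) @ [LM], b # w @ replicate z 0) =
         (Ret K', rev (block \<sigma> 0 i) @ [LM], b # w @ replicate z 0)"
        using K K' Pop by (subst mstep_simps(2)[of _ _ _ "Ret K'" b]) (simp_all add: act_def)
      note N = funpow_trans[OF bw(3) funpow_trans[OF mstep_one[OF this] msteps_Ret'[OF ok i bw(1)]]]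
      have "\<sigma>' = \<sigma>" using \<sigma>' Nil by (simp add: fun_upd_idem)
      moreover have "1 + length (block \<sigma> 0 i) + (1 + (length (block \<sigma> 0 i) + 2)) \<le> 4 * length (tape \<sigma>) + 8"
        using bw(2) by simp
      ultimately show ?thesis using N by blast
    next
      case (Cons a r)
      from reach[OF i l] obtain b w where bw: "b # w = \<sigma> i @ SP # block \<sigma> (Suc i) 4"
        "length (tape \<sigma>) = length (block \<sigma> 0 i) + 1 + length w" "set (b # w) \<subseteq> {1, 2, 3, SP}"
        "LM \<notin> set (block \<sigma> 0 i)"
        "msteps p (1 + length (block \<sigma> 0 i)) (repr K \<sigma> z) =
          (Seek 0 K, rev (block \<sigma> 0 i) @ [LM], b # w @ replicate z 0)" by blast
      have w: "b = a" "w = r @ SP # block \<sigma> (Suc i) 4" using bw(1) Cons by auto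
      have "a \<in> {1, 2, 3}" using ok i Cons unfolding ok_regs_def by fastforce
      then have 1: "mstep p (Seek 0 K, rev (block \<sigma> 0 i) @ [LM], b # w @ replicate z 0) =
         (DelR K0, DM # rev (block \<sigma> 0 i) @ [LM], w @ replicate z 0)"
        using K Pop w(1) by (subst mstep_simps(1)[of _ _ _ "DelR K0" DM]) (auto simp: act_def)
      have 2: "msteps p (2 * length w + 2) (DelR K0, DM # rev (block \<sigma> 0 i) @ [LM], w @ replicate z 0) =
         (Ret K0, rev (block \<sigma> 0 i) @ [LM], w @ 0 # 0 # replicate (z - 1) 0)"
      proof (intro msteps_Del)
        show "DM \<notin> set w" "0 \<notin> set w" using bw(3) by auto
        show "w \<noteq> []" using w(2) by simp
      qed
      obtain b' w' where bw': "w = b' # w'" using w(2) by (metis append_is_Nil_conv list.distinct(1) list.exhaust)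
      have 3: "msteps p (length (block \<sigma> 0 i) + 2)
          (Ret K0, rev (block \<sigma> 0 i) @ [LM], b' # (w' @ 0 # 0 # replicate (z - 1) 0)) =
         (At K0, [], LM # block \<sigma> 0 i @ b' # w' @ 0 # 0 # replicate (z - 1) 0)"
        using bw(3,4) bw' by (intro msteps_Ret) auto
      have 4: "block \<sigma> 0 i @ b' # w' @ 0 # 0 # replicate (z - 1) 0 = tape \<sigma>' @ replicate (z - 1 + 2) 0"
        unfolding \<sigma>' tape_upd[OF i] using w bw' Cons by (simp add: append_eq_append_conv2)
      have 2: "msteps p (2 * length w + 2) (DelR K0, DM # rev (block \<sigma> 0 i) @ [LM], w @ replicate z 0) =
         (Ret K0, rev (block \<sigma> 0 i) @ [LM], b' # (w' @ 0 # 0 # replicate (z - 1) 0))"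
        unfolding 2 using bw' by simp
      note N = funpow_trans[OF bw(5) funpow_trans[OF mstep_one[OF 1] funpow_trans[OF 2 3]], unfolded 4]
      have "1 + length (block \<sigma> 0 i) + (1 + (2 * length w + 2 + (length (block \<sigma> 0 i) + 2)))
          \<le> 4 * length (tape \<sigma>) + 8"
        using bw(2) by simp
      with N show ?thesis unfolding K' by blast
    qed
  next
    case (Branch i A x y)
    then show ?thesis using K wf step by (intro test[of i]) (auto simp: locate_def act_def)
  next
    case (Loop i A x)
    then show ?thesis using K wf step by (intro test[of i]) (auto simp: locate_def act_def)
  qed
qed

text \<open>The tape grows by at most one cell per command step, so each of the t rounds is linear
  in the initial length plus t. This is where the quadratic overhead of the compilation
  arises.\<close>

lemma csteps_sim:
  assumes "ok_regs \<sigma>" "\<forall>c\<in>set K. wf_cmd c" "(cstep ^^ t) (K, \<sigma>) = ([], \<sigma>')"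
  shows "\<exists>n z'. n \<le> t * (4 * (length (tape \<sigma>) + t) + 8) \<and> msteps p n (repr K \<sigma> z) = repr [] \<sigma>' z' \<and>
    ok_regs \<sigma>' \<and> length (tape \<sigma>') \<le> length (tape \<sigma>) + t"
  using assms
proof (induction t arbitrary: K \<sigma> z)
  case 0
  then show ?case by (intro exI[of _ 0] exI[of _ z]) auto
next
  case (Suc t)
  show ?case
  proof (cases "K = []")
    case True
    have "(cstep ^^ n) ([], \<sigma>) = ([], \<sigma>)" for n by (induction n) auto
    then show ?thesis using True Suc.prems by (intro exI[of _ 0] exI[of _ z]) (auto simp del: funpow.simps)
  next
    case False
    obtain K1 \<sigma>1 where st: "cstep (K, \<sigma>) = (K1, \<sigma>1)" by fastforce
    obtain n z1 where n: "n \<le> 4 * length (tape \<sigma>) + 8" "msteps p n (repr K \<sigma> z) = repr K1 \<sigma>1 z1"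
      using cstep_sim[OF Suc.prems(1,2) False st] by blast
    have len: "length (tape \<sigma>1) \<le> length (tape \<sigma>) + 1"
      by (rule length_tape_cstep[OF Suc.prems(2) st])
    have "(cstep ^^ t) (K1, \<sigma>1) = ([], \<sigma>')" using Suc.prems(3) st by (simp add: funpow_swap1)
    then obtain m z' where m: "m \<le> t * (4 * (length (tape \<sigma>1) + t) + 8)"
      "msteps p m (repr K1 \<sigma>1 z1) = repr [] \<sigma>' z'" "ok_regs \<sigma>'" "length (tape \<sigma>') \<le> length (tape \<sigma>1) + t"
      using Suc.IH ok_regs_cstep[OF Suc.prems(1,2) st] by meson
    have "n + m \<le> (4 * (length (tape \<sigma>) + Suc t) + 8) + t * (4 * (length (tape \<sigma>) + Suc t) + 8)"
    proof (rule add_mono)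
      show "m \<le> t * (4 * (length (tape \<sigma>) + Suc t) + 8)"
        using len by (intro order.trans[OF m(1)] mult_le_mono2) simp
    qed (use n(1) in simp)
    then show ?thesis using funpow_trans[OF n(2) m(2)] m(3,4) len
      by (intro exI[of _ "n + m"] exI[of _ z']) auto
  qed
qed

definition regs0 :: "nat list \<Rightarrow> regs" where
  "regs0 w = (\<lambda>_. [])(0 := w)"

lemma tape_regs0: "tape (regs0 w) = w @ [SP, SP, SP, SP]"
  by (simp add: regs0_def numeral_eq_Suc)

lemma msteps_init:
  assumes "w \<noteq> []" "set w \<subseteq> {1, 2, 3}"
  shows "msteps p (2 * length w + 11) (I0, [], w) = repr [p] (regs0 w) 0"
proof -
  have 1: "mstep p (I0, [], w) = (I1, [], 0 # w)"
    using assms(1) by (cases w) (simp_all add: mstep_simps(4)[where q'=I1])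
  have 2: "mstep p (I1, [], 0 # w) = (I2, [LM], w)" by (simp add: mstep_simps(1)[where q'=I2])
  have "msteps p (length w) (I2, [LM], w @ []) = (I2, rev w @ [LM], [])"
    using assms(2) by (intro msteps_right) auto
  then have 3: "msteps p (length w) (I2, [LM], w) = (I2, rev w @ [LM], [])" by simp
  have 4: "mstep p (I2, rev w @ [LM], []) = (I3 2, SP # rev w @ [LM], [])"
    by (simp add: mstep_simps(1)[where q'="I3 2"])
  have 5: "mstep p (I3 2, SP # rev w @ [LM], []) = (I3 1, SP # SP # rev w @ [LM], [])"
    by (simp add: mstep_simps(1)[where q'="I3 1"])
  have 6: "mstep p (I3 1, SP # SP # rev w @ [LM], []) = (I3 0, SP # SP # SP # rev w @ [LM], [])"
    by (simp add: mstep_simps(1)[where q'="I3 0"])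
  have 7: "mstep p (I3 0, SP # SP # SP # rev w @ [LM], []) = (Ret [p], SP # SP # SP # rev w @ [LM], [SP])"
    by (simp add: mstep_simps(2)[where q'="Ret [p]"])
  have "msteps p (length (w @ [SP, SP, SP]) + 2) (Ret [p], rev (w @ [SP, SP, SP]) @ [LM], [SP]) =
     (At [p], [], LM # (w @ [SP, SP, SP]) @ [SP])"
    using assms(2) by (intro msteps_Ret) auto
  moreover have "length (w @ [SP, SP, SP]) + 2 = length w + 5" by simp
  ultimately have 8: "msteps p (length w + 5) (Ret [p], SP # SP # SP # rev w @ [LM], [SP]) = repr [p] (regs0 w) 0"
    unfolding tape_regs0 by (simp only:) simp
  have "msteps p (1 + (1 + (length w + (1 + (1 + (1 + (1 + (length w + 5)))))))) (I0, [], w) =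
      repr [p] (regs0 w) 0"
    by (rule funpow_trans[OF mstep_one[OF 1] funpow_trans[OF mstep_one[OF 2] funpow_trans[OF 3
      funpow_trans[OF mstep_one[OF 4] funpow_trans[OF mstep_one[OF 5] funpow_trans[OF mstep_one[OF 6]
      funpow_trans[OF mstep_one[OF 7] 8]]]]]]])
  moreover have "1 + (1 + (length w + (1 + (1 + (1 + (1 + (length w + 5))))))) = 2 * length w + 11" by simp
  ultimately show ?thesis by (simp only:)
qed

lemma msteps_final:
  assumes "ok_regs \<sigma>"
  shows "\<exists>v. msteps p (2 * length (\<sigma> 0) + 4) (repr [] \<sigma> z) = (Halt, [LM], \<sigma> 0 @ 0 # v)"
proof -
  let ?v = "block \<sigma> 1 4 @ replicate z 0"
  have s: "set (\<sigma> 0) \<subseteq> {1, 2, 3}" using assms unfolding ok_regs_def by simp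
  have 1: "mstep p (repr [] \<sigma> z) = (F1, [LM], \<sigma> 0 @ SP # ?v)"
    using block_split[of 0 \<sigma>] by (simp add: mstep_simps(1)[where q'=F1] locate_def)
  have 2: "msteps p (length (\<sigma> 0)) (F1, [LM], \<sigma> 0 @ SP # ?v) = (F1, rev (\<sigma> 0) @ [LM], SP # ?v)"
    using s by (intro msteps_right) auto
  have "\<exists>v. msteps p (1 + length (\<sigma> 0)) (F1, rev (\<sigma> 0) @ [LM], SP # ?v) = (F2, [], LM # \<sigma> 0 @ 0 # v)"
  proof (cases "\<sigma> 0" rule: rev_cases)
    case Nil
    then show ?thesis by (simp add: mstep_simps(3)[where q'=F2])
  next
    case (snoc u b)
    have a: "mstep p (F1, rev (\<sigma> 0) @ [LM], SP # ?v) = (F2, rev u @ [LM], b # 0 # ?v)"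
      using snoc by (simp add: mstep_simps(3)[where q'=F2])
    have "msteps p (Suc (length u)) (F2, rev u @ LM # [], b # (0 # ?v)) = (F2, [], LM # u @ b # 0 # ?v)"
      using s snoc by (intro msteps_left) auto
    from funpow_trans[OF mstep_one[OF a] this] show ?thesis using snoc by auto
  qed
  then obtain v where 3: "msteps p (1 + length (\<sigma> 0)) (F1, rev (\<sigma> 0) @ [LM], SP # ?v) =
      (F2, [], LM # \<sigma> 0 @ 0 # v)" by blast
  have 4: "mstep p (F2, [], LM # \<sigma> 0 @ 0 # v) = (Halt, [LM], \<sigma> 0 @ 0 # v)"
    by (simp add: mstep_simps(1)[where q'=Halt])
  have 5: "mstep p (Halt, [LM], \<sigma> 0 @ 0 # v) = (Halt, [LM], \<sigma> 0 @ 0 # v)" by (simp add: mstep_def)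
  have "msteps p (1 + (length (\<sigma> 0) + ((1 + length (\<sigma> 0)) + (1 + 1)))) (repr [] \<sigma> z) =
      (Halt, [LM], \<sigma> 0 @ 0 # v)"
    by (rule funpow_trans[OF mstep_one[OF 1] funpow_trans[OF 2 funpow_trans[OF 3
      funpow_trans[OF mstep_one[OF 4] mstep_one[OF 5]]]]])
  moreover have "1 + (length (\<sigma> 0) + ((1 + length (\<sigma> 0)) + (1 + 1))) = 2 * length (\<sigma> 0) + 4" by simp
  ultimately have "msteps p (2 * length (\<sigma> 0) + 4) (repr [] \<sigma> z) = (Halt, [LM], \<sigma> 0 @ 0 # v)" by (simp only:)
  then show ?thesis by blast
qed

text \<open>The continuations that can occur during the execution of a command are finite in number,
  so that they can be stored in the finite control.\<close>

fun conts :: "cmd \<Rightarrow> cmd list \<Rightarrow> cmd list set" where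
  "conts (Seq c d) K = insert (Seq c d # K) (conts c (d # K) \<union> conts d K)"
| "conts (Branch i A c d) K = insert (Branch i A c d # K) (conts c K \<union> conts d K)"
| "conts (Loop i A c) K = insert (Loop i A c # K) (conts c (Loop i A c # K))"
| "conts c K = {c # K}"

lemma finite_conts: "finite (conts c K)"
  by (induction c arbitrary: K) auto

lemma self_conts: "c # K \<in> conts c K"
  by (cases c) auto

lemma wf_conts: "wf_cmd c \<Longrightarrow> \<forall>d\<in>set K. wf_cmd d \<Longrightarrow> L \<in> conts c K \<Longrightarrow> d \<in> set L \<Longrightarrow> wf_cmd d"
proof (induction c arbitrary: K)
  case (Seq c1 c2)
  then show ?case using Seq.IH(1)[of "c2 # K"] Seq.IH(2)[of K] by auto
next
  case (Loop i A c)
  then show ?case using Loop.IH[of "Loop i A c # K"] by auto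
qed auto

fun cnext :: "cmd list \<Rightarrow> cmd list set" where
  "cnext [] = {}"
| "cnext (Seq c d # K) = {c # d # K}"
| "cnext (Branch i A c d # K) = {c # K, d # K}"
| "cnext (Loop i A c # K) = {c # Loop i A c # K, K}"
| "cnext (c # K) = {K}"

text \<open>This keeps the control finite. The critical case is \<open>Loop\<close>: its body runs
  with the loop itself pushed back, which recreates a continuation already present instead of a
  longer one.\<close>

lemma cnext_conts: "L \<in> conts c K \<Longrightarrow> cnext L \<subseteq> insert K (conts c K)"
proof (induction c arbitrary: K)
  case (Seq c1 c2)
  then show ?case using Seq.IH(1)[of "c2 # K"] Seq.IH(2)[of K] self_conts[of c1 "c2 # K"] self_conts[of c2 K] by auto
next
  case (Branch i A c1 c2)
  then show ?case using Branch.IH(1)[of K] Branch.IH(2)[of K] self_conts[of c1 K] self_conts[of c2 K] by auto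
next
  case (Loop i A c)
  then show ?case using Loop.IH[of "Loop i A c # K"] self_conts[of c "Loop i A c # K"] by auto
qed auto

definition mstates :: "cmd \<Rightarrow> mst set" where
  "mstates p = (let C = insert [] (conts p []) in
     {I0, I1, I2, F1, F2, Halt} \<union> I3 ` {..2} \<union> At ` C \<union> Ret ` C \<union> DelR ` C \<union>
     case_prod Seek ` ({..<4} \<times> C) \<union> case_prod Ins ` ({..<7} \<times> C) \<union> case_prod DelL ` ({..<7} \<times> C))"

lemma finite_mstates: "finite (mstates p)"
  by (simp add: mstates_def Let_def finite_conts)

lemma mstates_simps [simp]:
  "I0 \<in> mstates p" "I1 \<in> mstates p" "I2 \<in> mstates p" "F1 \<in> mstates p" "F2 \<in> mstates p" "Halt \<in> mstates p"
  "I3 n \<in> mstates p \<longleftrightarrow> n \<le> 2"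
  "At K \<in> mstates p \<longleftrightarrow> K \<in> insert [] (conts p [])"
  "Ret K \<in> mstates p \<longleftrightarrow> K \<in> insert [] (conts p [])"
  "DelR K \<in> mstates p \<longleftrightarrow> K \<in> insert [] (conts p [])"
  "Seek n K \<in> mstates p \<longleftrightarrow> n < 4 \<and> K \<in> insert [] (conts p [])"
  "Ins n K \<in> mstates p \<longleftrightarrow> n < 7 \<and> K \<in> insert [] (conts p [])"
  "DelL n K \<in> mstates p \<longleftrightarrow> n < 7 \<and> K \<in> insert [] (conts p [])"
  unfolding mstates_def Let_def by auto

lemma trans_fun_closed:
  assumes wf: "wf_cmd p" and q: "q \<in> mstates p" and b: "b < 7"
  shows "fst (trans_fun p q b) \<in> mstates p \<and> fst (snd (trans_fun p q b)) < 7"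
proof -
  have nx: "\<And>L. L \<in> cnext K \<Longrightarrow> L = [] \<or> L \<in> conts p []" if "K = [] \<or> K \<in> conts p []" for K
    using that cnext_conts[of K p "[]"] by auto
  have w: "wf_cmd c" if "c # K \<in> conts p []" for c K
    using wf_conts[OF wf _ that, of c] by simp
  have "fst (locate K b) \<in> mstates p \<and> fst (snd (locate K b)) < 7" if "K = [] \<or> K \<in> conts p []" for K
    using that nx[OF that] b w
    by (cases K rule: cnext.cases) (fastforce simp: locate_def)+
  moreover have "fst (act K b) \<in> mstates p \<and> fst (snd (act K b)) < 7" if "K = [] \<or> K \<in> conts p []" for K
    using that nx[OF that] b w
    by (cases K rule: cnext.cases) (fastforce simp: act_def)+
  ultimately show ?thesis using q b
    by (cases q) (auto simp: self_conts)
qed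

text \<open>The finitely many symbolic states are numbered injectively, with 0 and 1 reserved for
  the start and the halting state and all others shifted by 2. The invariant that states and symbols
  remain within the finite sets allows every step to be transferred.\<close>

lemma mstep_tm:
  assumes wf: "wf_cmd p"
  shows "\<exists>M e. tm_valid M \<and> e I0 = 0 \<and> e Halt = 1 \<and>
    (\<forall>q ls rs n. q \<in> mstates p \<longrightarrow> set ls \<union> set rs \<subseteq> {..<7} \<longrightarrow>
       (tm_step M ^^ n) (e q, ls, rs) = (case msteps p n (q, ls, rs) of (q', ls', rs') \<Rightarrow> (e q', ls', rs')))"
proof -
  let ?S = "mstates p"
  obtain f n0 where f: "inj_on f (?S - {I0, Halt})" "f ` (?S - {I0, Halt}) = {i. i < (n0 :: nat)}"
    using finite_imp_inj_to_nat_seg[OF finite_Diff[OF finite_mstates[of p], of "{I0, Halt}"]] by blast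
  define e where "e q = (if q = I0 then 0 else if q = Halt then 1 else f q + 2)" for q
  have inj: "inj_on e ?S"
  proof (rule inj_onI)
    fix x y assume xy: "x \<in> ?S" "y \<in> ?S" "e x = e y"
    show "x = y"
    proof (cases "x \<in> {I0, Halt} \<or> y \<in> {I0, Halt}")
      case True
      with xy(3) show ?thesis by (auto simp: e_def split: if_splits)
    next
      case False
      with xy show ?thesis using inj_onD[OF f(1), of x y] by (simp add: e_def)
    qed
  qed
  \<comment> \<open>Numbers that name no state get an arbitrary legal transition, because
    \<open>tm_valid\<close> speaks about all numbers below the bound.\<close>
  define M :: tm where "M n a = (if n \<in> e ` ?S \<and> a < 7 then
     (case trans_fun p (inv_into ?S e n) a of (q', b, d) \<Rightarrow> (e q', b, d)) else (0, 0, Stay))" for n a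
  have M: "M (e q) a = (case trans_fun p q a of (q', b, d) \<Rightarrow> (e q', b, d))" if "q \<in> ?S" "a < 7" for q a
    using that inj by (simp add: M_def)
  define NQ where "NQ = Suc (Max (e ` ?S))"
  have eNQ: "e q < NQ" if "q \<in> ?S" for q
    using that finite_mstates[of p] by (simp add: NQ_def less_Suc_eq_le)
  have "e Halt < NQ" using eNQ by simp
  have valid: "tm_valid M"
    unfolding tm_valid_def
  proof (rule exI[of _ NQ], rule exI[of _ 7], intro conjI allI impI)
    show "2 \<le> NQ" using \<open>e Halt < NQ\<close> by (simp add: e_def split: if_splits)
    fix q a assume "q < NQ" "a < (7 :: nat)"
    consider "q \<notin> e ` ?S" | q0 where "q = e q0" "q0 \<in> ?S" by blast
    then have "fst (M q a) < NQ \<and> fst (snd (M q a)) < 7"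
    proof cases
      case 1
      then show ?thesis using \<open>e Halt < NQ\<close> by (simp add: M_def)
    next
      case 2
      then show ?thesis using M[of q0 a] trans_fun_closed[OF wf 2(2) \<open>a < 7\<close>] \<open>a < 7\<close> eNQ
        by (auto split: prod.splits)
    qed
    then show "fst (M q a) < NQ" "fst (snd (M q a)) < 7" by auto
  qed simp
  have step: "tm_step M (e q, ls, rs) = (case mstep p (q, ls, rs) of (q', ls', rs') \<Rightarrow> (e q', ls', rs'))
      \<and> (\<forall>q' ls' rs'. mstep p (q, ls, rs) = (q', ls', rs') \<longrightarrow> q' \<in> ?S \<and> set ls' \<union> set rs' \<subseteq> {..<7})"
    if "q \<in> ?S" "set ls \<union> set rs \<subseteq> {..<7}" for q ls rs
  proof (cases "q = Halt")
    case True
    then show ?thesis using that by (simp add: tm_step_def mstep_def e_def)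
  next
    case False
    have "e q \<noteq> e Halt" using inj_onD[OF inj, of q Halt] False that(1) by auto
    then have ne: "e q \<noteq> 1" by (simp add: e_def)
    have t: "first rs < 7" using that(2) by (cases rs) auto
    obtain q' b d where tr: "trans_fun p q (first rs) = (q', b, d)" using prod_cases3 by blast
    have cl: "q' \<in> ?S" "b < 7" using trans_fun_closed[OF wf that(1) t] tr by auto
    have tl: "set (tl rs) \<subseteq> {..<7}" using that(2) by (cases rs) auto
    have Mq: "M (e q) (first rs) = (e q', b, d)" using M[OF that(1) t] tr by simp
    have 1: "tm_step M (e q, ls, rs) = (case d of
        MoveL \<Rightarrow> (case ls of [] \<Rightarrow> (e q', [], 0 # b # tl rs) | x # ls' \<Rightarrow> (e q', ls', x # b # tl rs))
      | MoveR \<Rightarrow> (e q', b # ls, tl rs) | Stay \<Rightarrow> (e q', ls, b # tl rs))"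
      using ne by (simp only: tm_step_def prod.case if_False first_def[symmetric] Mq Let_def)
    have 2: "mstep p (q, ls, rs) = (case d of
        MoveL \<Rightarrow> (case ls of [] \<Rightarrow> (q', [], 0 # b # tl rs) | x # ls' \<Rightarrow> (q', ls', x # b # tl rs))
      | MoveR \<Rightarrow> (q', b # ls, tl rs) | Stay \<Rightarrow> (q', ls, b # tl rs))"
      using False by (simp only: mstep_def prod.case if_False tr Let_def)
    show ?thesis
      unfolding 1 2 using cl tl that(2) by (cases d; cases ls) simp_all
  qed
  have steps: "(tm_step M ^^ n) (e q, ls, rs) = (case msteps p n (q, ls, rs) of (q', ls', rs') \<Rightarrow> (e q', ls', rs'))
      \<and> (\<forall>q' ls' rs'. msteps p n (q, ls, rs) = (q', ls', rs') \<longrightarrow> q' \<in> ?S \<and> set ls' \<union> set rs' \<subseteq> {..<7})"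
    if "q \<in> ?S" "set ls \<union> set rs \<subseteq> {..<7}" for n q ls rs
  proof (induction n)
    case 0
    then show ?case using that by simp
  next
    case (Suc n)
    obtain q' ls' rs' where c: "msteps p n (q, ls, rs) = (q', ls', rs')" using prod_cases3 by blast
    with Suc have 1: "(tm_step M ^^ n) (e q, ls, rs) = (e q', ls', rs')"
      and 2: "q' \<in> ?S" "set ls' \<union> set rs' \<subseteq> {..<7}" by simp_all
    show ?case
      unfolding funpow.simps comp_apply 1 c by (rule step[OF 2])
  qed
  have e: "e I0 = 0" "e Halt = 1" by (simp_all add: e_def)
  show ?thesis
  proof (rule exI[of _ M], rule exI[of _ e], intro conjI allI impI)
    fix q and ls rs :: "nat list" and n assume "q \<in> ?S" "set ls \<union> set rs \<subseteq> {..<7}"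
    then show "(tm_step M ^^ n) (e q, ls, rs) = (case msteps p n (q, ls, rs) of (q', ls', rs') \<Rightarrow> (e q', ls', rs'))"
      using steps by blast
  qed (rule valid e)+
qed

text \<open>Initial pass, simulation and final pass are concatenated. The blank that the final pass
  writes behind register 0 is what \<open>takeWhile\<close> in \<open>halts_with\<close> stops at,
  since registers contain no 0.\<close>

theorem compile:
  assumes wf: "wf_cmd p"
  shows "\<exists>M. tm_valid M \<and> (\<forall>w t \<sigma>'. w \<noteq> [] \<longrightarrow> set w \<subseteq> {1, 2, 3} \<longrightarrow> runs p (regs0 w) t \<sigma>' \<longrightarrow>
    (\<exists>n \<le> 40 * (length w + t + 1)\<^sup>2. halts_with M n w (\<sigma>' 0)))"
proof -
  obtain M e where M: "tm_valid M" "e I0 = 0" "e Halt = 1" and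
    sim: "\<And>q ls rs n. q \<in> mstates p \<Longrightarrow> set ls \<union> set rs \<subseteq> {..<7} \<Longrightarrow>
      (tm_step M ^^ n) (e q, ls, rs) = (case msteps p n (q, ls, rs) of (q', ls', rs') \<Rightarrow> (e q', ls', rs'))"
    using mstep_tm[OF wf] by metis
  have "\<exists>n \<le> 40 * (length w + t + 1)\<^sup>2. halts_with M n w (\<sigma>' 0)"
    if w: "w \<noteq> []" "set w \<subseteq> {1, 2, 3}" and run: "runs p (regs0 w) t \<sigma>'" for w t \<sigma>'
  proof -
    have ok: "ok_regs (regs0 w)" using w(2) unfolding ok_regs_def regs0_def by (simp add: subset_iff)
    have "(cstep ^^ t) ([p], regs0 w) = ([], \<sigma>')" using run unfolding runs_def by blast
    then obtain n z where n: "n \<le> t * (4 * (length (tape (regs0 w)) + t) + 8)"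
      "msteps p n (repr [p] (regs0 w) 0) = repr [] \<sigma>' z" "ok_regs \<sigma>'"
      "length (tape \<sigma>') \<le> length (tape (regs0 w)) + t"
      using csteps_sim[OF ok, of "[p]" t \<sigma>' p 0] wf by auto
    obtain v where v: "msteps p (2 * length (\<sigma>' 0) + 4) (repr [] \<sigma>' z) = (Halt, [LM], \<sigma>' 0 @ 0 # v)"
      using msteps_final[OF n(3)] by blast
    define N where "N = 2 * length w + 11 + (n + (2 * length (\<sigma>' 0) + 4))"
    have "msteps p N (I0, [], w) = (Halt, [LM], \<sigma>' 0 @ 0 # v)"
      unfolding N_def by (intro funpow_trans[OF msteps_init[OF w] funpow_trans[OF n(2) v]])
    then have "tm_run M N w = (1, [LM], \<sigma>' 0 @ 0 # v)"
      using sim[of I0 "[]" w N] M(2,3) subset_trans[OF w(2), of "{..<7}"] by (simp add: tm_run_def)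
    moreover have "0 \<notin> set (\<sigma>' 0)" using n(3) unfolding ok_regs_def by fastforce
    then have "takeWhile (\<lambda>a. a \<noteq> 0) (\<sigma>' 0 @ 0 # v) = \<sigma>' 0"
      by (subst takeWhile_append2) (auto intro!: gr0I)
    ultimately have "halts_with M N w (\<sigma>' 0)" by (simp add: halts_with_def)
    moreover have "N \<le> 40 * (length w + t + 1)\<^sup>2"
    proof -
      have "length (\<sigma>' 0) \<le> length (tape \<sigma>')" using block_split[of 0 \<sigma>'] by simp
      also have "\<dots> \<le> length w + 4 + t" using n(4) by (simp add: tape_regs0)
      finally have "N \<le> t * (4 * (length w + 4 + t) + 8) + (2 * length w + 11 + 2 * (length w + 4 + t) + 4)"
        using n(1) unfolding N_def tape_regs0 by simp
      also have "\<dots> \<le> 40 * (length w + t + 1)\<^sup>2" by (simp add: power2_eq_square algebra_simps)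
      finally show ?thesis .
    qed
    ultimately show ?thesis by blast
  qed
  then show ?thesis using M(1) by blast
qed

section \<open>Time-bounded functions on tree-coded data\<close>

datatype tree = Lf | Nd tree tree

text \<open>Preorder notation with one symbol per node. It is self-delimiting, so values can be
  stacked in a register without separators.\<close>

fun tcode :: "tree \<Rightarrow> nat list" where
  "tcode Lf = [1]"
| "tcode (Nd a b) = 2 # tcode a @ tcode b"

class data =
  fixes encode :: "'a \<Rightarrow> tree"

abbreviation code :: "'a::data \<Rightarrow> nat list" where
  "code x \<equiv> tcode (encode x)"

definition sz :: "'a::data \<Rightarrow> nat" where
  "sz x = length (code x)"

instantiation unit :: data
begin
definition encode_unit :: "unit \<Rightarrow> tree" where "encode_unit _ = Lf"
instance ..
end

instantiation bool :: data
begin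
definition encode_bool :: "bool \<Rightarrow> tree" where "encode_bool b = (if b then Nd Lf Lf else Lf)"
instance ..
end

text \<open>Unary coding matches the tape format, where the parameter is unary too. It also makes a
  number look like a list of units, so that counting loops become list traversals.\<close>

instantiation nat :: data
begin
primrec encode_nat :: "nat \<Rightarrow> tree" where
  "encode_nat 0 = Lf"
| "encode_nat (Suc n) = Nd Lf (encode_nat n)"
instance ..
end

instantiation prod :: (data, data) data
begin
definition encode_prod :: "'a \<times> 'b \<Rightarrow> tree" where "encode_prod p = Nd (encode (fst p)) (encode (snd p))"
instance ..
end

fun tree_list :: "tree list \<Rightarrow> tree" where
  "tree_list [] = Lf"
| "tree_list (t # ts) = Nd t (tree_list ts)"

instantiation list :: (data) data
begin
definition encode_list :: "'a list \<Rightarrow> tree" where "encode_list xs = tree_list (map encode xs)"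
instance ..
end

instantiation option :: (data) data
begin
definition encode_option :: "'a option \<Rightarrow> tree" where
  "encode_option x = (case x of None \<Rightarrow> Lf | Some y \<Rightarrow> Nd (encode y) Lf)"
instance ..
end

lemma encode_simps [simp]:
  "encode () = Lf" "encode True = Nd Lf Lf" "encode False = Lf" "encode (x, y) = Nd (encode x) (encode y)"
  "encode [] = Lf" "encode (x # xs) = Nd (encode x) (encode xs)"
  "encode None = Lf" "encode (Some x) = Nd (encode x) Lf"
  by (simp_all add: encode_unit_def encode_bool_def encode_prod_def encode_list_def encode_option_def)

lemma tcode_ne [simp]: "tcode t \<noteq> []"
  by (cases t) auto

lemma set_tcode: "set (tcode t) \<subseteq> {1, 2}"
  by (induction t) auto

lemma sz_pos: "1 \<le> sz x"
  by (simp add: sz_def Suc_le_eq)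

lemma sz_simps [simp]:
  "sz (x, y) = 1 + sz x + sz y" "sz ([] :: 'a::data list) = 1" "sz (z # zs) = 1 + sz z + sz zs"
  "sz True = 3" "sz False = 1" "sz () = 1" "sz (None :: 'b::data option) = 1" "sz (Some x) = 2 + sz x"
  "sz (0 :: nat) = 1" "sz (Suc n) = 2 + sz n"
  by (simp_all add: sz_def)

lemma sz_nat [simp]: "sz (n :: nat) = 2 * n + 1"
  by (induction n) (simp_all del: sz_simps(9,10) add: sz_simps(9,10))

lemma sz_append: "sz (xs @ ys) + 1 = sz xs + sz (ys :: 'a::data list)"
  by (induction xs) auto

lemma length_less_sz: "length xs < sz (xs :: 'a::data list)"
  by (induction xs) auto

lemma sz_mem: "x \<in> set xs \<Longrightarrow> sz (x :: 'a::data) < sz xs"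
  by (induction xs) auto

lemma sz_list_le: "(\<And>x. x \<in> set xs \<Longrightarrow> sz x \<le> B) \<Longrightarrow> sz (xs :: 'a::data list) \<le> length xs * (B + 1) + 1"
proof (induction xs)
  case (Cons a xs)
  then have "sz a \<le> B" "sz xs \<le> length xs * (B + 1) + 1" by auto
  then show ?case by simp
qed simp

section \<open>Moving and copying codes between registers\<close>

abbreviation seqs :: "cmd list \<Rightarrow> cmd" where
  "seqs cs \<equiv> foldr Seq cs Skip"

declare fun_upd_apply [simp del] fun_upd_same [simp] fun_upd_other [simp]

text \<open>Moves the tree code at the front of register i, reversed, to register j, while register 2
  counts in unary the subtrees that are still to be read.\<close>

definition mv :: "nat \<Rightarrow> nat \<Rightarrow> cmd" where
  "mv i j = Seq (Push 2 1) (Loop 2 {1} (Branch i {2} (Seq (Pop i) (Seq (Push j 2) (Push 2 1)))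
     (Seq (Pop i) (Seq (Push j 1) (Pop 2)))))"

lemma runs_cong: "runs c \<sigma> t \<tau> \<Longrightarrow> t = t' \<Longrightarrow> \<tau> = \<tau>' \<Longrightarrow> runs c \<sigma> t' \<tau>'"
  by simp

lemma runs_cong1: "runs c \<sigma> t \<tau> \<Longrightarrow> \<sigma> = \<sigma>' \<Longrightarrow> runs c \<sigma>' t \<tau>"
  by simp

text \<open>The rest of the loop run is a premise, with its own time \<open>t\<close>, so that the
  induction on the tree never has to cut a loop run into pieces: reading one subtree just lowers the
  counter in register 2 by one. The factor 7 is the cost of one loop round, and each symbol takes
  one round.\<close>

lemma runs_mv_loop:
  assumes "i \<noteq> j" "i \<noteq> 2" "j \<noteq> 2" and L: "L = Loop 2 {1} (Branch i {2} (Seq (Pop i) (Seq (Push j 2) (Push 2 1)))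
     (Seq (Pop i) (Seq (Push j 1) (Pop 2))))"
    and "\<sigma> i = tcode a @ r" "\<sigma> 2 = 1 # k"
    and "runs L (\<sigma>(i := r, j := rev (tcode a) @ \<sigma> j, 2 := k)) t \<upsilon>"
  shows "runs L \<sigma> (7 * length (tcode a) + t) \<upsilon>"
  using assms(5-)
proof (induction a arbitrary: \<sigma> r k t)
  case Lf
  let ?\<tau> = "\<sigma>(i := r, j := 1 # \<sigma> j, 2 := k)"
  have "runs (Seq (Pop i) (Seq (Push j 1) (Pop 2))) \<sigma> 5 ?\<tau>"
    using Lf assms(1-3)
    by (intro runs_cong[OF runs_Seq[OF runs_Pop runs_Seq[OF runs_Push runs_Pop]]]) (auto simp: fun_eq_iff fun_upd_apply)
  then have "runs (Branch i {2} (Seq (Pop i) (Seq (Push j 2) (Push 2 1)))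
     (Seq (Pop i) (Seq (Push j 1) (Pop 2)))) \<sigma> (5 + 1) ?\<tau>"
    using Lf by (intro runs_Branch) simp
  moreover have "runs L ?\<tau> t \<upsilon>"
    by (rule runs_cong1[OF Lf(3)]) (auto simp: fun_eq_iff fun_upd_apply)
  ultimately have "runs L \<sigma> (5 + 1 + t + 1) \<upsilon>"
    unfolding L using Lf by (intro runs_Loop_step) auto
  then show ?case by (rule runs_cong) auto
next
  case (Nd a b)
  let ?\<tau> = "\<sigma>(i := tcode a @ tcode b @ r, j := 2 # \<sigma> j, 2 := 1 # 1 # k)"
  have "runs (Seq (Pop i) (Seq (Push j 2) (Push 2 1))) \<sigma> 5 ?\<tau>"
    using Nd.prems assms(1-3)
    by (intro runs_cong[OF runs_Seq[OF runs_Pop runs_Seq[OF runs_Push runs_Push]]]) (auto simp: fun_eq_iff fun_upd_apply)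
  then have 1: "runs (Branch i {2} (Seq (Pop i) (Seq (Push j 2) (Push 2 1)))
     (Seq (Pop i) (Seq (Push j 1) (Pop 2)))) \<sigma> (5 + 1) ?\<tau>"
    using Nd.prems by (intro runs_Branch) simp
  let ?\<tau>' = "\<sigma>(i := tcode b @ r, j := rev (tcode a) @ 2 # \<sigma> j, 2 := 1 # k)"
  have "runs L (?\<tau>'(i := r, j := rev (tcode b) @ ?\<tau>' j, 2 := k)) t \<upsilon>"
    by (rule runs_cong1[OF Nd.prems(3)]) (use assms(1-3) in \<open>auto simp: fun_eq_iff fun_upd_apply\<close>)
  then have "runs L ?\<tau>' (7 * length (tcode b) + t) \<upsilon>"
    using assms(1-3) by (intro Nd.IH(2)) auto
  then have "runs L (?\<tau>(i := tcode b @ r, j := rev (tcode a) @ ?\<tau> j, 2 := 1 # k)) (7 * length (tcode b) + t) \<upsilon>"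
    by (rule runs_cong1) (use assms(1-3) in \<open>auto simp: fun_eq_iff fun_upd_apply\<close>)
  then have "runs L ?\<tau> (7 * length (tcode a) + (7 * length (tcode b) + t)) \<upsilon>"
    using assms(1-3) by (intro Nd.IH(1)) auto
  then have "runs L \<sigma> (5 + 1 + (7 * length (tcode a) + (7 * length (tcode b) + t)) + 1) \<upsilon>"
    unfolding L using Nd.prems(2) by (intro runs_Loop_step[OF _ 1]) auto
  then show ?case by (rule runs_cong) auto
qed

lemma runs_mv:
  assumes "i \<noteq> j" "i \<noteq> 2" "j \<noteq> 2" "\<sigma> i = tcode a @ r" "\<sigma> 2 = []"
  shows "runs (mv i j) \<sigma> (7 * length (tcode a) + 3) (\<sigma>(i := r, j := rev (tcode a) @ \<sigma> j))"
proof -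
  let ?\<tau> = "\<sigma>(2 := 1 # \<sigma> 2)" and ?\<upsilon> = "\<sigma>(i := r, j := rev (tcode a) @ \<sigma> j)"
  let ?c = "Branch i {2} (Seq (Pop i) (Seq (Push j 2) (Push 2 1))) (Seq (Pop i) (Seq (Push j 1) (Pop 2)))"
  have eq: "?\<tau>(i := r, j := rev (tcode a) @ ?\<tau> j, 2 := []) = ?\<upsilon>"
    using assms by (auto simp: fun_eq_iff fun_upd_apply)
  have "runs (Loop 2 {1} ?c) (?\<tau>(i := r, j := rev (tcode a) @ ?\<tau> j, 2 := [])) 1 ?\<upsilon>"
    unfolding eq using assms by (intro runs_Loop_end) auto
  then have "runs (Loop 2 {1} ?c) ?\<tau> (7 * length (tcode a) + 1) ?\<upsilon>"
    using assms(2,4,5) by (intro runs_mv_loop[OF assms(1-3) refl]) auto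
  from runs_Seq[OF runs_Push this] show ?thesis
    unfolding mv_def by (rule runs_cong) auto
qed

definition pour :: "nat \<Rightarrow> nat \<Rightarrow> cmd" where
  "pour i j = Loop i {1, 2, 3} (Branch i {1} (Seq (Pop i) (Push j 1))
     (Branch i {2} (Seq (Pop i) (Push j 2)) (Seq (Pop i) (Push j 3))))"

lemma runs_pour:
  assumes "i \<noteq> j" "set w \<subseteq> {1, 2, 3}" "\<sigma> i = w"
  shows "\<exists>t \<le> 6 * length w + 1. runs (pour i j) \<sigma> t (\<sigma>(i := [], j := rev w @ \<sigma> j))"
  using assms(2-)
proof (induction w arbitrary: \<sigma>)
  case Nil
  then have "runs (pour i j) \<sigma> 1 \<sigma>" unfolding pour_def by (intro runs_Loop_end) auto
  then have "runs (pour i j) \<sigma> 1 (\<sigma>(i := [], j := rev [] @ \<sigma> j))"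
    by (rule runs_cong) (use Nil in \<open>auto simp: fun_eq_iff fun_upd_apply\<close>)
  then show ?case by (intro exI[of _ 1]) (simp del: fun_upd_apply)
next
  case (Cons a w)
  let ?\<tau> = "\<sigma>(i := w, j := a # \<sigma> j)"
  have *: "runs (Seq (Pop i) (Push j a)) \<sigma> 3 ?\<tau>"
    using assms(1) Cons.prems by (intro runs_cong[OF runs_Seq[OF runs_Pop runs_Push]]) (auto simp: fun_eq_iff fun_upd_apply)
  have "?\<tau> i = w" using assms(1) by simp
  have "\<exists>s \<le> 5. runs (Branch i {1} (Seq (Pop i) (Push j 1))
     (Branch i {2} (Seq (Pop i) (Push j 2)) (Seq (Pop i) (Push j 3)))) \<sigma> s ?\<tau>"
  proof (cases "a = 1")
    case True
    then show ?thesis using * Cons.prems by (intro exI[of _ "3 + 1"] conjI runs_Branch) auto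
  next
    case False
    then show ?thesis using * Cons.prems
      by (intro exI[of _ "3 + 1 + 1"] conjI runs_Branch) (auto intro!: runs_Branch[where t=3, simplified])
  qed
  then obtain s where s: "s \<le> 5" "runs (Branch i {1} (Seq (Pop i) (Push j 1))
     (Branch i {2} (Seq (Pop i) (Push j 2)) (Seq (Pop i) (Push j 3)))) \<sigma> s ?\<tau>" by blast
  obtain t where t: "t \<le> 6 * length w + 1" "runs (pour i j) ?\<tau> t (?\<tau>(i := [], j := rev w @ ?\<tau> j))"
    using Cons.IH[of ?\<tau>] Cons.prems(1) \<open>?\<tau> i = w\<close> by (meson set_subset_Cons subset_trans)
  have "first (\<sigma> i) \<in> {1, 2, 3}" using Cons.prems by auto
  from runs_Loop_step[OF this s(2), folded pour_def, OF t(2)]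
  have "runs (pour i j) \<sigma> (s + t + 1) (\<sigma>(i := [], j := rev (a # w) @ \<sigma> j))"
    by (rule runs_cong) (use assms(1) in \<open>auto simp: fun_eq_iff fun_upd_apply\<close>)
  then show ?case using s(1) t(1) by (intro exI[of _ "s + t + 1"]) auto
qed

definition clear :: cmd where "clear = Loop 1 {1, 2, 3} (Pop 1)"

lemma runs_clear: "set (\<sigma> 1) \<subseteq> {1, 2, 3} \<Longrightarrow> runs clear \<sigma> (2 * length (\<sigma> 1) + 1) (\<sigma>(1 := []))"
proof (induction "\<sigma> 1" arbitrary: \<sigma>)
  case Nil
  then show ?case unfolding clear_def
    by (intro runs_cong[OF runs_Loop_end]) (auto simp: fun_eq_iff fun_upd_apply)
next
  case (Cons a w)
  have "runs clear (\<sigma>(1 := w)) (2 * length ((\<sigma>(1 := w)) 1) + 1) ((\<sigma>(1 := w))(1 := []))"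
    using Cons(3) unfolding Cons(2)[symmetric] by (intro Cons(1)) auto
  then have "runs clear (\<sigma>(1 := w)) (2 * length w + 1) (\<sigma>(1 := []))" by simp
  moreover have "tl (\<sigma> 1) = w" using Cons(2) by (metis list.sel(3))
  then have "runs (Pop 1) \<sigma> 1 (\<sigma>(1 := w))" using runs_Pop[of 1 \<sigma>] by simp
  moreover have "first (\<sigma> 1) \<in> {1, 2, 3}" using Cons(2,3) by (metis list.set_intros(1) subsetD first_simps(2))
  ultimately have "runs clear \<sigma> (1 + (2 * length w + 1) + 1) (\<sigma>(1 := []))"
    unfolding clear_def by (intro runs_Loop_step)
  then show ?case using Cons(2)[symmetric] by simp
qed

text \<open>Register 3 serves as a second stack. A code passes through register 1 and is reversed
  twice, hence arrives in its original order. \<open>dup\<close> reads the reversed code once and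
  pushes it to registers 0 and 3 at the same time.\<close>

definition to_R :: cmd where "to_R = Seq (mv 0 1) (pour 1 3)"
definition from_R :: cmd where "from_R = Seq (mv 3 1) (pour 1 0)"
definition drop_top :: cmd where "drop_top = Seq (mv 0 1) clear"
definition dup :: cmd where
  "dup = Seq (mv 0 1) (Seq (Loop 1 {1, 2} (Branch 1 {1} (Seq (Pop 1) (Seq (Push 0 1) (Push 3 1)))
     (Seq (Pop 1) (Seq (Push 0 2) (Push 3 2))))) from_R)"

definition pushes :: "nat list \<Rightarrow> cmd" where
  "pushes w = seqs (map (Push 0) (rev w))"

lemma wf_macros [simp]:
  "wf_cmd to_R" "wf_cmd from_R" "wf_cmd drop_top" "wf_cmd dup"
  by (simp_all add: to_R_def from_R_def drop_top_def dup_def mv_def pour_def clear_def)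

lemma wf_seqs [simp]: "wf_cmd (seqs cs) \<longleftrightarrow> (\<forall>c\<in>set cs. wf_cmd c)"
  by (induction cs) auto

lemma wf_pushes: "set w \<subseteq> {1, 2, 3} \<Longrightarrow> wf_cmd (pushes w)"
  by (auto simp: pushes_def)

lemma set_tcode3: "set (tcode t) \<subseteq> {1, 2, 3}"
  using set_tcode by fastforce

lemma runs_to_R:
  assumes "\<sigma> 0 = tcode a @ r" "\<sigma> 1 = []" "\<sigma> 2 = []"
  shows "\<exists>t \<le> 18 * length (tcode a). runs to_R \<sigma> t (\<sigma>(0 := r, 3 := tcode a @ \<sigma> 3))"
proof -
  let ?\<tau> = "\<sigma>(0 := r, 1 := rev (tcode a) @ \<sigma> 1)"
  have 1: "runs (mv 0 1) \<sigma> (7 * length (tcode a) + 3) ?\<tau>" using assms by (intro runs_mv) auto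
  obtain t where t: "t \<le> 6 * length (tcode a) + 1" "runs (pour 1 3) ?\<tau> t (?\<tau>(1 := [], 3 := tcode a @ ?\<tau> 3))"
    using runs_pour[of 1 3 "rev (tcode a)" ?\<tau>] set_tcode3 assms by auto
  have "runs to_R \<sigma> (7 * length (tcode a) + 3 + t + 1) (\<sigma>(0 := r, 3 := tcode a @ \<sigma> 3))"
    unfolding to_R_def by (rule runs_cong[OF runs_Seq[OF 1 t(2)]]) (use assms in \<open>auto simp: fun_eq_iff fun_upd_apply\<close>)
  moreover have "1 \<le> length (tcode a)" by (simp add: Suc_le_eq)
  ultimately show ?thesis using t(1) by (intro exI[of _ "7 * length (tcode a) + 3 + t + 1"]) auto
qed

lemma runs_from_R:
  assumes "\<sigma> 3 = tcode a @ r" "\<sigma> 1 = []" "\<sigma> 2 = []"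
  shows "\<exists>t \<le> 18 * length (tcode a). runs from_R \<sigma> t (\<sigma>(3 := r, 0 := tcode a @ \<sigma> 0))"
proof -
  let ?\<tau> = "\<sigma>(3 := r, 1 := rev (tcode a) @ \<sigma> 1)"
  have 1: "runs (mv 3 1) \<sigma> (7 * length (tcode a) + 3) ?\<tau>" using assms by (intro runs_mv) auto
  obtain t where t: "t \<le> 6 * length (tcode a) + 1" "runs (pour 1 0) ?\<tau> t (?\<tau>(1 := [], 0 := tcode a @ ?\<tau> 0))"
    using runs_pour[of 1 0 "rev (tcode a)" ?\<tau>] set_tcode3 assms by auto
  have "runs from_R \<sigma> (7 * length (tcode a) + 3 + t + 1) (\<sigma>(3 := r, 0 := tcode a @ \<sigma> 0))"
    unfolding from_R_def by (rule runs_cong[OF runs_Seq[OF 1 t(2)]]) (use assms in \<open>auto simp: fun_eq_iff fun_upd_apply\<close>)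
  moreover have "1 \<le> length (tcode a)" by (simp add: Suc_le_eq)
  ultimately show ?thesis using t(1) by (intro exI[of _ "7 * length (tcode a) + 3 + t + 1"]) auto
qed

lemma runs_drop_top:
  assumes "\<sigma> 0 = tcode a @ r" "\<sigma> 1 = []" "\<sigma> 2 = []"
  shows "\<exists>t \<le> 18 * length (tcode a). runs drop_top \<sigma> t (\<sigma>(0 := r))"
proof -
  let ?\<tau> = "\<sigma>(0 := r, 1 := rev (tcode a) @ \<sigma> 1)"
  have 1: "runs (mv 0 1) \<sigma> (7 * length (tcode a) + 3) ?\<tau>" using assms by (intro runs_mv) auto
  have 2: "runs clear ?\<tau> (2 * length (?\<tau> 1) + 1) (?\<tau>(1 := []))"
    using assms set_tcode3 by (intro runs_clear) auto
  have "runs drop_top \<sigma> (7 * length (tcode a) + 3 + (2 * length (tcode a) + 1) + 1) (\<sigma>(0 := r))"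
    unfolding drop_top_def by (rule runs_cong[OF runs_Seq[OF 1 2]]) (use assms in \<open>auto simp: fun_eq_iff fun_upd_apply\<close>)
  moreover have "1 \<le> length (tcode a)" by (simp add: Suc_le_eq)
  ultimately show ?thesis by (intro exI[of _ "7 * length (tcode a) + 3 + (2 * length (tcode a) + 1) + 1"]) auto
qed

lemma runs_dup:
  assumes "\<sigma> 0 = tcode a @ r" "\<sigma> 1 = []" "\<sigma> 2 = []"
  shows "\<exists>t \<le> 40 * length (tcode a). runs dup \<sigma> t (\<sigma>(0 := tcode a @ tcode a @ r))"
proof -
  let ?c = "Loop 1 {1, 2} (Branch 1 {1} (Seq (Pop 1) (Seq (Push 0 1) (Push 3 1)))
     (Seq (Pop 1) (Seq (Push 0 2) (Push 3 2))))"
  let ?\<tau> = "\<sigma>(0 := r, 1 := rev (tcode a) @ \<sigma> 1)"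
  have 1: "runs (mv 0 1) \<sigma> (7 * length (tcode a) + 3) ?\<tau>" using assms by (intro runs_mv) auto
  have loop: "runs ?c \<sigma> (7 * length w + 1) (\<sigma>(1 := [], 0 := rev w @ \<sigma> 0, 3 := rev w @ \<sigma> 3))"
    if "set w \<subseteq> {1, 2}" "\<sigma> 1 = w" for w \<sigma>
    using that
  proof (induction w arbitrary: \<sigma>)
    case Nil
    then show ?case by (intro runs_cong[OF runs_Loop_end]) (auto simp: fun_eq_iff fun_upd_apply)
  next
    case (Cons b w)
    let ?\<tau> = "\<sigma>(1 := w, 0 := b # \<sigma> 0, 3 := b # \<sigma> 3)"
    have "runs (Seq (Pop 1) (Seq (Push 0 b) (Push 3 b))) \<sigma> 5 ?\<tau>"
      using Cons.prems
      by (intro runs_cong[OF runs_Seq[OF runs_Pop runs_Seq[OF runs_Push runs_Push]]]) (auto simp: fun_eq_iff fun_upd_apply)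
    then have b: "runs (Branch 1 {1} (Seq (Pop 1) (Seq (Push 0 1) (Push 3 1)))
     (Seq (Pop 1) (Seq (Push 0 2) (Push 3 2)))) \<sigma> (5 + 1) ?\<tau>"
      using Cons.prems by (intro runs_Branch) auto
    have i: "runs ?c ?\<tau> (7 * length w + 1) (?\<tau>(1 := [], 0 := rev w @ ?\<tau> 0, 3 := rev w @ ?\<tau> 3))"
      using Cons.prems by (intro Cons.IH) auto
    have "first (\<sigma> 1) \<in> {1, 2}" using Cons.prems by auto
    from runs_Loop_step[OF this b i] show ?case
      by (rule runs_cong) (auto simp: fun_eq_iff fun_upd_apply)
  qed
  let ?\<upsilon> = "\<sigma>(0 := tcode a @ r, 3 := tcode a @ \<sigma> 3)"
  have 2: "runs ?c ?\<tau> (7 * length (tcode a) + 1) ?\<upsilon>"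
    using set_tcode[of a] assms
    by (intro runs_cong[OF loop[of "rev (tcode a)"]]) (auto simp: fun_eq_iff fun_upd_apply)
  obtain t where t: "t \<le> 18 * length (tcode a)" "runs from_R ?\<upsilon> t (?\<upsilon>(3 := \<sigma> 3, 0 := tcode a @ ?\<upsilon> 0))"
    using runs_from_R[of ?\<upsilon> a "\<sigma> 3"] assms by auto
  have "runs dup \<sigma> (7 * length (tcode a) + 3 + (7 * length (tcode a) + 1 + t + 1) + 1) (\<sigma>(0 := tcode a @ tcode a @ r))"
    unfolding dup_def by (rule runs_cong[OF runs_Seq[OF 1 runs_Seq[OF 2 t(2)]]]) (auto simp: fun_eq_iff fun_upd_apply)
  moreover have "1 \<le> length (tcode a)" by (simp add: Suc_le_eq)
  ultimately show ?thesis using t(1)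
    by (intro exI[of _ "7 * length (tcode a) + 3 + (7 * length (tcode a) + 1 + t + 1) + 1"]) auto
qed

lemma runs_pushes: "runs (pushes w) \<sigma> (2 * length w + 1) (\<sigma>(0 := w @ \<sigma> 0))"
  unfolding pushes_def
proof (induction w arbitrary: \<sigma> rule: rev_induct)
  case Nil
  then show ?case using runs_Skip by simp
next
  case (snoc a w)
  show ?case
    using runs_Seq[OF runs_Push snoc.IH, of 0 a \<sigma>] by simp
qed


text \<open>A program for \<^term>\<open>f\<close> replaces the code of its argument at the front of register 0 by the code
  of the result. Registers 1 and 2 are scratch, and register 3 is left as it was, so that
  programs may keep intermediate results there and in the rest of register 0.\<close>

definition implements :: "cmd \<Rightarrow> 'a::data set \<Rightarrow> ('a \<Rightarrow> 'b::data) \<Rightarrow> ('a \<Rightarrow> nat) \<Rightarrow> bool" where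
  "implements p D f T \<longleftrightarrow> wf_cmd p \<and> (\<forall>x\<in>D. \<forall>\<sigma> r. \<sigma> 0 = code x @ r \<longrightarrow> \<sigma> 1 = [] \<longrightarrow> \<sigma> 2 = [] \<longrightarrow>
     (\<exists>t \<le> T x. runs p \<sigma> t (\<sigma>(0 := code (f x) @ r))))"

text \<open>The domain \<open>D\<close> admits programs that are correct only on some arguments,
  such as destructors on nonempty data or loops that stop only from certain states.\<close>

definition timed :: "'a::data set \<Rightarrow> ('a \<Rightarrow> 'b::data) \<Rightarrow> ('a \<Rightarrow> nat) \<Rightarrow> bool" where
  "timed D f T \<longleftrightarrow> (\<exists>p. implements p D f T)"

section \<open>Programs for composition, pairing, case distinction and loops\<close>

lemma implementsI:
  assumes "wf_cmd p"
    "\<And>x \<sigma> r. x \<in> D \<Longrightarrow> \<sigma> 0 = code x @ r \<Longrightarrow> \<sigma> 1 = [] \<Longrightarrow> \<sigma> 2 = [] \<Longrightarrow>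
       \<exists>t \<le> T x. runs p \<sigma> t (\<sigma>(0 := code (f x) @ r))"
  shows "implements p D f T"
  using assms unfolding implements_def by blast

lemma implementsE:
  assumes "implements p D f T" "x \<in> D" "\<sigma> 0 = code x @ r" "\<sigma> 1 = []" "\<sigma> 2 = []"
  obtains t where "t \<le> T x" "runs p \<sigma> t (\<sigma>(0 := code (f x) @ r))"
  using assms unfolding implements_def by blast

lemma timed_mono: "timed D f T \<Longrightarrow> D' \<subseteq> D \<Longrightarrow> (\<And>x. x \<in> D' \<Longrightarrow> T x \<le> T' x) \<Longrightarrow> timed D' f T'"
  unfolding timed_def implements_def by (meson order.trans subset_iff)

text \<open>A function that leaves the code unchanged costs nothing but a \<open>Skip\<close>. This
  yields the constructors: a list cell, a successor and \<open>Some\<close> all have the code of a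
  suitable pair.\<close>

lemma timed_recode:
  assumes "\<And>x. x \<in> D \<Longrightarrow> encode (f x) = encode x"
  shows "timed D f (\<lambda>_. 1)"
  unfolding timed_def
  by (rule exI[of _ Skip], rule implementsI) (use assms runs_Skip in \<open>auto intro!: exI[of _ 1] simp: fun_upd_idem\<close>)

text \<open>Formulated on codes, so that a single program serves \<open>fst\<close>,
  \<open>hd\<close> and \<open>the\<close>, and also the tag of a formula.\<close>

lemma timed_fst':
  assumes "\<And>x. x \<in> D \<Longrightarrow> \<exists>t. encode x = Nd (encode (f x)) t"
  shows "timed D f (\<lambda>x. 60 * sz x)"
  unfolding timed_def
proof (rule exI[of _ "Seq (Pop 0) (Seq to_R (Seq drop_top from_R))"], rule implementsI)
  fix x r and \<sigma> :: regs assume x: "x \<in> D" and \<sigma>: "\<sigma> 0 = code x @ r" "\<sigma> 1 = []" "\<sigma> 2 = []"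
  obtain u where u: "encode x = Nd (encode (f x)) u" using assms x by blast
  let ?\<sigma>1 = "\<sigma>(0 := code (f x) @ tcode u @ r)"
  let ?\<sigma>2 = "\<sigma>(0 := tcode u @ r, 3 := code (f x) @ \<sigma> 3)"
  let ?\<sigma>3 = "\<sigma>(0 := r, 3 := code (f x) @ \<sigma> 3)"
  have 1: "runs (Pop 0) \<sigma> 1 ?\<sigma>1" by (rule runs_cong[OF runs_Pop]) (use u \<sigma> in simp_all)
  obtain t2 where 2: "t2 \<le> 18 * length (code (f x))" "runs to_R ?\<sigma>1 t2 ?\<sigma>2"
    using runs_to_R[of ?\<sigma>1 "encode (f x)" "tcode u @ r"] \<sigma> by auto
  obtain t3 where 3: "t3 \<le> 18 * length (tcode u)" "runs drop_top ?\<sigma>2 t3 (?\<sigma>2(0 := r))"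
    using runs_drop_top[of ?\<sigma>2 u r] \<sigma> by auto
  have 3: "t3 \<le> 18 * length (tcode u)" "runs drop_top ?\<sigma>2 t3 ?\<sigma>3"
    using 3 by (auto elim!: runs_cong simp: fun_eq_iff fun_upd_apply)
  obtain t4 where 4: "t4 \<le> 18 * length (code (f x))" "runs from_R ?\<sigma>3 t4 (?\<sigma>3(3 := \<sigma> 3, 0 := code (f x) @ ?\<sigma>3 0))"
    using runs_from_R[of ?\<sigma>3 "encode (f x)" "\<sigma> 3"] \<sigma> by auto
  have "runs (Seq (Pop 0) (Seq to_R (Seq drop_top from_R))) \<sigma> (1 + (t2 + (t3 + t4 + 1) + 1) + 1) (\<sigma>(0 := code (f x) @ r))"
    by (rule runs_cong[OF runs_Seq[OF 1 runs_Seq[OF 2(2) runs_Seq[OF 3(2) 4(2)]]]])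
      (auto simp: fun_eq_iff fun_upd_apply)
  moreover have "sz x = 1 + length (code (f x)) + length (tcode u)" by (simp add: sz_def u)
  ultimately show "\<exists>t \<le> 60 * sz x. runs (Seq (Pop 0) (Seq to_R (Seq drop_top from_R))) \<sigma> t (\<sigma>(0 := code (f x) @ r))"
    using 2(1) 3(1) 4(1) by (intro exI conjI) (auto)
qed simp

lemma timed_snd':
  assumes "\<And>x. x \<in> D \<Longrightarrow> \<exists>t. encode x = Nd t (encode (f x))"
  shows "timed D f (\<lambda>x. 60 * sz x)"
  unfolding timed_def
proof (rule exI[of _ "Seq (Pop 0) drop_top"], rule implementsI)
  fix x r and \<sigma> :: regs assume x: "x \<in> D" and \<sigma>: "\<sigma> 0 = code x @ r" "\<sigma> 1 = []" "\<sigma> 2 = []"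
  obtain u where u: "encode x = Nd u (encode (f x))" using assms x by blast
  let ?\<sigma>1 = "\<sigma>(0 := tcode u @ code (f x) @ r)"
  have 1: "runs (Pop 0) \<sigma> 1 ?\<sigma>1" by (rule runs_cong[OF runs_Pop]) (use u \<sigma> in simp_all)
  obtain t where t: "t \<le> 18 * length (tcode u)" "runs drop_top ?\<sigma>1 t (?\<sigma>1(0 := code (f x) @ r))"
    using runs_drop_top[of ?\<sigma>1 u "code (f x) @ r"] \<sigma> by auto
  have "runs (Seq (Pop 0) drop_top) \<sigma> (1 + t + 1) (\<sigma>(0 := code (f x) @ r))"
    by (rule runs_cong[OF runs_Seq[OF 1 t(2)]]) auto
  moreover have "sz x = 1 + length (code (f x)) + length (tcode u)" by (simp add: sz_def u)
  ultimately show "\<exists>t \<le> 60 * sz x. runs (Seq (Pop 0) drop_top) \<sigma> t (\<sigma>(0 := code (f x) @ r))"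
    using t(1) by (intro exI conjI) (auto)
qed simp

lemma timed_const: "timed D (\<lambda>_. c) (\<lambda>x. 20 * sz x + 2 * sz c)"
  unfolding timed_def
proof (rule exI[of _ "Seq drop_top (pushes (code c))"], rule implementsI)
  fix x r and \<sigma> :: regs assume x: "x \<in> D" and \<sigma>: "\<sigma> 0 = code x @ r" "\<sigma> 1 = []" "\<sigma> 2 = []"
  obtain t where t: "t \<le> 18 * length (code x)" "runs drop_top \<sigma> t (\<sigma>(0 := r))"
    using runs_drop_top \<sigma> by blast
  have "runs (Seq drop_top (pushes (code c))) \<sigma> (t + (2 * length (code c) + 1) + 1) (\<sigma>(0 := code c @ r))"
    by (rule runs_cong[OF runs_Seq[OF t(2) runs_pushes]]) auto
  then show "\<exists>t \<le> 20 * sz x + 2 * sz c. runs (Seq drop_top (pushes (code c))) \<sigma> t (\<sigma>(0 := code c @ r))"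
    using t(1) sz_pos[of x] by (intro exI conjI) (auto simp: sz_def)
qed (simp add: wf_pushes[OF set_tcode3])

lemma timed_o:
  assumes "timed D f Tf" "timed E g Tg" "f ` D \<subseteq> E"
  shows "timed D (\<lambda>x. g (f x)) (\<lambda>x. Tf x + Tg (f x) + 1)"
proof -
  obtain p q where pq: "implements p D f Tf" "implements q E g Tg"
    using assms unfolding timed_def by blast
  have "implements (Seq p q) D (\<lambda>x. g (f x)) (\<lambda>x. Tf x + Tg (f x) + 1)"
  proof (rule implementsI)
    show "wf_cmd (Seq p q)" using pq by (auto simp: implements_def)
    fix x r and \<sigma> :: regs assume x: "x \<in> D" and \<sigma>: "\<sigma> 0 = code x @ r" "\<sigma> 1 = []" "\<sigma> 2 = []"
    obtain s where s: "s \<le> Tf x" "runs p \<sigma> s (\<sigma>(0 := code (f x) @ r))"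
      using implementsE[OF pq(1) x \<sigma>] by blast
    obtain t where t: "t \<le> Tg (f x)" "runs q (\<sigma>(0 := code (f x) @ r)) t ((\<sigma>(0 := code (f x) @ r))(0 := code (g (f x)) @ r))"
      using implementsE[OF pq(2), of "f x" "\<sigma>(0 := code (f x) @ r)" r] x \<sigma> assms(3) by auto
    show "\<exists>t \<le> Tf x + Tg (f x) + 1. runs (Seq p q) \<sigma> t (\<sigma>(0 := code (g (f x)) @ r))"
      using runs_Seq[OF s(2) t(2)] s(1) t(1) by (intro exI[of _ "s + t + 1"]) auto
  qed
  then show ?thesis unfolding timed_def by blast
qed

text \<open>The second component is computed while a copy of the argument waits in register 3; the
  copy is then put on top of the result and turned into the first component. Two adjacent codes with
  the symbol 2 in front form the code of the pair.\<close>

lemma timed_pair: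
  assumes "timed D f Tf" "timed D g Tg"
  shows "timed D (\<lambda>x. (f x, g x)) (\<lambda>x. Tf x + Tg x + 90 * sz x)"
proof -
  obtain p q where pq: "implements p D f Tf" "implements q D g Tg"
    using assms unfolding timed_def by blast
  let ?c = "Seq dup (Seq to_R (Seq q (Seq from_R (Seq p (Push 0 2)))))"
  have "implements ?c D (\<lambda>x. (f x, g x)) (\<lambda>x. Tf x + Tg x + 90 * sz x)"
  proof (rule implementsI)
    show "wf_cmd ?c" using pq by (auto simp: implements_def)
    fix x r and \<sigma> :: regs assume x: "x \<in> D" and \<sigma>: "\<sigma> 0 = code x @ r" "\<sigma> 1 = []" "\<sigma> 2 = []"
    let ?\<sigma>1 = "\<sigma>(0 := code x @ code x @ r)"
    let ?\<sigma>2 = "\<sigma>(0 := code x @ r, 3 := code x @ \<sigma> 3)"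
    let ?\<sigma>3 = "\<sigma>(0 := code (g x) @ r, 3 := code x @ \<sigma> 3)"
    let ?\<sigma>4 = "\<sigma>(0 := code x @ code (g x) @ r)"
    let ?\<sigma>5 = "\<sigma>(0 := code (f x) @ code (g x) @ r)"
    obtain t1 where 1: "t1 \<le> 40 * length (code x)" "runs dup \<sigma> t1 ?\<sigma>1"
      using runs_dup \<sigma> by blast
    obtain t2 where 2: "t2 \<le> 18 * length (code x)" "runs to_R ?\<sigma>1 t2 ?\<sigma>2"
      using runs_to_R[of ?\<sigma>1 "encode x" "code x @ r"] \<sigma> by auto
    obtain t3 where "t3 \<le> Tg x" "runs q ?\<sigma>2 t3 (?\<sigma>2(0 := code (g x) @ r))"
      using implementsE[OF pq(2) x, of ?\<sigma>2 r] \<sigma> by auto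
    then have 3: "t3 \<le> Tg x" "runs q ?\<sigma>2 t3 ?\<sigma>3"
      by (auto elim!: runs_cong simp: fun_eq_iff fun_upd_apply)
    obtain t4 where "t4 \<le> 18 * length (code x)" "runs from_R ?\<sigma>3 t4 (?\<sigma>3(3 := \<sigma> 3, 0 := code x @ ?\<sigma>3 0))"
      using runs_from_R[of ?\<sigma>3 "encode x" "\<sigma> 3"] \<sigma> by auto
    then have 4: "t4 \<le> 18 * length (code x)" "runs from_R ?\<sigma>3 t4 ?\<sigma>4"
      by (auto elim!: runs_cong simp: fun_eq_iff fun_upd_apply)
    obtain t5 where "t5 \<le> Tf x" "runs p ?\<sigma>4 t5 (?\<sigma>4(0 := code (f x) @ code (g x) @ r))"
      using implementsE[OF pq(1) x, of ?\<sigma>4 "code (g x) @ r"] \<sigma> by auto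
    then have 5: "t5 \<le> Tf x" "runs p ?\<sigma>4 t5 ?\<sigma>5" by auto
    have "runs ?c \<sigma> (t1 + (t2 + (t3 + (t4 + (t5 + 1 + 1) + 1) + 1) + 1) + 1) (\<sigma>(0 := code (f x, g x) @ r))"
      by (rule runs_cong[OF runs_Seq[OF 1(2) runs_Seq[OF 2(2) runs_Seq[OF 3(2) runs_Seq[OF 4(2) runs_Seq[OF 5(2) runs_Push]]]]]])
        auto
    then show "\<exists>t \<le> Tf x + Tg x + 90 * sz x. runs ?c \<sigma> t (\<sigma>(0 := code (f x, g x) @ r))"
      using 1(1) 2(1) 3(1) 4(1) 5(1) sz_pos[of x] by (intro exI conjI) (auto simp: sz_def)
  qed
  then show ?thesis unfolding timed_def by blast
qed

lemma timed_is_node: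
  assumes "\<And>x. x \<in> D \<Longrightarrow> f x \<longleftrightarrow> encode x \<noteq> Lf"
  shows "timed D f (\<lambda>x. 30 * sz x)"
  unfolding timed_def
proof (rule exI[of _ "Branch 0 {2} (Seq drop_top (pushes [2, 1, 1])) (Seq drop_top (pushes [1]))"], rule implementsI)
  fix x r and \<sigma> :: regs assume x: "x \<in> D" and \<sigma>: "\<sigma> 0 = code x @ r" "\<sigma> 1 = []" "\<sigma> 2 = []"
  obtain t where t: "t \<le> 18 * length (code x)" "runs drop_top \<sigma> t (\<sigma>(0 := r))"
    using runs_drop_top \<sigma> by blast
  have 1: "runs (Seq drop_top (pushes w)) \<sigma> (t + (2 * length w + 1) + 1) (\<sigma>(0 := w @ r))" for w
    by (rule runs_cong[OF runs_Seq[OF t(2) runs_pushes]]) auto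
  have "code (f x) = (if first (\<sigma> 0) \<in> {2} then [2, 1, 1] else [1])"
    using assms[OF x] \<sigma>(1) by (cases "encode x") auto
  then have "runs (Branch 0 {2} (Seq drop_top (pushes [2, 1, 1])) (Seq drop_top (pushes [1]))) \<sigma>
      ((t + (2 * length (code (f x)) + 1) + 1) + 1) (\<sigma>(0 := code (f x) @ r))"
    using 1[of "[2, 1, 1]"] 1[of "[1]"] by (intro runs_Branch) (simp only: if_True if_False split: if_split, blast)
  moreover have "length (code (f x)) \<le> 3" by (cases "f x") auto
  ultimately show "\<exists>t \<le> 30 * sz x. runs (Branch 0 {2} (Seq drop_top (pushes [2, 1, 1])) (Seq drop_top (pushes [1]))) \<sigma> t
      (\<sigma>(0 := code (f x) @ r))"
    using t(1) sz_pos[of x] by (intro exI conjI) (auto simp: sz_def)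
qed (simp add: wf_pushes)

lemma timed_if:
  assumes "timed D b Tb" "timed (D \<inter> {x. b x}) f Tf" "timed (D \<inter> {x. \<not> b x}) g Tg"
  shows "timed D (\<lambda>x. if b x then f x else g x) (\<lambda>x. Tb x + (if b x then Tf x else Tg x) + 110 * sz x)"
proof -
  obtain pb p q where pq: "implements pb D b Tb" "implements p (D \<inter> {x. b x}) f Tf" "implements q (D \<inter> {x. \<not> b x}) g Tg"
    using assms unfolding timed_def by blast
  let ?b = "Branch 0 {2} (Seq drop_top p) (Seq drop_top q)"
  let ?c = "Seq dup (Seq pb ?b)"
  have "implements ?c D (\<lambda>x. if b x then f x else g x) (\<lambda>x. Tb x + (if b x then Tf x else Tg x) + 110 * sz x)"
  proof (rule implementsI)
    show "wf_cmd ?c" using pq by (auto simp: implements_def)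
    fix x r and \<sigma> :: regs assume x: "x \<in> D" and \<sigma>: "\<sigma> 0 = code x @ r" "\<sigma> 1 = []" "\<sigma> 2 = []"
    let ?\<sigma>1 = "\<sigma>(0 := code x @ code x @ r)"
    let ?\<sigma>2 = "\<sigma>(0 := code (b x) @ code x @ r)"
    obtain t1 where 1: "t1 \<le> 40 * length (code x)" "runs dup \<sigma> t1 ?\<sigma>1"
      using runs_dup \<sigma> by blast
    obtain t2 where 2: "t2 \<le> Tb x" "runs pb ?\<sigma>1 t2 ?\<sigma>2"
      using implementsE[OF pq(1) x, of ?\<sigma>1 "code x @ r"] \<sigma> by auto
    obtain t3 where 3: "t3 \<le> 18 * length (code (b x))" "runs drop_top ?\<sigma>2 t3 \<sigma>"
      using runs_drop_top[of ?\<sigma>2 "encode (b x)" "code x @ r"] \<sigma> by (auto simp: fun_upd_idem)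
    let ?h = "if b x then f x else g x"
    have "\<exists>t4 \<le> (if b x then Tf x else Tg x). runs (if b x then p else q) \<sigma> t4 (\<sigma>(0 := code ?h @ r))"
    proof (cases "b x")
      case True
      then show ?thesis using implementsE[OF pq(2), of x \<sigma> r] x \<sigma> by auto
    next
      case False
      then show ?thesis using implementsE[OF pq(3), of x \<sigma> r] x \<sigma> by auto
    qed
    then obtain t4 where 4: "t4 \<le> (if b x then Tf x else Tg x)"
      "runs (if b x then p else q) \<sigma> t4 (\<sigma>(0 := code ?h @ r))" by blast
    have "first (?\<sigma>2 0) \<in> {2} \<longleftrightarrow> b x" by (cases "b x") auto
    then have "runs ?b ?\<sigma>2 (t3 + t4 + 1 + 1) (\<sigma>(0 := code ?h @ r))"
      using runs_Seq[OF 3(2) 4(2)] by (intro runs_Branch) auto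
    from runs_Seq[OF 1(2) runs_Seq[OF 2(2) this]]
    have "runs ?c \<sigma> (t1 + (t2 + (t3 + t4 + 1 + 1) + 1) + 1) (\<sigma>(0 := code ?h @ r))" .
    moreover have "length (code (b x)) \<le> 3" by (cases "b x") auto
    ultimately show "\<exists>t \<le> Tb x + (if b x then Tf x else Tg x) + 110 * sz x. runs ?c \<sigma> t (\<sigma>(0 := code ?h @ r))"
      using 1(1) 2(1) 3(1) 4(1) sz_pos[of x]
      by (intro exI[of _ "t1 + (t2 + (t3 + t4 + 1 + 1) + 1) + 1"]) (auto simp: sz_def)
  qed
  then show ?thesis unfolding timed_def by blast
qed

text \<open>The cost is the sum over the visited states, so no measure function is involved.
  \<open>E\<close> contains only start values from which the loop ends within its budget; all
  visited states lie in \<open>D\<close>, and elsewhere the loop may diverge. This generality is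
  used for the simulation of an arbitrary machine.\<close>

lemma timed_while:
  assumes b: "timed D b Tb" and g: "timed (D \<inter> {x. b x}) g Tg"
    and f: "\<And>x. x \<in> E \<Longrightarrow> \<exists>n. f x = (g ^^ n) x \<and> (\<forall>i\<le>n. (g ^^ i) x \<in> D) \<and> (\<forall>i<n. b ((g ^^ i) x)) \<and>
      \<not> b ((g ^^ n) x) \<and> (\<Sum>i\<le>n. Tb ((g ^^ i) x) + Tg ((g ^^ i) x) + 120 * sz ((g ^^ i) x)) \<le> T x"
  shows "timed E f T"
proof -
  obtain pb p where pq: "implements pb D b Tb" "implements p (D \<inter> {x. b x}) g Tg"
    using b g unfolding timed_def by blast
  let ?l = "Loop 0 {2} (Seq drop_top (Seq p (Seq dup pb)))"
  let ?c = "Seq (Seq (Seq dup pb) ?l) drop_top"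
  let ?A = "\<lambda>x n. \<Sum>i<n. Tg ((g ^^ i) x) + 60 * sz ((g ^^ i) x)"
  let ?B = "\<lambda>x n. \<Sum>i\<le>n. Tb ((g ^^ i) x) + 41 * sz ((g ^^ i) x)"
  have wf: "wf_cmd pb" "wf_cmd p" using pq by (auto simp: implements_def)
  have test: "\<exists>t \<le> Tb x + 41 * sz x. runs (Seq dup pb) \<sigma> t (\<sigma>(0 := code (b x) @ code x @ r))"
    if x: "x \<in> D" and \<sigma>: "\<sigma> 0 = code x @ r" "\<sigma> 1 = []" "\<sigma> 2 = []" for x r and \<sigma> :: regs
  proof -
    let ?\<sigma>1 = "\<sigma>(0 := code x @ code x @ r)"
    obtain t1 where 1: "t1 \<le> 40 * length (code x)" "runs dup \<sigma> t1 ?\<sigma>1"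
      using runs_dup \<sigma> by blast
    obtain t2 where 2: "t2 \<le> Tb x" "runs pb ?\<sigma>1 t2 (\<sigma>(0 := code (b x) @ code x @ r))"
      using implementsE[OF pq(1) x, of ?\<sigma>1 "code x @ r"] \<sigma> by auto
    show ?thesis using runs_Seq[OF 1(2) 2(2)] 1(1) 2(1) sz_pos[of x] unfolding sz_def
      by (intro exI[of _ "t1 + t2 + 1"]) auto
  qed
  have bl: "length (code y) \<le> 3" for y :: bool by (cases y) auto
  \<comment> \<open>The first test has already been executed before the loop is entered. Its cost is
    added on the left, so that the sum of all tests on the right satisfies a uniform
    recurrence.\<close>
  have loop: "\<exists>t. t + (Tb x + 41 * sz x) \<le> ?A x n + ?B x n + 1 \<and>
      runs ?l (\<sigma>(0 := code (b x) @ code x @ r)) t (\<sigma>(0 := code False @ code ((g ^^ n) x) @ r))"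
    if "\<forall>i\<le>n. (g ^^ i) x \<in> D" "\<forall>i<n. b ((g ^^ i) x)" "\<not> b ((g ^^ n) x)" "\<sigma> 1 = []" "\<sigma> 2 = []"
    for n x r and \<sigma> :: regs
    using that
  proof (induction n arbitrary: x)
    case 0
    have "first ((\<sigma>(0 := code (b x) @ code x @ r)) 0) \<notin> {2}" using 0 by simp
    then have "runs ?l (\<sigma>(0 := code (b x) @ code x @ r)) 1 (\<sigma>(0 := code (b x) @ code x @ r))"
      by (rule runs_Loop_end)
    then show ?case using 0 by (intro exI[of _ 1]) auto
  next
    case (Suc n)
    have x: "x \<in> D" "b x" "g x \<in> D" using Suc.prems(1)[rule_format, of 0] Suc.prems(2)[rule_format, of 0]
      Suc.prems(1)[rule_format, of 1] by auto
    let ?\<sigma>1 = "\<sigma>(0 := code (b x) @ code x @ r)" and ?\<sigma>2 = "\<sigma>(0 := code x @ r)"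
      and ?\<sigma>3 = "\<sigma>(0 := code (g x) @ r)" and ?\<sigma>4 = "\<sigma>(0 := code (b (g x)) @ code (g x) @ r)"
    obtain t1 where 1: "t1 \<le> 18 * length (code (b x))" "runs drop_top ?\<sigma>1 t1 ?\<sigma>2"
      using runs_drop_top[of ?\<sigma>1 "encode (b x)" "code x @ r"] Suc.prems(4,5) by auto
    obtain t2 where 2: "t2 \<le> Tg x" "runs p ?\<sigma>2 t2 ?\<sigma>3"
      using implementsE[OF pq(2), of x ?\<sigma>2 r] x Suc.prems(4,5) by auto
    obtain t3 where 3: "t3 \<le> Tb (g x) + 41 * sz (g x)" "runs (Seq dup pb) ?\<sigma>3 t3 ?\<sigma>4"
      using test[of "g x" ?\<sigma>3 r] x Suc.prems(4,5) by auto
    have body: "runs (Seq drop_top (Seq p (Seq dup pb))) ?\<sigma>1 (t1 + (t2 + t3 + 1) + 1) ?\<sigma>4"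
      using runs_Seq[OF 1(2) runs_Seq[OF 2(2) 3(2)]] .
    have "\<forall>i\<le>n. (g ^^ i) (g x) \<in> D" "\<forall>i<n. b ((g ^^ i) (g x))" "\<not> b ((g ^^ n) (g x))"
      using Suc.prems(1)[rule_format, of "Suc _"] Suc.prems(2)[rule_format, of "Suc _"] Suc.prems(3)
      by (simp_all add: funpow_swap1)
    then obtain t4 where 4: "t4 + (Tb (g x) + 41 * sz (g x)) \<le> ?A (g x) n + ?B (g x) n + 1"
      "runs ?l ?\<sigma>4 t4 (\<sigma>(0 := code False @ code ((g ^^ n) (g x)) @ r))"
      using Suc.IH[of "g x"] Suc.prems(4,5) by auto
    have t: "first (?\<sigma>1 0) \<in> {2}" using x by simp
    have AS: "?A x (Suc n) = Tg x + 60 * sz x + ?A (g x) n"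
      by (subst sum.lessThan_Suc_shift) (simp add: funpow_swap1)
    have BS: "?B x (Suc n) = Tb x + 41 * sz x + ?B (g x) n"
      by (subst sum.atMost_Suc_shift) (simp add: funpow_swap1)
    have "t1 + (t2 + t3 + 1) + 1 + t4 + 1 + (Tb x + 41 * sz x) \<le> ?A x (Suc n) + ?B x (Suc n) + 1"
      using 1(1) 2(1) 3(1) 4(1) bl[of "b x"] sz_pos[of x] unfolding AS BS by simp
    moreover have "runs ?l ?\<sigma>1 (t1 + (t2 + t3 + 1) + 1 + t4 + 1) (\<sigma>(0 := code False @ code ((g ^^ Suc n) x) @ r))"
      using runs_Loop_step[OF t body 4(2)] by (simp add: funpow_swap1)
    ultimately show ?case by blast
  qed
  have "implements ?c E f (\<lambda>x. T x)"
  proof (rule implementsI)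
    show "wf_cmd ?c" using wf by auto
    fix x r and \<sigma> :: regs assume x: "x \<in> E" and \<sigma>: "\<sigma> 0 = code x @ r" "\<sigma> 1 = []" "\<sigma> 2 = []"
    from f[OF x] obtain n where n: "f x = (g ^^ n) x" "\<forall>i\<le>n. (g ^^ i) x \<in> D" "\<forall>i<n. b ((g ^^ i) x)"
      "\<not> b ((g ^^ n) x)" "(\<Sum>i\<le>n. Tb ((g ^^ i) x) + Tg ((g ^^ i) x) + 120 * sz ((g ^^ i) x)) \<le> T x" by blast
    have D: "x \<in> D" using n(2)[rule_format, of 0] by simp
    let ?\<sigma>1 = "\<sigma>(0 := code (b x) @ code x @ r)"
      and ?\<sigma>2 = "\<sigma>(0 := code False @ code ((g ^^ n) x) @ r)"
    obtain t1 where 1: "t1 \<le> Tb x + 41 * sz x" "runs (Seq dup pb) \<sigma> t1 ?\<sigma>1"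
      using test[OF D \<sigma>] by blast
    obtain t2 where 2: "t2 + (Tb x + 41 * sz x) \<le> ?A x n + ?B x n + 1" "runs ?l ?\<sigma>1 t2 ?\<sigma>2"
      using loop[OF n(2-4) \<sigma>(2,3)] by blast
    obtain t3 where 3: "t3 \<le> 18" "runs drop_top ?\<sigma>2 t3 (\<sigma>(0 := code (f x) @ r))"
      using runs_drop_top[of ?\<sigma>2 Lf "code (f x) @ r"] \<sigma> n(1) by auto
    have "?A x n + ?B x n + 60 * sz ((g ^^ n) x) \<le> (\<Sum>i\<le>n. Tg ((g ^^ i) x) + 60 * sz ((g ^^ i) x)) + ?B x n"
      by (simp add: lessThan_Suc_atMost[symmetric])
    also have "\<dots> \<le> (\<Sum>i\<le>n. Tb ((g ^^ i) x) + Tg ((g ^^ i) x) + 120 * sz ((g ^^ i) x))"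
      unfolding sum.distrib[symmetric] by (intro sum_mono) simp
    finally have "t1 + t2 + 1 + t3 + 1 \<le> T x"
      using 1(1) 2(1) 3(1) n(5) sz_pos[of "(g ^^ n) x"] by simp
    moreover have "runs ?c \<sigma> (t1 + t2 + 1 + t3 + 1) (\<sigma>(0 := code (f x) @ r))"
      by (rule runs_Seq[OF runs_Seq[OF 1(2) 2(2)] 3(2)])
    ultimately show "\<exists>t \<le> T x. runs ?c \<sigma> t (\<sigma>(0 := code (f x) @ r))"
      by blast
  qed
  then show ?thesis unfolding timed_def by blast
qed


section \<open>Conversion between the tape format and tree codes\<close>

abbreviation bit :: "bool \<Rightarrow> nat" where
  "bit b \<equiv> if b then 2 else 1"

text \<open>Reversing the whole input brings the unary parameter to the front. It becomes the second
  component of the pair at the bottom of register 0, and the bits then arrive last to first, in the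
  order in which a list is built by consing.\<close>

definition read_input :: cmd where
  "read_input = Seq (pour 0 1) (Seq (Push 0 1) (Seq
     (Loop 1 {1} (Seq (Pop 1) (Seq (Push 0 1) (Push 0 2)))) (Seq (Pop 1) (Seq (Push 0 1) (Seq
     (Loop 1 {1, 2} (Branch 1 {1} (Seq (Pop 1) (pushes [2, 1])) (Seq (Pop 1) (pushes [2, 2, 1, 1])))) (Push 0 2))))))"

text \<open>The bits, the separator 3 and the unary parameter are pushed in this order onto register
  1; one final reversal restores the reading direction.\<close>

definition write_output :: cmd where
  "write_output = Seq (Pop 0) (Seq
     (Loop 0 {2} (Seq (Pop 0) (Branch 0 {2} (Seq (Pop 0) (Seq (Pop 0) (Seq (Pop 0) (Push 1 2))))
        (Seq (Pop 0) (Push 1 1))))) (Seq (Pop 0) (Seq (Push 1 3) (Seq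
     (Loop 0 {2} (Seq (Pop 0) (Seq (Pop 0) (Push 1 1)))) (Seq (Pop 0) (pour 1 0))))))"

lemma runs_read_nat:
  "\<sigma> 1 = replicate k 1 @ w \<Longrightarrow> first w \<noteq> 1 \<Longrightarrow> \<sigma> 0 = code (n :: nat) \<Longrightarrow>
   runs (Loop 1 {1} (Seq (Pop 1) (Seq (Push 0 1) (Push 0 2)))) \<sigma> (6 * k + 1) (\<sigma>(1 := w, 0 := code (k + n)))"
proof (induction k arbitrary: \<sigma> n)
  case 0
  then have "runs (Loop 1 {1} (Seq (Pop 1) (Seq (Push 0 1) (Push 0 2)))) \<sigma> 1 \<sigma>"
    by (intro runs_Loop_end) auto
  then show ?case by (rule runs_cong) (use 0 in \<open>auto simp: fun_eq_iff fun_upd_apply\<close>)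
next
  case (Suc k)
  let ?\<tau> = "\<sigma>(1 := replicate k 1 @ w, 0 := code (Suc n))"
  have 1: "runs (Seq (Pop 1) (Seq (Push 0 1) (Push 0 2))) \<sigma> 5 ?\<tau>"
    by (rule runs_cong[OF runs_Seq[OF runs_Pop runs_Seq[OF runs_Push runs_Push]]])
      (use Suc.prems in \<open>auto simp: fun_eq_iff fun_upd_apply\<close>)
  have 2: "runs (Loop 1 {1} (Seq (Pop 1) (Seq (Push 0 1) (Push 0 2)))) ?\<tau> (6 * k + 1)
      (?\<tau>(1 := w, 0 := code (k + Suc n)))"
    using Suc.prems by (intro Suc.IH) auto
  have "first (\<sigma> 1) \<in> {1}" using Suc.prems by simp
  from runs_Loop_step[OF this 1 2] show ?case
    by (rule runs_cong) (auto simp: fun_eq_iff fun_upd_apply)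
qed

lemma runs_read_bits:
  "\<sigma> 1 = rev (map bit bs) \<Longrightarrow> \<sigma> 0 = code cs @ r \<Longrightarrow>
   \<exists>t \<le> 13 * length bs + 1. runs (Loop 1 {1, 2} (Branch 1 {1} (Seq (Pop 1) (pushes [2, 1]))
       (Seq (Pop 1) (pushes [2, 2, 1, 1])))) \<sigma> t (\<sigma>(1 := [], 0 := code (bs @ cs) @ r))"
proof (induction bs arbitrary: \<sigma> cs rule: rev_induct)
  case Nil
  then have "runs (Loop 1 {1, 2} (Branch 1 {1} (Seq (Pop 1) (pushes [2, 1]))
       (Seq (Pop 1) (pushes [2, 2, 1, 1])))) \<sigma> 1 \<sigma>"
    by (intro runs_Loop_end) auto
  moreover have "\<sigma>(1 := [], 0 := code ([] @ cs) @ r) = \<sigma>" using Nil by (auto simp: fun_eq_iff fun_upd_apply)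
  ultimately show ?case by (intro exI[of _ 1]) simp
next
  case (snoc b bs)
  let ?\<tau> = "\<sigma>(1 := rev (map bit bs), 0 := code (b # cs) @ r)"
  have 1: "runs (Seq (Pop 1) (pushes (if b then [2, 2, 1, 1] else [2, 1]))) \<sigma>
      (1 + (2 * length (if b then [2, 2, 1, 1 :: nat] else [2, 1]) + 1) + 1) ?\<tau>"
    by (rule runs_cong[OF runs_Seq[OF runs_Pop runs_pushes]])
      (use snoc.prems in \<open>auto simp: fun_eq_iff fun_upd_apply\<close>)
  have "runs (Branch 1 {1} (Seq (Pop 1) (pushes [2, 1])) (Seq (Pop 1) (pushes [2, 2, 1, 1]))) \<sigma>
      ((1 + (2 * length (if b then [2, 2, 1, 1 :: nat] else [2, 1]) + 1) + 1) + 1) ?\<tau>"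
    using 1 snoc.prems(1) by (intro runs_Branch) (cases b; simp)
  moreover obtain t where "t \<le> 13 * length bs + 1" "runs (Loop 1 {1, 2} (Branch 1 {1} (Seq (Pop 1) (pushes [2, 1]))
       (Seq (Pop 1) (pushes [2, 2, 1, 1])))) ?\<tau> t (?\<tau>(1 := [], 0 := code (bs @ b # cs) @ r))"
    using snoc.IH[of ?\<tau> "b # cs"] by auto
  moreover have "first (\<sigma> 1) \<in> {1, 2}" using snoc.prems by simp
  ultimately have "runs (Loop 1 {1, 2} (Branch 1 {1} (Seq (Pop 1) (pushes [2, 1]))
       (Seq (Pop 1) (pushes [2, 2, 1, 1])))) \<sigma>
       (1 + (2 * length (if b then [2, 2, 1, 1 :: nat] else [2, 1]) + 1) + 1 + 1 + t + 1)
       (?\<tau>(1 := [], 0 := code (bs @ b # cs) @ r))"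
    by (intro runs_Loop_step)
  moreover have "?\<tau>(1 := [], 0 := code (bs @ b # cs) @ r) = \<sigma>(1 := [], 0 := code ((bs @ [b]) @ cs) @ r)"
    by (auto simp: fun_eq_iff fun_upd_apply)
  ultimately show ?case using \<open>t \<le> 13 * length bs + 1\<close>
    by (intro exI[of _ "1 + (2 * length (if b then [2, 2, 1, 1 :: nat] else [2, 1]) + 1) + 1 + 1 + t + 1"]) auto
qed

lemma runs_write_bits:
  "\<sigma> 0 = code bs @ r \<Longrightarrow>
   \<exists>t \<le> 13 * length bs + 1. runs (Loop 0 {2} (Seq (Pop 0) (Branch 0 {2}
       (Seq (Pop 0) (Seq (Pop 0) (Seq (Pop 0) (Push 1 2)))) (Seq (Pop 0) (Push 1 1))))) \<sigma> t
     (\<sigma>(0 := 1 # r, 1 := rev (map bit bs) @ \<sigma> 1))"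
proof (induction bs arbitrary: \<sigma>)
  case Nil
  then have "runs (Loop 0 {2} (Seq (Pop 0) (Branch 0 {2}
       (Seq (Pop 0) (Seq (Pop 0) (Seq (Pop 0) (Push 1 2)))) (Seq (Pop 0) (Push 1 1))))) \<sigma> 1 \<sigma>"
    by (intro runs_Loop_end) auto
  moreover have "\<sigma>(0 := 1 # r, 1 := rev (map bit []) @ \<sigma> 1) = \<sigma>" using Nil by (auto simp: fun_eq_iff fun_upd_apply)
  ultimately show ?case by (intro exI[of _ 1]) simp
next
  case (Cons b bs)
  let ?\<sigma>1 = "\<sigma>(0 := code b @ code bs @ r)"
  let ?\<tau> = "\<sigma>(0 := code bs @ r, 1 := bit b # \<sigma> 1)"
  have 1: "runs (Pop 0) \<sigma> 1 ?\<sigma>1" by (rule runs_cong[OF runs_Pop]) (use Cons.prems in auto)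
  have "\<exists>t \<le> 8. runs (Branch 0 {2}
       (Seq (Pop 0) (Seq (Pop 0) (Seq (Pop 0) (Push 1 2)))) (Seq (Pop 0) (Push 1 1))) ?\<sigma>1 t ?\<tau>"
  proof (cases b)
    case True
    have "runs (Seq (Pop 0) (Seq (Pop 0) (Seq (Pop 0) (Push 1 2)))) ?\<sigma>1 7 ?\<tau>"
      by (rule runs_cong[OF runs_Seq[OF runs_Pop runs_Seq[OF runs_Pop runs_Seq[OF runs_Pop runs_Push]]]])
        (use True in \<open>auto simp: fun_eq_iff fun_upd_apply\<close>)
    then show ?thesis using True by (intro exI[of _ "7 + 1"] conjI runs_Branch) auto
  next
    case False
    have "runs (Seq (Pop 0) (Push 1 1)) ?\<sigma>1 3 ?\<tau>"
      by (rule runs_cong[OF runs_Seq[OF runs_Pop runs_Push]])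
        (use False in \<open>auto simp: fun_eq_iff fun_upd_apply\<close>)
    then show ?thesis using False by (intro exI[of _ "3 + 1"] conjI runs_Branch) auto
  qed
  then obtain s where s: "s \<le> 8" "runs (Branch 0 {2}
       (Seq (Pop 0) (Seq (Pop 0) (Seq (Pop 0) (Push 1 2)))) (Seq (Pop 0) (Push 1 1))) ?\<sigma>1 s ?\<tau>" by blast
  obtain t where t: "t \<le> 13 * length bs + 1" "runs (Loop 0 {2} (Seq (Pop 0) (Branch 0 {2}
       (Seq (Pop 0) (Seq (Pop 0) (Seq (Pop 0) (Push 1 2)))) (Seq (Pop 0) (Push 1 1))))) ?\<tau> t
     (?\<tau>(0 := 1 # r, 1 := rev (map bit bs) @ ?\<tau> 1))"
    using Cons.IH[of ?\<tau>] by auto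
  have "first (\<sigma> 0) \<in> {2}" using Cons.prems by simp
  from runs_Loop_step[OF this runs_Seq[OF 1 s(2)] t(2)]
  have "runs (Loop 0 {2} (Seq (Pop 0) (Branch 0 {2}
       (Seq (Pop 0) (Seq (Pop 0) (Seq (Pop 0) (Push 1 2)))) (Seq (Pop 0) (Push 1 1))))) \<sigma> (1 + s + 1 + t + 1)
     (\<sigma>(0 := 1 # r, 1 := rev (map bit (b # bs)) @ \<sigma> 1))"
    by (rule runs_cong) (auto simp: fun_eq_iff fun_upd_apply)
  then show ?case using s(1) t(1) by (intro exI[of _ "1 + s + 1 + t + 1"]) auto
qed

lemma runs_write_nat:
  "\<sigma> 0 = code (k :: nat) @ r \<Longrightarrow>
   runs (Loop 0 {2} (Seq (Pop 0) (Seq (Pop 0) (Push 1 1)))) \<sigma> (6 * k + 1) (\<sigma>(0 := 1 # r, 1 := replicate k 1 @ \<sigma> 1))"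
proof (induction k arbitrary: \<sigma>)
  case 0
  then have "runs (Loop 0 {2} (Seq (Pop 0) (Seq (Pop 0) (Push 1 1)))) \<sigma> 1 \<sigma>"
    by (intro runs_Loop_end) auto
  then show ?case by (rule runs_cong) (use 0 in \<open>auto simp: fun_eq_iff fun_upd_apply\<close>)
next
  case (Suc k)
  let ?\<tau> = "\<sigma>(0 := code k @ r, 1 := 1 # \<sigma> 1)"
  have 1: "runs (Seq (Pop 0) (Seq (Pop 0) (Push 1 1))) \<sigma> 5 ?\<tau>"
    by (rule runs_cong[OF runs_Seq[OF runs_Pop runs_Seq[OF runs_Pop runs_Push]]])
      (use Suc.prems in \<open>auto simp: fun_eq_iff fun_upd_apply\<close>)
  have 2: "runs (Loop 0 {2} (Seq (Pop 0) (Seq (Pop 0) (Push 1 1)))) ?\<tau> (6 * k + 1)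
      (?\<tau>(0 := 1 # r, 1 := replicate k 1 @ ?\<tau> 1))"
    by (intro Suc.IH) auto
  have "first (\<sigma> 0) \<in> {2}" using Suc.prems by simp
  from runs_Loop_step[OF this 1 2] show ?case
    by (rule runs_cong) (auto simp: fun_eq_iff fun_upd_apply replicate_app_Cons_same)
qed

lemma runs_read_input:
  "\<exists>t \<le> 30 * (length x + k + 1). runs read_input (regs0 (code_pair (x, k))) t (regs0 (code (x, k)))"
proof -
  let ?w = "code_pair (x, k)"
  let ?s1 = "((\<lambda>_. []) :: regs)(1 := replicate k 1 @ 3 # rev (map bit x))"
  let ?s2 = "?s1(0 := code (0 :: nat))"
  let ?s3 = "((\<lambda>_. []) :: regs)(1 := 3 # rev (map bit x), 0 := code k)"
  let ?s4 = "((\<lambda>_. []) :: regs)(1 := rev (map bit x), 0 := code k)"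
  let ?s5 = "((\<lambda>_. []) :: regs)(1 := rev (map bit x), 0 := code ([] :: bool list) @ code k)"
  let ?s6 = "((\<lambda>_. []) :: regs)(0 := code x @ code k)"
  have "\<exists>t \<le> 6 * length ?w + 1. runs (pour 0 1) (regs0 ?w) t
      ((regs0 ?w)(0 := [], 1 := rev ?w @ (regs0 ?w) 1))"
    by (rule runs_pour) (auto simp: code_pair_def regs0_def)
  moreover have "(regs0 ?w)(0 := [], 1 := rev ?w @ (regs0 ?w) 1) = ?s1"
    by (auto simp: code_pair_def regs0_def fun_eq_iff fun_upd_apply rev_map)
  ultimately obtain t1 where 1: "t1 \<le> 6 * length ?w + 1" "runs (pour 0 1) (regs0 ?w) t1 ?s1" by auto
  have 2: "runs (Push 0 1) ?s1 1 ?s2" by (rule runs_cong[OF runs_Push]) auto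
  have 3: "runs (Loop 1 {1} (Seq (Pop 1) (Seq (Push 0 1) (Push 0 2)))) ?s2 (6 * k + 1) ?s3"
    by (rule runs_cong[OF runs_read_nat[of _ k "3 # rev (map bit x)" 0]]) (auto simp: fun_eq_iff fun_upd_apply)
  have 4: "runs (Pop 1) ?s3 1 ?s4" by (rule runs_cong[OF runs_Pop]) (auto simp: fun_eq_iff fun_upd_apply)
  have 5: "runs (Push 0 1) ?s4 1 ?s5" by (rule runs_cong[OF runs_Push]) (auto simp: fun_eq_iff fun_upd_apply)
  have "\<exists>t \<le> 13 * length x + 1. runs (Loop 1 {1, 2} (Branch 1 {1} (Seq (Pop 1) (pushes [2, 1]))
       (Seq (Pop 1) (pushes [2, 2, 1, 1])))) ?s5 t (?s5(1 := [], 0 := code (x @ []) @ code k))"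
    by (rule runs_read_bits) auto
  moreover have "?s5(1 := [], 0 := code (x @ []) @ code k) = ?s6" by (auto simp: fun_eq_iff fun_upd_apply)
  ultimately obtain t6 where 6: "t6 \<le> 13 * length x + 1" "runs (Loop 1 {1, 2} (Branch 1 {1} (Seq (Pop 1) (pushes [2, 1]))
       (Seq (Pop 1) (pushes [2, 2, 1, 1])))) ?s5 t6 ?s6" by auto
  have 7: "runs (Push 0 2) ?s6 1 (regs0 (code (x, k)))"
    by (rule runs_cong[OF runs_Push]) (auto simp: regs0_def)
  show ?thesis
    unfolding read_input_def
    using runs_Seq[OF 1(2) runs_Seq[OF 2 runs_Seq[OF 3 runs_Seq[OF 4 runs_Seq[OF 5 runs_Seq[OF 6(2) 7]]]]]]
      1(1) 6(1)
    by (intro exI conjI) (auto simp: code_pair_def)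
qed

lemma runs_write_output:
  "\<exists>t \<le> 40 * (length x + k + 1). runs write_output (regs0 (code (x, k))) t (regs0 (code_pair (x, k)))"
proof -
  let ?w = "rev (code_pair (x, k))"
  let ?s1 = "regs0 (code x @ code k)"
  let ?s2 = "((\<lambda>_. []) :: regs)(0 := 1 # code k, 1 := rev (map bit x))"
  let ?s3 = "((\<lambda>_. []) :: regs)(0 := code k, 1 := rev (map bit x))"
  let ?s4 = "((\<lambda>_. []) :: regs)(0 := code k, 1 := 3 # rev (map bit x))"
  let ?s5 = "((\<lambda>_. []) :: regs)(0 := [1], 1 := ?w)"
  let ?s6 = "((\<lambda>_. []) :: regs)(1 := ?w)"
  have 1: "runs (Pop 0) (regs0 (code (x, k))) 1 ?s1"
    by (rule runs_cong[OF runs_Pop]) (auto simp: regs0_def)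
  have "\<exists>t \<le> 13 * length x + 1. runs (Loop 0 {2} (Seq (Pop 0) (Branch 0 {2}
       (Seq (Pop 0) (Seq (Pop 0) (Seq (Pop 0) (Push 1 2)))) (Seq (Pop 0) (Push 1 1))))) ?s1 t
     (?s1(0 := 1 # code k, 1 := rev (map bit x) @ ?s1 1))"
    by (rule runs_write_bits) (auto simp: regs0_def)
  moreover have "?s1(0 := 1 # code k, 1 := rev (map bit x) @ ?s1 1) = ?s2"
    by (auto simp: fun_eq_iff fun_upd_apply regs0_def)
  ultimately obtain t2 where 2: "t2 \<le> 13 * length x + 1" "runs (Loop 0 {2} (Seq (Pop 0) (Branch 0 {2}
       (Seq (Pop 0) (Seq (Pop 0) (Seq (Pop 0) (Push 1 2)))) (Seq (Pop 0) (Push 1 1))))) ?s1 t2 ?s2" by auto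
  have 3: "runs (Pop 0) ?s2 1 ?s3" by (rule runs_cong[OF runs_Pop]) (auto simp: fun_eq_iff fun_upd_apply)
  have 4: "runs (Push 1 3) ?s3 1 ?s4" by (rule runs_cong[OF runs_Push]) (auto simp: fun_eq_iff fun_upd_apply)
  have 5: "runs (Loop 0 {2} (Seq (Pop 0) (Seq (Pop 0) (Push 1 1)))) ?s4 (6 * k + 1) ?s5"
    by (rule runs_cong[OF runs_write_nat[of _ k "[]"]])
      (auto simp: fun_eq_iff fun_upd_apply code_pair_def rev_map)
  have 6: "runs (Pop 0) ?s5 1 ?s6" by (rule runs_cong[OF runs_Pop]) (auto simp: fun_eq_iff fun_upd_apply)
  have "\<exists>t \<le> 6 * length ?w + 1. runs (pour 1 0) ?s6 t (?s6(1 := [], 0 := rev ?w @ ?s6 0))"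
    by (rule runs_pour) (auto simp: code_pair_def)
  moreover have "?s6(1 := [], 0 := rev ?w @ ?s6 0) = regs0 (code_pair (x, k))"
    by (auto simp: fun_eq_iff fun_upd_apply regs0_def)
  ultimately obtain t7 where 7: "t7 \<le> 6 * length ?w + 1" "runs (pour 1 0) ?s6 t7 (regs0 (code_pair (x, k)))" by auto
  show ?thesis
    unfolding write_output_def
    using runs_Seq[OF 1 runs_Seq[OF 2(2) runs_Seq[OF 3 runs_Seq[OF 4 runs_Seq[OF 5 runs_Seq[OF 6 7(2)]]]]]]
      2(1) 7(1)
    by (intro exI conjI) (auto simp: code_pair_def)
qed

lemma length_cstep: "cstep (K, \<sigma>) = (K', \<sigma>') \<Longrightarrow> length (\<sigma>' i) \<le> length (\<sigma> i) + 1"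
  by (cases "(K, \<sigma>)" rule: cstep.cases) (auto simp: fun_upd_apply split: if_splits)

lemma length_runs: assumes "runs c \<sigma> t \<tau>" shows "length (\<tau> i) \<le> length (\<sigma> i) + t"
proof -
  have "(cstep ^^ t) (K, \<sigma>) = (K', \<tau>) \<Longrightarrow> length (\<tau> i) \<le> length (\<sigma> i) + t" for K K'
  proof (induction t arbitrary: K' \<tau>)
    case (Suc t)
    obtain K1 \<tau>1 where 1: "(cstep ^^ t) (K, \<sigma>) = (K1, \<tau>1)" by fastforce
    then have "cstep (K1, \<tau>1) = (K', \<tau>)" using Suc.prems by simp
    from length_cstep[OF this, of i] Suc.IH[OF 1] show ?case by simp
  qed simp
  then show ?thesis using assms unfolding runs_def by blast
qed

text \<open>A register grows by at most one symbol per step, so every time bound is also a bound on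
  the size of the result.\<close>

lemma timed_size:
  assumes "timed D f T" "x \<in> D"
  shows "sz (f x) \<le> sz x + T x"
proof -
  obtain p where p: "implements p D f T" using assms(1) unfolding timed_def by blast
  obtain t where t: "t \<le> T x" "runs p (regs0 (code x)) t ((regs0 (code x))(0 := code (f x) @ []))"
    using implementsE[OF p assms(2), of "regs0 (code x)" "[]"] by (auto simp: regs0_def)
  from length_runs[OF t(2), of 0] t(1) show ?thesis by (simp add: sz_def regs0_def)
qed

lemma length_le_sz_pair: "length x + k + 1 \<le> sz (x :: bool list, k :: nat)"
  using length_less_sz[of x] by simp

text \<open>Reading and writing cost linear time in the sizes of argument and result, and the latter
  is bounded through \<open>timed_size\<close>. The constant 150 collects these linear terms; the
  square is the overhead of \<open>compile\<close>.\<close>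

theorem timed_halts_with:
  fixes f :: "bool list \<times> nat \<Rightarrow> bool list \<times> nat"
  assumes "timed UNIV f T"
  shows "\<exists>M. tm_valid M \<and> (\<forall>x k. \<exists>n \<le> 40 * (150 * (sz (x, k) + T (x, k)))\<^sup>2.
    halts_with M n (code_pair (x, k)) (code_pair (f (x, k))))"
proof -
  obtain p where p: "implements p UNIV f T" using assms unfolding timed_def by blast
  let ?c = "Seq (Seq read_input p) write_output"
  have "wf_cmd ?c" using p
    by (simp add: implements_def read_input_def write_output_def pour_def wf_pushes)
  then obtain M where M: "tm_valid M" and
    run: "\<And>w t \<sigma>'. w \<noteq> [] \<Longrightarrow> set w \<subseteq> {1, 2, 3} \<Longrightarrow> runs ?c (regs0 w) t \<sigma>' \<Longrightarrow>
      (\<exists>n \<le> 40 * (length w + t + 1)\<^sup>2. halts_with M n w (\<sigma>' 0))"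
    using compile by metis
  have "\<exists>n \<le> 40 * (150 * (sz (x, k) + T (x, k)))\<^sup>2. halts_with M n (code_pair (x, k)) (code_pair (f (x, k)))" for x k
  proof -
    obtain y l where yl: "f (x, k) = (y, l)" by fastforce
    obtain t1 where 1: "t1 \<le> 30 * (length x + k + 1)" "runs read_input (regs0 (code_pair (x, k))) t1 (regs0 (code (x, k)))"
      using runs_read_input by blast
    obtain t2 where "t2 \<le> T (x, k)" "runs p (regs0 (code (x, k))) t2 ((regs0 (code (x, k)))(0 := code (f (x, k)) @ []))"
      using implementsE[OF p, of "(x, k)" "regs0 (code (x, k))" "[]"] by (auto simp: regs0_def)
    then have 2: "t2 \<le> T (x, k)" "runs p (regs0 (code (x, k))) t2 (regs0 (code (y, l)))"
      by (simp_all add: regs0_def yl)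
    obtain t3 where 3: "t3 \<le> 40 * (length y + l + 1)" "runs write_output (regs0 (code (y, l))) t3 (regs0 (code_pair (y, l)))"
      using runs_write_output by blast
    have c: "code_pair (x, k) \<noteq> []" "set (code_pair (x, k)) \<subseteq> {1, 2, 3}" by (auto simp: code_pair_def)
    obtain n where n: "n \<le> 40 * (length (code_pair (x, k)) + (t1 + t2 + 1 + t3 + 1) + 1)\<^sup>2"
      "halts_with M n (code_pair (x, k)) (code_pair (y, l))"
      using run[OF c runs_Seq[OF runs_Seq[OF 1(2) 2(2)] 3(2)]] by (auto simp: regs0_def)
    have "sz (y, l) \<le> sz (x, k) + T (x, k)" using timed_size[OF assms, of "(x, k)"] yl by simp
    then have "length (code_pair (x, k)) + (t1 + t2 + 1 + t3 + 1) + 1 \<le> 150 * (sz (x, k) + T (x, k))"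
      using 1(1) 2(1) 3(1) length_le_sz_pair[of x k] length_le_sz_pair[of y l]
      by (simp add: code_pair_def del: sz_simps sz_nat)
    then have "(length (code_pair (x, k)) + (t1 + t2 + 1 + t3 + 1) + 1)\<^sup>2 \<le> (150 * (sz (x, k) + T (x, k)))\<^sup>2"
      by (intro power_mono) auto
    then have "40 * (length (code_pair (x, k)) + (t1 + t2 + 1 + t3 + 1) + 1)\<^sup>2 \<le> 40 * (150 * (sz (x, k) + T (x, k)))\<^sup>2"
      by (rule mult_le_mono2)
    then show ?thesis using n unfolding yl by (meson order.trans)
  qed
  then show ?thesis using M by blast
qed

section \<open>Polynomial-time functions\<close>

text \<open>Since the base is at least 2, constants and sums can be absorbed into the exponent, and
  one number \<open>c\<close> describes the bound.\<close>

definition polyb :: "('a::data \<Rightarrow> nat) \<Rightarrow> bool" where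
  "polyb T \<longleftrightarrow> (\<exists>c. \<forall>x. T x \<le> (sz x + 1) ^ c)"

lemma polybI: "(\<And>x. T x \<le> (sz x + 1) ^ c) \<Longrightarrow> polyb T"
  unfolding polyb_def by blast

lemma polyb_le: "polyb S \<Longrightarrow> (\<And>x. T x \<le> S x) \<Longrightarrow> polyb T"
  unfolding polyb_def by (meson order.trans)

lemma sz_base: "2 \<le> sz x + 1"
  using sz_pos[of x] by simp

lemma polyb_const: "polyb (\<lambda>_. n)"
proof (rule polybI)
  fix x :: 'a
  have "n \<le> 2 ^ n" using less_exp[of n] by simp
  also have "\<dots> \<le> (sz x + 1) ^ n" using sz_base by (intro power_mono) auto
  finally show "n \<le> (sz x + 1) ^ n" .
qed

lemma polyb_sz: "polyb sz"
  by (rule polybI[of _ 1]) simp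

lemma polyb_mult:
  assumes "polyb S" "polyb T"
  shows "polyb (\<lambda>x. S x * T x)"
proof -
  obtain a b where "\<And>x. S x \<le> (sz x + 1) ^ a" "\<And>x. T x \<le> (sz x + 1) ^ b"
    using assms unfolding polyb_def by blast
  then show ?thesis by (intro polybI[of _ "a + b"]) (simp add: power_add mult_le_mono)
qed

lemma polyb_add:
  assumes "polyb S" "polyb T"
  shows "polyb (\<lambda>x. S x + T x)"
proof -
  have "polyb (\<lambda>x. (S x + 1) * (T x + 1))"
  proof (rule polyb_mult)
    have *: "polyb (\<lambda>x. S x + 1)" if S: "polyb S" for S :: "'a \<Rightarrow> nat"
    proof -
      obtain a where a: "\<And>x. S x \<le> (sz x + 1) ^ a" using S unfolding polyb_def by blast
      show ?thesis
      proof (rule polybI[of _ "a + 1"])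
        fix x
        have "S x + 1 \<le> (sz x + 1) ^ a * 2" using add_mono[OF a[of x] one_le_power[of "sz x + 1" a]] by simp
        also have "\<dots> \<le> (sz x + 1) ^ a * (sz x + 1)" using sz_base by (intro mult_le_mono2)
        finally show "S x + 1 \<le> (sz x + 1) ^ (a + 1)" by (simp add: algebra_simps)
      qed
    qed
    show "polyb (\<lambda>x. S x + 1)" "polyb (\<lambda>x. T x + 1)" using assms * by auto
  qed
  then show ?thesis by (rule polyb_le) simp
qed

lemma polyb_pow: "polyb S \<Longrightarrow> polyb (\<lambda>x. S x ^ n)"
  by (induction n) (auto intro: polyb_mult polyb_const)

lemma polyb_comp:
  assumes "polyb T" "polyb (\<lambda>x. sz (f x))"
  shows "polyb (\<lambda>x. T (f x))"
proof -
  obtain c where c: "\<And>x. T x \<le> (sz x + 1) ^ c" using assms(1) unfolding polyb_def by blast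
  show ?thesis
    by (rule polyb_le[OF polyb_pow[OF polyb_add[OF assms(2) polyb_const[of 1]]] c])
qed

lemma polyb_Suc: "polyb S \<Longrightarrow> polyb (\<lambda>x. Suc (S x))"
  using polyb_add[OF _ polyb_const[of 1]] by simp

lemmas polyb_intros = polyb_const polyb_sz polyb_mult polyb_add polyb_pow

definition ptime :: "('a::data \<Rightarrow> 'b::data) \<Rightarrow> bool" where
  "ptime f \<longleftrightarrow> (\<exists>T. timed UNIV f T \<and> polyb T)"

lemma ptimeI: "timed UNIV f T \<Longrightarrow> polyb T \<Longrightarrow> ptime f"
  unfolding ptime_def by blast

lemma ptime_sz: "ptime f \<Longrightarrow> polyb (\<lambda>x. sz (f x))"
proof -
  assume "ptime f"
  then obtain T where T: "timed UNIV f T" "polyb T" unfolding ptime_def by blast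
  show ?thesis
    by (rule polyb_le[OF polyb_add[OF polyb_sz T(2)]]) (rule timed_size[OF T(1) UNIV_I])
qed

lemma ptime_o: "ptime g \<Longrightarrow> ptime f \<Longrightarrow> ptime (\<lambda>x. g (f x))"
proof -
  assume g: "ptime g" and f: "ptime f"
  obtain S T where T: "timed UNIV f S" "polyb S" "timed UNIV g T" "polyb T"
    using f g unfolding ptime_def by blast
  show ?thesis
    by (rule ptimeI[OF timed_o[OF T(1,3)]], simp)
      (intro polyb_add polyb_const polyb_comp[OF _ ptime_sz[OF f]] T)
qed

lemma ptime_recode: "(\<And>x. encode (f x) = encode x) \<Longrightarrow> ptime f"
  by (rule ptimeI[OF timed_recode]) (auto intro: polyb_const)

lemma ptime_id: "ptime (\<lambda>x. x)"
  by (rule ptime_recode) simp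

lemma ptime_const: "ptime (\<lambda>_. c)"
  by (rule ptimeI[OF timed_const]) (intro polyb_intros)

lemma ptime_pair: "ptime f \<Longrightarrow> ptime g \<Longrightarrow> ptime (\<lambda>x. (f x, g x))"
proof -
  assume "ptime f" "ptime g"
  then obtain S T where "timed UNIV f S" "polyb S" "timed UNIV g T" "polyb T"
    unfolding ptime_def by blast
  then show ?thesis by (intro ptimeI[OF timed_pair] polyb_intros)
qed

lemma ptime_fst: "ptime f \<Longrightarrow> ptime (\<lambda>x. fst (f x))"
  by (rule ptime_o[of fst]) (auto intro!: ptimeI[OF timed_fst'] polyb_intros simp: encode_prod_def)

lemma ptime_snd: "ptime f \<Longrightarrow> ptime (\<lambda>x. snd (f x))"
  by (rule ptime_o[of snd]) (auto intro!: ptimeI[OF timed_snd'] polyb_intros simp: encode_prod_def)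

lemma ptime_if:
  assumes "ptime b" "ptime f" "ptime g"
  shows "ptime (\<lambda>x. if b x then f x else g x)"
proof -
  obtain Tb Tf Tg where T: "timed UNIV b Tb" "polyb Tb" "timed UNIV f Tf" "polyb Tf" "timed UNIV g Tg" "polyb Tg"
    using assms unfolding ptime_def by blast
  have "timed UNIV (\<lambda>x. if b x then f x else g x) (\<lambda>x. Tb x + (if b x then Tf x else Tg x) + 110 * sz x)"
    by (rule timed_if[OF T(1) timed_mono[OF T(3)] timed_mono[OF T(5)]]) auto
  then have "timed UNIV (\<lambda>x. if b x then f x else g x) (\<lambda>x. Tb x + (Tf x + Tg x) + 110 * sz x)"
    by (rule timed_mono) auto
  then show ?thesis by (rule ptimeI) (intro polyb_intros T)
qed

text \<open>Partial destructors: on the inputs where a function is not determined by a component of the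
  code, it is replaced by a constant.\<close>

lemma ptime_if_on:
  assumes "ptime b" "timed {x. b x} f (\<lambda>x. 60 * sz x)"
  shows "ptime (\<lambda>x. if b x then f x else c)"
proof -
  obtain Tb where T: "timed UNIV b Tb" "polyb Tb" using assms unfolding ptime_def by blast
  have "timed UNIV (\<lambda>x. if b x then f x else c) (\<lambda>x. Tb x + (if b x then 60 * sz x else 20 * sz x + 2 * sz c) + 110 * sz x)"
    using assms(2) by (intro timed_if[OF T(1)] timed_const) auto
  then have "timed UNIV (\<lambda>x. if b x then f x else c) (\<lambda>x. Tb x + (60 * sz x + 2 * sz c) + 110 * sz x)"
    by (rule timed_mono) auto
  then show ?thesis by (rule ptimeI) (intro polyb_intros T)
qed

text \<open>Functions of several arguments are treated as functions on nested pairs. In the later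
  rules for \<open>map\<close>, \<open>filter\<close>, \<open>fold\<close> and quantifiers the
  variable \<open>x\<close> acts as an environment, paired with the element at hand.\<close>

lemma ptime_2:
  "ptime (\<lambda>z. f (fst z) (snd z)) \<Longrightarrow> ptime a \<Longrightarrow> ptime b \<Longrightarrow> ptime (\<lambda>x. f (a x) (b x))"
  using ptime_o[OF _ ptime_pair, of "\<lambda>z. f (fst z) (snd z)" a b] by simp

lemma ptime_3:
  "ptime (\<lambda>z. f (fst z) (fst (snd z)) (snd (snd z))) \<Longrightarrow> ptime a \<Longrightarrow> ptime b \<Longrightarrow> ptime c \<Longrightarrow>
    ptime (\<lambda>x. f (a x) (b x) (c x))"
  using ptime_o[OF _ ptime_pair[OF _ ptime_pair], of "\<lambda>z. f (fst z) (fst (snd z)) (snd (snd z))" a b c] by simp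

named_theorems ptime_intros

lemma ptime_case_prod [ptime_intros]:
  "ptime (\<lambda>x. f x (fst (p x)) (snd (p x))) \<Longrightarrow> ptime (\<lambda>x. case p x of (a, b) \<Rightarrow> f x a b)"
  by (simp add: case_prod_beta)

lemmas [ptime_intros] = ptime_id ptime_const ptime_pair ptime_fst ptime_snd ptime_if

lemma ptime_not [ptime_intros]: "ptime a \<Longrightarrow> ptime (\<lambda>x. \<not> a x)"
proof -
  assume "ptime a"
  then have "ptime (\<lambda>x. if a x then False else True)" by (intro ptime_intros)
  also have "(\<lambda>x. if a x then False else True) = (\<lambda>x. \<not> a x)" by auto
  finally show ?thesis .
qed

lemma ptime_conj [ptime_intros]: "ptime a \<Longrightarrow> ptime b \<Longrightarrow> ptime (\<lambda>x. a x \<and> b x)"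
proof -
  assume "ptime a" "ptime b"
  then have "ptime (\<lambda>x. if a x then b x else False)" by (intro ptime_intros)
  also have "(\<lambda>x. if a x then b x else False) = (\<lambda>x. a x \<and> b x)" by auto
  finally show ?thesis .
qed

lemma ptime_disj [ptime_intros]: "ptime a \<Longrightarrow> ptime b \<Longrightarrow> ptime (\<lambda>x. a x \<or> b x)"
proof -
  assume "ptime a" "ptime b"
  then have "ptime (\<lambda>x. if a x then True else b x)" by (intro ptime_intros)
  also have "(\<lambda>x. if a x then True else b x) = (\<lambda>x. a x \<or> b x)" by auto
  finally show ?thesis .
qed

lemma ptime_imp [ptime_intros]: "ptime a \<Longrightarrow> ptime b \<Longrightarrow> ptime (\<lambda>x. a x \<longrightarrow> b x)"
  unfolding imp_conv_disj by (intro ptime_intros)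

lemma ptime_iff [ptime_intros]: "ptime a \<Longrightarrow> ptime b \<Longrightarrow> ptime (\<lambda>x. a x \<longleftrightarrow> b x)"
  unfolding iff_conv_conj_imp by (intro ptime_intros)

lemma ptime_is_node: "(\<And>x. f x \<longleftrightarrow> encode x \<noteq> Lf) \<Longrightarrow> ptime f"
  by (rule ptimeI[OF timed_is_node]) (auto intro!: polyb_intros)

lemma encode_eq_Lf [simp]:
  "encode xs = Lf \<longleftrightarrow> xs = ([] :: 'a::data list)" "encode n = Lf \<longleftrightarrow> n = (0 :: nat)"
  "encode y = Lf \<longleftrightarrow> y = (None :: 'b::data option)" "encode c = Lf \<longleftrightarrow> \<not> c"
  by (cases xs; cases n; cases y; cases c; simp)+

lemma ptime_ne_Nil: "ptime (\<lambda>xs. xs \<noteq> ([] :: 'a::data list))"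
  by (rule ptime_is_node) simp

lemma ptime_hd: "ptime (hd :: 'a::data list \<Rightarrow> 'a)"
proof -
  have "ptime (\<lambda>xs. if xs \<noteq> [] then hd xs else hd ([] :: 'a list))"
    by (rule ptime_if_on[OF ptime_ne_Nil timed_fst']) (auto simp: neq_Nil_conv)
  also have "(\<lambda>xs. if xs \<noteq> [] then hd xs else hd ([] :: 'a list)) = hd" by auto
  finally show ?thesis .
qed

lemma ptime_tl': "ptime (tl :: 'a::data list \<Rightarrow> 'a list)"
proof -
  have "ptime (\<lambda>xs. if xs \<noteq> [] then tl xs else ([] :: 'a list))"
    by (rule ptime_if_on[OF ptime_ne_Nil timed_snd']) (auto simp: neq_Nil_conv)
  also have "(\<lambda>xs. if xs \<noteq> [] then tl xs else ([] :: 'a list)) = tl" by auto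
  finally show ?thesis .
qed

lemma ptime_tl [ptime_intros]: "ptime l \<Longrightarrow> ptime (\<lambda>x. tl (l x))"
  by (rule ptime_o[OF ptime_tl'])

lemma ptime_Nil [ptime_intros]: "ptime l \<Longrightarrow> ptime (\<lambda>x. l x = [])"
  using ptime_not[OF ptime_o[OF ptime_ne_Nil, of l]] by simp

lemma ptime_Cons [ptime_intros]: "ptime a \<Longrightarrow> ptime l \<Longrightarrow> ptime (\<lambda>x. a x # l x)"
proof -
  assume "ptime a" "ptime l"
  then have "ptime (\<lambda>x. (a x, l x))" by (rule ptime_pair)
  moreover have "ptime (\<lambda>p :: 'b \<times> 'b list. fst p # snd p)" by (rule ptime_recode) auto
  ultimately show ?thesis using ptime_o by fastforce
qed

lemma ptime_case_list [ptime_intros]: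
  assumes "ptime l" "ptime a" "ptime (\<lambda>z. b (fst z) (fst (snd z)) (snd (snd z)))"
  shows "ptime (\<lambda>x. case l x of [] \<Rightarrow> a x | y # ys \<Rightarrow> b x y ys)"
proof -
  have "ptime (\<lambda>x. if l x = [] then a x else b x (hd (l x)) (tl (l x)))"
    by (intro ptime_intros assms ptime_3[OF assms(3)] ptime_o[OF ptime_hd])
  also have "(\<lambda>x. if l x = [] then a x else b x (hd (l x)) (tl (l x))) =
      (\<lambda>x. case l x of [] \<Rightarrow> a x | y # ys \<Rightarrow> b x y ys)"
    by (auto split: list.splits)
  finally show ?thesis .
qed

lemma ptime_Some [ptime_intros]: "ptime f \<Longrightarrow> ptime (\<lambda>x. Some (f x))"
proof -
  assume "ptime f"
  then have "ptime (\<lambda>x. (f x, ()))" by (intro ptime_intros)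
  moreover have "ptime (\<lambda>(y :: 'b, u :: unit). Some y)" by (rule ptime_recode) auto
  ultimately show ?thesis using ptime_o by fastforce
qed

lemma ptime_case_option [ptime_intros]:
  fixes l :: "'a::data \<Rightarrow> 'c::data option"
  assumes "ptime l" "ptime a" "ptime (\<lambda>z. b (fst z) (snd z))"
  shows "ptime (\<lambda>x. case l x of None \<Rightarrow> a x | Some y \<Rightarrow> b x y)"
proof -
  have ne: "ptime (\<lambda>y. y \<noteq> (None :: 'c option))" by (rule ptime_is_node) simp
  have "ptime (\<lambda>y. if y \<noteq> None then the y else the (None :: 'c option))"
    by (rule ptime_if_on[OF ne timed_fst']) auto
  also have "(\<lambda>y. if y \<noteq> None then the y else the (None :: 'c option)) = the" by auto
  finally have the: "ptime (the :: 'c option \<Rightarrow> 'c)" .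
  have "ptime (\<lambda>x. if l x \<noteq> None then b x (the (l x)) else a x)"
    by (intro ptime_if ptime_o[OF ne assms(1)] assms ptime_2[OF assms(3)] ptime_id ptime_o[OF the assms(1)])
  also have "(\<lambda>x. if l x \<noteq> None then b x (the (l x)) else a x) = (\<lambda>x. case l x of None \<Rightarrow> a x | Some y \<Rightarrow> b x y)"
    by (auto split: option.splits)
  finally show ?thesis .
qed

lemma ptime_Suc [ptime_intros]: "ptime f \<Longrightarrow> ptime (\<lambda>x. Suc (f x))"
proof -
  assume "ptime f"
  then have "ptime (\<lambda>x. ((), f x))" by (intro ptime_intros)
  moreover have "ptime (\<lambda>(u :: unit, n :: nat). Suc n)" by (rule ptime_recode) auto
  ultimately show ?thesis using ptime_o by fastforce
qed

lemma ptime_eq_0 [ptime_intros]: "ptime f \<Longrightarrow> ptime (\<lambda>x. f x = (0 :: nat))"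
proof -
  assume f: "ptime f"
  have "ptime (\<lambda>n. n \<noteq> (0 :: nat))" by (rule ptime_is_node) simp
  from ptime_not[OF ptime_o[OF this f]] show ?thesis by simp
qed

lemma ptime_pred [ptime_intros]: "ptime f \<Longrightarrow> ptime (\<lambda>x. f x - (1 :: nat))"
proof -
  assume f: "ptime f"
  have ne: "ptime (\<lambda>n. n \<noteq> (0 :: nat))" by (rule ptime_is_node) simp
  have "ptime (\<lambda>n. if n \<noteq> 0 then n - 1 else (0 :: nat))"
    by (rule ptime_if_on[OF ne timed_snd']) (auto simp: gr0_conv_Suc)
  also have "(\<lambda>n. if n \<noteq> 0 then n - 1 else 0) = (\<lambda>n. n - (1 :: nat))" by auto
  finally show ?thesis by (rule ptime_o[OF _ f])
qed

subsection \<open>Iteration\<close>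

text \<open>Polynomial time is not closed under iteration, because intermediate values may double in
  every round; hence the separate bound \<open>B\<close> on all of them. The loop state carries the
  environment, the remaining list and the accumulator.\<close>

lemma ptime_fold:
  fixes f :: "'c::data \<Rightarrow> 'a::data \<Rightarrow> 's::data \<Rightarrow> 's"
  assumes f: "ptime (\<lambda>z. f (fst z) (fst (snd z)) (snd (snd z)))" and l: "ptime l" and s: "ptime s"
    and B: "polyb B" "\<And>x n. sz (fold (f x) (take n (l x)) (s x)) \<le> B x"
  shows "ptime (\<lambda>x. fold (f x) (l x) (s x))"
proof -
  let ?g = "\<lambda>z :: 'c \<times> 'a list \<times> 's. (fst z, tl (fst (snd z)), f (fst z) (hd (fst (snd z))) (snd (snd z)))"
  let ?b = "\<lambda>z :: 'c \<times> 'a list \<times> 's. fst (snd z) \<noteq> []"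
  let ?F = "\<lambda>z :: 'c \<times> 'a list \<times> 's. (fst z, [] :: 'a list, fold (f (fst z)) (fst (snd z)) (snd (snd z)))"
  let ?E = "range (\<lambda>x. (x, l x, s x))"
  have "ptime ?g"
    by (intro ptime_intros ptime_3[OF f] ptime_o[OF ptime_hd])
  then obtain Tg where g: "timed UNIV ?g Tg" "polyb Tg" unfolding ptime_def by blast
  have "ptime ?b" by (intro ptime_intros)
  then obtain Tb where b: "timed UNIV ?b Tb" "polyb Tb" unfolding ptime_def by blast
  let ?R = "\<lambda>z :: 'c \<times> 'a list \<times> 's. Tb z + Tg z + 120 * sz z"
  have "polyb ?R" by (intro polyb_intros b g)
  then obtain c where c: "\<And>z. ?R z \<le> (sz z + 1) ^ c" unfolding polyb_def by blast
  let ?S = "\<lambda>x. sz x + sz (l x) + B x + 3"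
  \<comment> \<open>The time may be expressed through the first component of the state, which no
    round changes. On the start states in \<open>?E\<close> it determines the list and the initial
    accumulator.\<close>
  let ?T = "\<lambda>z :: 'c \<times> 'a list \<times> 's. sz (l (fst z)) * ?S (fst z) ^ c"
  have it: "(?g ^^ i) (x, ys, a) = (x, drop i ys, fold (f x) (take i ys) a)" if "i \<le> length ys" for i x ys a
    using that by (induction i) (auto simp: take_Suc_conv_app_nth hd_drop_conv_nth tl_drop drop_Suc)
  have dropsz: "sz (drop i ys) \<le> sz ys" for i and ys :: "'a list"
    by (induction ys arbitrary: i) (auto simp: drop_Cons' le_SucI trans_le_add2)
  have "timed ?E ?F ?T"
  proof (rule timed_while[OF b(1) timed_mono[OF g(1)]])
    fix z assume "z \<in> ?E"
    then obtain x where z: "z = (x, l x, s x)" by blast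
    let ?n = "length (l x)"
    have "(\<Sum>i\<le>?n. ?R ((?g ^^ i) z)) \<le> (\<Sum>i\<le>?n. ?S x ^ c)"
    proof (rule sum_mono)
      fix i assume "i \<in> {..?n}"
      then have "sz ((?g ^^ i) z) + 1 \<le> ?S x"
        using it[of i "l x" x "s x"] B(2)[of x i] dropsz[of i "l x"] by (simp add: z)
      then show "?R ((?g ^^ i) z) \<le> ?S x ^ c" by (meson c order.trans power_mono zero_le)
    qed
    also have "\<dots> = Suc (length (l x)) * ?S x ^ c" by simp
    also have "\<dots> \<le> sz (l x) * ?S x ^ c" using length_less_sz[of "l x"] by (intro mult_le_mono1) simp
    also have "\<dots> = ?T z" by (simp add: z)
    finally have "(\<Sum>i\<le>?n. ?R ((?g ^^ i) z)) \<le> ?T z" .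
    then show "\<exists>n. ?F z = (?g ^^ n) z \<and> (\<forall>i\<le>n. (?g ^^ i) z \<in> UNIV) \<and> (\<forall>i<n. ?b ((?g ^^ i) z)) \<and>
      \<not> ?b ((?g ^^ n) z) \<and> (\<Sum>i\<le>n. ?R ((?g ^^ i) z)) \<le> ?T z"
      using it[of _ "l x" x "s x"] by (intro exI[of _ ?n]) (simp add: z)
  qed auto
  moreover have "ptime (\<lambda>x. (x, l x, s x))" by (intro ptime_intros l s)
  then obtain T0 where 0: "timed UNIV (\<lambda>x. (x, l x, s x)) T0" "polyb T0" unfolding ptime_def by blast
  ultimately have "timed UNIV (\<lambda>x. ?F (x, l x, s x)) (\<lambda>x. T0 x + ?T (x, l x, s x) + 1)"
    by (intro timed_o[OF 0(1)]) auto
  moreover have "polyb (\<lambda>x. T0 x + ?T (x, l x, s x) + 1)"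
    unfolding fst_conv by (intro polyb_intros 0 B ptime_sz l)
  ultimately have "ptime (\<lambda>x. ?F (x, l x, s x))" by (rule ptimeI)
  from ptime_snd[OF ptime_snd[OF this]] show ?thesis by simp
qed

text \<open>If each round adds at most \<open>B x\<close>, an amount that depends on the environment
  and not on the accumulator, then all intermediate values are polynomially bounded. The invariant
  \<open>P\<close> supplies facts about the state that the growth estimate may use.\<close>

lemma ptime_fold_inv:
  fixes f :: "'c::data \<Rightarrow> 'a::data \<Rightarrow> 's::data \<Rightarrow> 's"
  assumes f: "ptime (\<lambda>z. f (fst z) (fst (snd z)) (snd (snd z)))" and l: "ptime l" and s: "ptime s"
    and B: "polyb B" and P: "\<And>x. P x (s x)"
      "\<And>x a y. P x y \<Longrightarrow> a \<in> set (l x) \<Longrightarrow> P x (f x a y) \<and> sz (f x a y) \<le> sz y + B x"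
  shows "ptime (\<lambda>x. fold (f x) (l x) (s x))"
proof (rule ptime_fold[OF f l s, of "\<lambda>x. sz (s x) + sz (l x) * B x"])
  show "polyb (\<lambda>x. sz (s x) + sz (l x) * B x)" by (intro polyb_intros ptime_sz l s B)
  fix x n
  have *: "P x (fold (f x) ys (s x)) \<and> sz (fold (f x) ys (s x)) \<le> sz (s x) + length ys * B x"
    if "set ys \<subseteq> set (l x)" for ys
    using that
  proof (induction ys rule: rev_induct)
    case (snoc a ys)
    then show ?case using P(2)[of x "fold (f x) ys (s x)" a] by auto
  qed (simp add: P)
  have "length (take n (l x)) \<le> sz (l x)" using length_less_sz[of "l x"] by simp
  then have "length (take n (l x)) * B x \<le> sz (l x) * B x" by (rule mult_le_mono1)
  then show "sz (fold (f x) (take n (l x)) (s x)) \<le> sz (s x) + sz (l x) * B x"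
    using *[of "take n (l x)"] set_take_subset[of n "l x"] by linarith
qed

lemmas ptime_fold_inc = ptime_fold_inv[where P="\<lambda>_ _. True", OF _ _ _ _ TrueI, simplified]

text \<open>A number has the same code as the list of that many units, so iteration is a special
  fold.\<close>

lemma ptime_funpow_inv:
  fixes f :: "'c::data \<Rightarrow> 's::data \<Rightarrow> 's"
  assumes f: "ptime (\<lambda>z. f (fst z) (snd z))" and n: "ptime n" and s: "ptime s"
    and B: "polyb B" and P: "\<And>x. P x (s x)" "\<And>x y. P x y \<Longrightarrow> P x (f x y) \<and> sz (f x y) \<le> sz y + B x"
  shows "ptime (\<lambda>x. (f x ^^ n x) (s x))"
proof -
  have "encode (replicate k ()) = encode k" for k
    by (induction k) auto
  then have r: "ptime (\<lambda>k. replicate k ())" by (intro ptime_recode) auto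
  have "ptime (\<lambda>z :: 'c \<times> unit \<times> 's. f (fst z) (snd (snd z)))"
    by (intro ptime_2[OF f] ptime_intros)
  then have "ptime (\<lambda>x. fold (\<lambda>_ :: unit. f x) (replicate (n x) ()) (s x))"
    by (rule ptime_fold_inv[where P=P, OF _ ptime_o[OF r n] s B]) (use P in auto)
  moreover have "fold (\<lambda>_ :: unit. g) (replicate k ()) y = (g ^^ k) y" for g :: "'s \<Rightarrow> 's" and k y
    by (induction k arbitrary: y) (auto simp: funpow_swap1)
  ultimately show ?thesis by simp
qed

lemmas ptime_funpow_inc = ptime_funpow_inv[where P="\<lambda>_ _. True", OF _ _ _ _ TrueI, simplified]

lemma ptime_rev [ptime_intros]: "ptime l \<Longrightarrow> ptime (\<lambda>x. rev (l x))"
proof (rule ptime_o[of rev])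
  have "ptime (\<lambda>xs :: 'b list. fold (\<lambda>a s. a # s) xs [])"
    by (rule ptime_fold_inc[where B=sz and l="\<lambda>xs. xs"]) (auto intro!: ptime_intros polyb_intros dest!: sz_mem)
  then show "ptime (rev :: 'b list \<Rightarrow> 'b list)" by (simp add: fold_Cons_rev[unfolded fun_eq_iff, rule_format] eta_contract_eq)
qed

subsection \<open>Lists and numbers\<close>

lemma ptime_append [ptime_intros]:
  assumes "ptime f" "ptime g"
  shows "ptime (\<lambda>x. f x @ g x)"
proof -
  have "ptime (\<lambda>z :: 'b list \<times> 'b list. fold (\<lambda>a s. a # s) (rev (fst z)) (snd z))"
    by (rule ptime_fold_inc[where B=sz]) (auto intro!: ptime_intros polyb_intros dest!: sz_mem)
  moreover have "fold (\<lambda>a s. a # s) (rev u) v = u @ v" for u v :: "'b list"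
    by (simp add: fold_Cons_rev)
  ultimately have "ptime (\<lambda>z :: 'b list \<times> 'b list. fst z @ snd z)" by simp
  from ptime_o[OF this ptime_pair[OF assms]] show ?thesis by simp
qed

text \<open>An element is smaller than its list, so the results on all elements share one polynomial
  bound in the environment.\<close>

lemma ptime_mem_bound:
  assumes "ptime (\<lambda>z. f (fst z) (snd z))" "ptime l"
  shows "\<exists>B. polyb B \<and> (\<forall>x. \<forall>a\<in>set (l x). sz (f x a) \<le> B x)"
proof -
  obtain c where c: "\<And>z. sz (f (fst z) (snd z)) \<le> (sz z + 1) ^ c"
    using ptime_sz[OF assms(1)] unfolding polyb_def by blast
  have "polyb (\<lambda>x. (sz x + sz (l x) + 2) ^ c)" by (intro polyb_intros ptime_sz assms)
  moreover have "sz (f x a) \<le> (sz x + sz (l x) + 2) ^ c" if "a \<in> set (l x)" for x a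
  proof -
    have "sz (f x a) \<le> (sz (x, a) + 1) ^ c" using c[of "(x, a)"] by simp
    also have "\<dots> \<le> (sz x + sz (l x) + 2) ^ c" using sz_mem[OF that] by (intro power_mono) auto
    finally show ?thesis .
  qed
  ultimately show ?thesis by blast
qed

lemma ptime_map [ptime_intros]:
  assumes f: "ptime (\<lambda>z. f (fst z) (snd z))" and l: "ptime l"
  shows "ptime (\<lambda>x. map (f x) (l x))"
proof -
  obtain B where B: "polyb B" "\<And>x a. a \<in> set (l x) \<Longrightarrow> sz (f x a) \<le> B x"
    using ptime_mem_bound[OF f l] by blast
  have "ptime (\<lambda>x. rev (fold (\<lambda>a s. f x a # s) (l x) []))"
    by (intro ptime_rev ptime_fold_inc[where B="\<lambda>x. B x + 1"] ptime_intros ptime_2[OF f] polyb_intros l)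
      (use B in \<open>auto intro: le_SucI\<close>)
  moreover have "rev (fold (\<lambda>a s. g a # s) l s) = rev s @ map g l" for g :: "'b \<Rightarrow> 'c" and l s
    by (induction l arbitrary: s) auto
  ultimately show ?thesis by simp
qed

lemma ptime_concat [ptime_intros]: "ptime l \<Longrightarrow> ptime (\<lambda>x. concat (l x))"
proof (rule ptime_o[of concat])
  have "ptime (\<lambda>ls :: 'b list list. fold (\<lambda>a s. a @ s) (rev ls) [])"
  proof (rule ptime_fold_inc[where B=sz])
    fix ls and a y :: "'b list" assume "a \<in> set (rev ls)"
    then show "sz (a @ y) \<le> sz y + sz ls" using sz_mem[of a ls] sz_append[of a y] by simp
  qed (intro ptime_intros polyb_intros)+
  moreover have "fold (\<lambda>a s. a @ s) (rev ls) [] = concat ls" for ls :: "'b list list"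
    by (simp add: concat_conv_foldr foldr_conv_fold)
  ultimately show "ptime (concat :: 'b list list \<Rightarrow> 'b list)" by simp
qed

lemma ptime_filter [ptime_intros]:
  assumes f: "ptime (\<lambda>z. P (fst z) (snd z))" and l: "ptime l"
  shows "ptime (\<lambda>x. filter (P x) (l x))"
proof -
  have "ptime (\<lambda>x. concat (map (\<lambda>a. if P x a then [a] else []) (l x)))"
    by (intro ptime_intros f l)
  moreover have "concat (map (\<lambda>a. if Q a then [a] else []) l) = filter Q l" for Q :: "'b \<Rightarrow> bool" and l
    by (induction l) auto
  ultimately show ?thesis by simp
qed

lemma ptime_Bex [ptime_intros]:
  assumes f: "ptime (\<lambda>z. P (fst z) (snd z))" and l: "ptime l"
  shows "ptime (\<lambda>x. \<exists>a\<in>set (l x). P x a)"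
proof -
  have "ptime (\<lambda>x. filter (P x) (l x) \<noteq> [])" by (intro ptime_intros f l)
  moreover have "filter Q l \<noteq> [] \<longleftrightarrow> (\<exists>a\<in>set l. Q a)" for Q :: "'b \<Rightarrow> bool" and l
    by (induction l) auto
  ultimately show ?thesis by simp
qed

lemma ptime_Ball [ptime_intros]:
  assumes f: "ptime (\<lambda>z. P (fst z) (snd z))" and l: "ptime l"
  shows "ptime (\<lambda>x. \<forall>a\<in>set (l x). P x a)"
proof -
  have "ptime (\<lambda>x. \<not> (\<exists>a\<in>set (l x). \<not> P x a))" by (intro ptime_intros f l)
  then show ?thesis by simp
qed

lemma ptime_length [ptime_intros]: "ptime l \<Longrightarrow> ptime (\<lambda>x. length (l x))"
proof (rule ptime_o[of length])
  have "ptime (\<lambda>l :: 'b list. fold (\<lambda>_ n. Suc n) l 0)"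
    by (rule ptime_fold_inc[where B="\<lambda>_. 2"]) (auto intro!: ptime_intros polyb_intros)
  moreover have "fold (\<lambda>_ n. Suc n) l k = k + length l" for l :: "'b list" and k
    by (induction l arbitrary: k) auto
  ultimately show "ptime (length :: 'b list \<Rightarrow> nat)" by simp
qed

lemma ptime_add [ptime_intros]:
  assumes "ptime f" "ptime g"
  shows "ptime (\<lambda>x. f x + g x :: nat)"
proof -
  have "ptime (\<lambda>x. (Suc ^^ f x) (g x))"
    by (rule ptime_funpow_inc[where B="\<lambda>_. 2"]) (auto intro!: ptime_intros polyb_intros assms)
  moreover have "(Suc ^^ m) n = m + n" for m n by (induction m) auto
  ultimately show ?thesis by simp
qed

lemma ptime_diff [ptime_intros]:
  assumes "ptime f" "ptime g"
  shows "ptime (\<lambda>x. f x - g x :: nat)"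
proof -
  have "ptime (\<lambda>x. ((\<lambda>n. n - 1) ^^ g x) (f x))"
    by (rule ptime_funpow_inc[where B="\<lambda>_. 0"]) (intro ptime_intros polyb_intros assms | simp)+
  moreover have "((\<lambda>n. n - 1) ^^ m) n = n - m" for m n :: nat by (induction m) auto
  ultimately show ?thesis by simp
qed

lemma ptime_le [ptime_intros]: "ptime f \<Longrightarrow> ptime g \<Longrightarrow> ptime (\<lambda>x. f x \<le> (g x :: nat))"
  using ptime_eq_0[OF ptime_diff] by fastforce

lemma ptime_less [ptime_intros]: "ptime f \<Longrightarrow> ptime g \<Longrightarrow> ptime (\<lambda>x. f x < (g x :: nat))"
  using ptime_not[OF ptime_le[of g f]] by (simp add: not_le)

lemma ptime_eq_nat [ptime_intros]: "ptime f \<Longrightarrow> ptime g \<Longrightarrow> ptime (\<lambda>x. f x = (g x :: nat))"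
  unfolding eq_iff by (intro ptime_intros)

lemma ptime_upt [ptime_intros]: "ptime n \<Longrightarrow> ptime (\<lambda>x. [0..<n x])"
proof (rule ptime_o[of "\<lambda>n. [0..<n]"])
  \<comment> \<open>Counting down, the state after i rounds is (n - i, [n - i..<n]). The invariant
    \<open>fst s \<le> n\<close> bounds the number that is pushed.\<close>
  let ?f = "\<lambda>s :: nat \<times> nat list. (fst s - 1, (fst s - 1) # snd s)"
  have "ptime (\<lambda>n. (?f ^^ n) (n, []))"
    by (rule ptime_funpow_inv[where B="\<lambda>n. 2 * n + 2" and P="\<lambda>n s. fst s \<le> n"])
      (auto intro!: ptime_intros polyb_Suc polyb_le[OF polyb_sz, of "\<lambda>n. 2 * n"] ptime_pred[simplified])
  then have "ptime (\<lambda>n. snd ((?f ^^ n) (n, [])))" by (intro ptime_intros)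
  moreover have "i \<le> n \<Longrightarrow> (?f ^^ i) (n, []) = (n - i, [n - i..<n])" for i n
    by (induction i) (auto simp: upt_conv_Cons Suc_diff_Suc)
  ultimately show "ptime (\<lambda>n. [0..<n])" by simp
qed

lemma ptime_drop [ptime_intros]:
  assumes "ptime n" "ptime l"
  shows "ptime (\<lambda>x. drop (n x) (l x))"
proof -
  have "sz (tl y) \<le> sz y" for y :: "'b list" by (cases y) auto
  then have "ptime (\<lambda>x. (tl ^^ n x) (l x))"
    by (intro ptime_funpow_inc[where B="\<lambda>_. 0"] ptime_intros polyb_intros assms) simp
  moreover have "(tl ^^ n) l = drop n l" for n and l :: "'b list"
    by (induction n) (auto simp: drop_Suc tl_drop)
  ultimately show ?thesis by simp
qed

lemma ptime_take [ptime_intros]: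
  assumes "ptime n" "ptime l"
  shows "ptime (\<lambda>x. take (n x) (l x))"
proof -
  have "ptime (\<lambda>x. rev (drop (length (l x) - n x) (rev (l x))))" by (intro ptime_intros assms)
  moreover have "rev (drop (length l - n) (rev l)) = take n l" for n and l :: "'b list"
    by (cases "n \<le> length l") (auto simp: rev_drop)
  ultimately show ?thesis by simp
qed

lemma ptime_zip [ptime_intros]:
  assumes "ptime k" "ptime l"
  shows "ptime (\<lambda>x. zip (k x) (l x))"
proof -
  let ?f = "\<lambda>a (s :: ('b \<times> 'c) list \<times> 'c list).
     case snd s of [] \<Rightarrow> (fst s, []) | y # ys \<Rightarrow> ((a, y) # fst s, ys)"
  have "ptime (\<lambda>z :: 'b list \<times> 'c list. fold ?f (fst z) ([], snd z))"
    by (rule ptime_fold_inc[where B="\<lambda>z. sz z + 2"])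
      (auto intro!: ptime_intros polyb_intros polyb_Suc dest!: sz_mem split: list.split)
  then have "ptime (\<lambda>z :: 'b list \<times> 'c list. rev (fst (fold ?f (fst z) ([], snd z))))"
    by (intro ptime_intros)
  moreover have "rev (fst (fold ?f u (s, v))) = rev s @ zip u v" for u v s
    by (induction u arbitrary: v s) (auto split: list.split)
  ultimately have "ptime (\<lambda>z :: 'b list \<times> 'c list. zip (fst z) (snd z))" by simp
  from ptime_2[OF this assms] show ?thesis .
qed

lemma ptime_eq_list:
  assumes eq: "ptime (\<lambda>z :: 'b \<times> 'b. fst z = snd z)" and k: "ptime k" and l: "ptime l"
  shows "ptime (\<lambda>x. k x = (l x :: 'b::data list))"
proof -
  let ?f = "\<lambda>a (s :: bool \<times> 'b list). case snd s of [] \<Rightarrow> (False, []) | y # ys \<Rightarrow> (fst s \<and> a = y, ys)"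
  have szb: "sz b \<le> 3" for b :: bool by (cases b) auto
  have "ptime (\<lambda>z :: 'b list \<times> 'b list. fold ?f (fst z) (True, snd z))"
  proof (rule ptime_fold_inc[where B="\<lambda>_. 3"])
    show "sz (?f a y) \<le> sz y + 3" for a y
      using szb[of "fst y \<and> a = hd (snd y)"] by (cases y; cases "snd y") auto
  qed (intro ptime_intros polyb_intros ptime_2[OF eq])+
  then have "ptime (\<lambda>z :: 'b list \<times> 'b list. fst (fold ?f (fst z) (True, snd z)) \<and> snd (fold ?f (fst z) (True, snd z)) = [])"
    by (intro ptime_intros)
  moreover have "fst (fold ?f u (b, v)) \<and> snd (fold ?f u (b, v)) = [] \<longleftrightarrow> b \<and> u = v" for u v b
    by (induction u arbitrary: v b) (auto split: list.split)
  ultimately have "ptime (\<lambda>z :: 'b list \<times> 'b list. fst z = snd z)" by simp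
  from ptime_2[OF this k l] show ?thesis .
qed

lemma ptime_eq_nat_list [ptime_intros]: "ptime k \<Longrightarrow> ptime l \<Longrightarrow> ptime (\<lambda>x. k x = (l x :: nat list))"
  and ptime_eq_bool_list [ptime_intros]: "ptime k' \<Longrightarrow> ptime l' \<Longrightarrow> ptime (\<lambda>x. k' x = (l' x :: bool list))"
  by (intro ptime_eq_list ptime_intros; assumption)+

lemma ptime_mem:
  assumes eq: "ptime (\<lambda>z :: 'b \<times> 'b. fst z = snd z)" and a: "ptime a" and l: "ptime l"
  shows "ptime (\<lambda>x. a x \<in> set (l x :: 'b::data list))"
proof -
  have "ptime (\<lambda>x. \<exists>y\<in>set (l x). a x = y)"
    by (intro ptime_intros l ptime_2[OF eq] ptime_o[OF a])
  then show ?thesis by simp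
qed

lemma ptime_eq_nat_pair: "ptime (\<lambda>z :: (nat \<times> nat) \<times> (nat \<times> nat). fst z = snd z)"
proof -
  have "ptime (\<lambda>z :: (nat \<times> nat) \<times> (nat \<times> nat). fst (fst z) = fst (snd z) \<and> snd (fst z) = snd (snd z))"
    by (intro ptime_intros)
  then show ?thesis by (simp only: prod_eq_iff)
qed

lemma ptime_mem_nat_pair [ptime_intros]:
  "ptime a \<Longrightarrow> ptime l \<Longrightarrow> ptime (\<lambda>x. (a x :: nat \<times> nat) \<in> set (l x))"
  by (rule ptime_mem[OF ptime_eq_nat_pair])

lemma ptime_mem_bool_list [ptime_intros]:
  "ptime a \<Longrightarrow> ptime l \<Longrightarrow> ptime (\<lambda>x. (a x :: bool list) \<in> set (l x))"
  by (rule ptime_mem) (intro ptime_intros)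

lemma ptime_mem_nat [ptime_intros]:
  "ptime a \<Longrightarrow> ptime l \<Longrightarrow> ptime (\<lambda>x. (a x :: nat) \<in> set (l x))"
  by (rule ptime_mem) (intro ptime_intros)

text \<open>The length \<open>n\<close> is a constant of the program and not part of the input: the
  output has (length l) ^ n entries. This is the place where the number of cells per vertex has to
  be independent of k and of the formula size.\<close>

lemma ptime_n_lists [ptime_intros]: "ptime l \<Longrightarrow> ptime (\<lambda>x. List.n_lists n (l x))"
proof (induction n)
  case (Suc n)
  show ?case
    unfolding List.n_lists.simps by (intro ptime_intros Suc.IH ptime_o[OF Suc.prems] Suc.prems)
qed (simp add: ptime_const)

lemma ptime_product [ptime_intros]:
  assumes "ptime k" "ptime l"
  shows "ptime (\<lambda>x. List.product (k x) (l x))"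
  unfolding product_concat_map by (intro ptime_intros assms ptime_o[OF assms(2)])

text \<open>One step removes the head if it satisfies the predicate and otherwise idles, so
  length-many rounds suffice and no early exit is needed.\<close>

lemma ptime_dropWhile [ptime_intros]:
  assumes P: "ptime (\<lambda>z. P (fst z) (snd z))" and l: "ptime l"
  shows "ptime (\<lambda>x. dropWhile (P x) (l x))"
proof -
  let ?f = "\<lambda>x (s :: 'b list). case s of [] \<Rightarrow> [] | y # ys \<Rightarrow> if P x y then ys else s"
  have "ptime (\<lambda>x. (?f x ^^ length (l x)) (l x))"
    by (rule ptime_funpow_inc[where B="\<lambda>_. 0"])
      (auto intro!: ptime_intros ptime_2[OF P] polyb_intros l split: list.split)
  moreover have "((\<lambda>s. case s of [] \<Rightarrow> [] | y # ys \<Rightarrow> if Q y then ys else s) ^^ n) l = dropWhile Q l"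
    if "length l \<le> n" for Q n and l :: "'b list"
    using that
  proof (induction n arbitrary: l)
    case (Suc n)
    have stop: "((\<lambda>s. case s of [] \<Rightarrow> [] | y # ys \<Rightarrow> if Q y then ys else s) ^^ n) l = l"
      if "l = [] \<or> \<not> Q (hd l)" for n and l :: "'b list"
      using that by (induction n) (auto split: list.split)
    show ?case using Suc stop[of l n] by (cases l) (auto simp: funpow_swap1 simp del: funpow.simps(2) simp add: funpow_Suc_right)
  qed simp
  ultimately show ?thesis by simp
qed

lemma ptime_takeWhile [ptime_intros]:
  assumes P: "ptime (\<lambda>z. P (fst z) (snd z))" and l: "ptime l"
  shows "ptime (\<lambda>x. takeWhile (P x) (l x))"
proof -
  have "ptime (\<lambda>x. take (length (l x) - length (dropWhile (P x) (l x))) (l x))"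
    by (intro ptime_intros P l)
  moreover have "take (length l - length (dropWhile Q l)) l = takeWhile Q l" for Q and l :: "'b list"
    by (metis add_diff_cancel_right' append_eq_conv_conj length_append takeWhile_dropWhile_id)
  ultimately show ?thesis by simp
qed

section \<open>Prefix-free encodings\<close>

text \<open>The cancellation form, which includes injectivity; it is what allows components of a
  concatenated code to be split off one by one.\<close>

definition prefix_free :: "('a \<Rightarrow> bool list) \<Rightarrow> bool" where
  "prefix_free e \<longleftrightarrow> (\<forall>a b r s. e a @ r = e b @ s \<longrightarrow> a = b \<and> r = s)"

lemma prefix_freeD: "prefix_free e \<Longrightarrow> e a @ r = e b @ s \<Longrightarrow> a = b \<and> r = s"
  unfolding prefix_free_def by blast

lemma prefix_free_inj: "prefix_free e \<Longrightarrow> e a = e b \<longleftrightarrow> a = b"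
  using prefix_freeD[of e a "[]" b "[]"] by auto

lemma prefix_free_nat: "prefix_free enc_nat"
  unfolding prefix_free_def
proof (intro allI)
  fix a b r s
  show "enc_nat a @ r = enc_nat b @ s \<longrightarrow> a = b \<and> r = s"
  proof (induction a arbitrary: b rule: enc_nat.induct)
    case 1
    show ?case by (cases b) auto
  next
    case (2 n)
    show ?case
    proof (cases b)
      case (Suc k)
      show ?thesis
      proof
        assume eq: "enc_nat (Suc n) @ r = enc_nat b @ s"
        then have "odd (Suc n) = odd (Suc k)" and rest: "enc_nat (Suc n div 2) @ r = enc_nat (Suc k div 2) @ s"
          using Suc by auto
        moreover from rest 2 have "Suc n div 2 = Suc k div 2" "r = s" by blast+
        ultimately show "Suc n = b \<and> r = s" using Suc by presburger
      qed
    qed auto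
  qed
qed

lemma prefix_free_list:
  assumes "prefix_free e"
  shows "prefix_free (enc_list e)"
  unfolding prefix_free_def
proof (intro allI impI)
  fix xs ys r s assume "enc_list e xs @ r = enc_list e ys @ s"
  then have "length xs = length ys \<and> concat (map e xs) @ r = concat (map e ys) @ s"
    unfolding enc_list_def append_assoc by (rule prefix_freeD[OF prefix_free_nat])
  then have "length xs = length ys" "concat (map e xs) @ r = concat (map e ys) @ s" by simp_all
  then show "xs = ys \<and> r = s"
  proof (induction xs ys rule: list_induct2)
    case (Cons x xs y ys)
    then have "e x @ (concat (map e xs) @ r) = e y @ (concat (map e ys) @ s)" by simp
    from prefix_freeD[OF assms this] Cons.IH show ?case by simp
  qed simp
qed

lemma prefix_free_edge: "prefix_free (\<lambda>(u, v, t). enc_nat u @ enc_nat v @ enc_nat t)"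
  unfolding prefix_free_def
proof (intro allI impI)
  fix a b :: "nat \<times> nat \<times> nat" and r s
  obtain u v t u' v' t' where a: "a = (u, v, t)" and b: "b = (u', v', t')" by (metis prod_cases3)
  assume "(case a of (u, v, t) \<Rightarrow> enc_nat u @ enc_nat v @ enc_nat t) @ r =
    (case b of (u, v, t) \<Rightarrow> enc_nat u @ enc_nat v @ enc_nat t) @ s"
  then have *: "enc_nat u @ (enc_nat v @ (enc_nat t @ r)) = enc_nat u' @ (enc_nat v' @ (enc_nat t' @ s))"
    by (simp add: a b)
  note 1 = prefix_freeD[OF prefix_free_nat *]
  note 2 = prefix_freeD[OF prefix_free_nat conjunct2[OF 1]]
  note 3 = prefix_freeD[OF prefix_free_nat conjunct2[OF 2]]
  show "a = b \<and> r = s" using 1 2 3 by (simp add: a b)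
qed

text \<open>Membership in \<open>SetTEXP_L\<close> asserts that some instance with the given code is
  a yes-instance; injectivity makes this a statement about the constructed instance.\<close>

lemma enc_texp_inj: "enc_texp I = enc_texp J \<longleftrightarrow> I = J"
proof
  assume *: "enc_texp I = enc_texp J"
  obtain n L es s Xs n' L' es' s' Xs' where I: "I = (n, L, es, s, Xs)" and J: "J = (n', L', es', s', Xs')"
    by (metis prod_cases5)
  note 1 = prefix_freeD[OF prefix_free_nat, OF *[unfolded I J enc_texp_def prod.case]]
  note 2 = prefix_freeD[OF prefix_free_nat, OF conjunct2[OF 1]]
  note 3 = prefix_freeD[OF prefix_free_list[OF prefix_free_edge], OF conjunct2[OF 2]]
  note 4 = prefix_freeD[OF prefix_free_nat, OF conjunct2[OF 3]]
  have "Xs = Xs'"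
    using conjunct2[OF 4] prefix_free_inj[OF prefix_free_list[OF prefix_free_list[OF prefix_free_nat]]] by blast
  then show "I = J" using 1 2 3 4 by (simp add: I J)
qed simp

section \<open>Formulas in negation normal form\<close>

text \<open>\<^term>\<open>Gate True\<close> is disjunction and \<^term>\<open>Gate False\<close> is conjunction; a variable is named by
  the encoding of its index, because the index itself may be exponential in the input length.\<close>

datatype fm = Lit bool "bool list" | Gate bool "fm list"

text \<open>One operator for both gate types, so that disjunctive and conjunctive normal forms are
  treated by the same lemmas.\<close>

definition quant :: "bool \<Rightarrow> ('a \<Rightarrow> bool) \<Rightarrow> 'a list \<Rightarrow> bool" where
  "quant b P xs \<longleftrightarrow> (if b then \<exists>x\<in>set xs. P x else \<forall>x\<in>set xs. P x)"

lemma quant_cong [fundef_cong]: "xs = ys \<Longrightarrow> (\<And>x. x \<in> set ys \<Longrightarrow> P x = Q x) \<Longrightarrow> quant b P xs = quant b Q ys"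
  by (auto simp: quant_def)

fun ev :: "bool list set \<Rightarrow> fm \<Rightarrow> bool" where
  "ev A (Lit s x) = ((x \<in> A) = s)"
| "ev A (Gate b fs) = quant b (ev A) fs"

fun fvars :: "fm \<Rightarrow> bool list set" where
  "fvars (Lit s x) = {x}"
| "fvars (Gate b fs) = (\<Union>f\<in>set fs. fvars f)"

text \<open>The bounds w on the weft and d on the depth as budgets that are spent while descending;
  a gate with more than two inputs spends one unit of weft.\<close>

fun shape :: "nat \<Rightarrow> nat \<Rightarrow> fm \<Rightarrow> bool" where
  "shape w d (Lit s x) = True"
| "shape w d (Gate b fs) = (d > 0 \<and> (length fs > 2 \<longrightarrow> w > 0) \<and>
     (\<forall>f\<in>set fs. shape (if length fs > 2 then w - 1 else w) (d - 1) f))"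

text \<open>The flag is the truth value to be expressed. By de Morgan, negations only flip it on the
  way down, so neither depth nor weft increases.\<close>

fun nnf :: "bool \<Rightarrow> circ \<Rightarrow> fm" where
  "nnf s (Inp i) = Lit s (enc_nat i)"
| "nnf s (NotG c) = nnf (\<not> s) c"
| "nnf s (AndG cs) = Gate (\<not> s) (map (nnf s) cs)"
| "nnf s (OrG cs) = Gate s (map (nnf s) cs)"

lemma fold_max_le: "fold max xs a \<le> n \<longleftrightarrow> a \<le> n \<and> (\<forall>x\<in>set xs. x \<le> (n :: nat))"
  by (induction xs arbitrary: a) auto

lemma ev_nnf: "ev (enc_nat ` A) (nnf s C) \<longleftrightarrow> circ_eval (\<lambda>i. i \<in> A) C = s"
  by (induction s C rule: nnf.induct)
    (auto simp: quant_def list_all_iff list_ex_iff prefix_free_inj[OF prefix_free_nat] image_iff)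

lemma fvars_nnf: "fvars (nnf s C) = enc_nat ` circ_inputs C"
  by (induction s C rule: nnf.induct) auto

lemma weighted_sat_nnf:
  "weighted_sat C k \<longleftrightarrow> (\<exists>A \<subseteq> fvars (nnf True C). card A = k \<and> ev A (nnf True C))"
proof -
  have inj: "inj enc_nat" using prefix_free_inj[OF prefix_free_nat] by (auto intro: injI)
  have *: "card (enc_nat ` S) = card S" for S
    by (rule card_image[OF inj_on_subset[OF inj]]) simp
  have "(\<exists>A \<subseteq> enc_nat ` circ_inputs C. card A = k \<and> ev A (nnf True C)) \<longleftrightarrow>
    (\<exists>S \<subseteq> circ_inputs C. card (enc_nat ` S) = k \<and> ev (enc_nat ` S) (nnf True C))"
    by (metis image_mono subset_imageE)
  then show ?thesis
    unfolding weighted_sat_def fvars_nnf * ev_nnf by simp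
qed

lemma shape_mono: "shape w d f \<Longrightarrow> d \<le> d' \<Longrightarrow> shape w d' f"
proof (induction w d f arbitrary: d' rule: shape.induct)
  case (2 w d b fs)
  then show ?case by (auto simp: diff_le_mono)
qed auto

text \<open>The top part of a formula, down to the first large gates of polarity opposite to \<^term>\<open>b\<close>,
  is multiplied out.\<close>

primrec flat :: "nat \<Rightarrow> bool \<Rightarrow> fm \<Rightarrow> fm list list" where
  "flat 0 b f = [[f]]"
| "flat (Suc d) b f = (case f of Lit s x \<Rightarrow> [[f]] | Gate c fs \<Rightarrow>
     if c = b then concat (map (flat d b) fs) else
     (case fs of [] \<Rightarrow> [[]] | g # gs \<Rightarrow>
       (case gs of [] \<Rightarrow> flat d b g | h # hs \<Rightarrow>
         (case hs of [] \<Rightarrow> concat (map (\<lambda>u. map (\<lambda>v. u @ v) (flat d b h)) (flat d b g)) | _ \<Rightarrow> [fs]))))"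

text \<open>For b = True the result is read as a disjunction of conjunctions, for b = False dually.
  Gates of polarity b are merged into the outer level whatever their fan-in, gates of opposite
  polarity with at most two inputs are distributed, and those with more inputs become one inner
  list.\<close>

lemma ev_flat: "quant b (quant (\<not> b) (ev A)) (flat d b f) = ev A f"
proof (induction d arbitrary: f)
  case 0
  show ?case by (simp add: quant_def)
next
  case (Suc d)
  \<comment> \<open>Distributivity for a two-input gate of opposite polarity.\<close>
  have pair: "quant b (quant (\<not> b) P) (concat (map (\<lambda>u. map (\<lambda>v. u @ v) V) U)) \<longleftrightarrow>
      quant (\<not> b) (quant b (quant (\<not> b) P)) [U, V]" for P :: "fm \<Rightarrow> bool" and U V
    by (cases b) (fastforce simp: quant_def ball_Un bex_Un)+
  have conc: "quant b P (concat xss) = quant b (quant b P) xss" for P :: "fm list \<Rightarrow> bool" and xss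
    by (cases b) (auto simp: quant_def)
  have map: "quant c P (map h xs) = quant c (\<lambda>x. P (h x)) xs" for c P and h :: "fm \<Rightarrow> fm list list" and xs
    by (auto simp: quant_def)
  have one: "quant c P [x] = P x" for c and P :: "'z \<Rightarrow> bool" and x by (auto simp: quant_def)
  show ?case
  proof (cases f)
    case (Gate c fs)
    show ?thesis
    proof (cases "c = b")
      case True
      then show ?thesis using Gate by (simp add: conc map Suc)
    next
      case False
      then have c: "c = (\<not> b)" by simp
      show ?thesis using Gate c Suc
        by (auto simp: pair one split: list.split) (auto simp: quant_def split: if_splits)
    qed
  qed (simp add: one)
qed

lemma flat_Suc_cases:
  assumes "t \<in> set (flat (Suc d) b f)" "g \<in> set t"
  shows "(\<exists>s x. f = Lit s x \<and> g = f) \<or> (\<exists>c fs. f = Gate c fs \<and>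
    ((\<exists>f'\<in>set fs. \<exists>t'\<in>set (flat d b f'). g \<in> set t') \<or> 2 < length fs \<and> g \<in> set fs))"
proof (cases f)
  case (Gate c fs)
  show ?thesis
  proof (cases "c = b")
    case False
    consider "fs = []" | x where "fs = [x]" | x y where "fs = [x, y]" | x y z zs where "fs = x # y # z # zs"
      by (metis list.exhaust)
    then show ?thesis using assms Gate False by cases auto
  qed (use assms Gate in auto)
qed (use assms in auto)

lemma fvars_flat: "t \<in> set (flat d b f) \<Longrightarrow> g \<in> set t \<Longrightarrow> fvars g \<subseteq> fvars f"
proof (induction d arbitrary: f t g)
  case (Suc d)
  from flat_Suc_cases[OF Suc.prems] show ?case
    using Suc.IH by fastforce
qed simp

text \<open>A member of an inner list is either a literal or an input of a large gate, so one unit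
  of weft is spent. As the recursion depth is at least the depth of the formula,
  \<open>flat 0\<close> is reached at literals only.\<close>

lemma shape_flat: "shape (Suc w) d f \<Longrightarrow> t \<in> set (flat d b f) \<Longrightarrow> g \<in> set t \<Longrightarrow> shape w d g"
proof (induction d arbitrary: f t g)
  case 0
  then show ?case by (cases f) auto
next
  case (Suc d)
  have weaken: "shape (Suc w) d f'" if "shape w d f'" for f'
    using that by (induction w d f' rule: shape.induct) (auto split: if_splits)
  from flat_Suc_cases[OF Suc.prems(2,3)] show ?case
  proof (elim disjE exE conjE bexE)
    fix s x assume "f = Lit s x" "g = f"
    then show ?thesis by simp
  next
    fix c fs f' t' assume *: "f = Gate c fs" "f' \<in> set fs" "t' \<in> set (flat d b f')" "g \<in> set t'"
    have "shape (if length fs > 2 then w else Suc w) d f'" using Suc.prems(1) *(1,2) by (auto split: if_splits)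
    then have "shape (Suc w) d f'" using weaken by (auto split: if_splits)
    then have "shape w d g" using Suc.IH *(3,4) by blast
    then show ?thesis by (rule shape_mono) simp
  next
    fix c fs assume *: "f = Gate c fs" "2 < length fs" "g \<in> set fs"
    then have "shape w d g" using Suc.prems(1) by auto
    then show ?thesis by (rule shape_mono) simp
  qed
qed

text \<open>Without large gates only the distribution of binary gates lengthens the inner lists, and
  it at most doubles the bound per level.\<close>

lemma flat_small: "shape 0 d f \<Longrightarrow> t \<in> set (flat d b f) \<Longrightarrow> length t \<le> 2 ^ d \<and> (\<forall>g\<in>set t. \<exists>s x. g = Lit s x)"
proof (induction d arbitrary: f t)
  case 0
  then show ?case by (cases f) auto
next
  case (Suc d)
  have le: "(1 :: nat) \<le> 2 * 2 ^ d" by simp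
  show ?case
  proof (cases f)
    case (Gate c fs)
    have IH: "length t' \<le> 2 ^ d \<and> (\<forall>g\<in>set t'. \<exists>s x. g = Lit s x)" if "f' \<in> set fs" "t' \<in> set (flat d b f')" for f' t'
      using Suc.prems(1) Gate that by (intro Suc.IH[of f']) auto
    have fs: "length fs \<le> 2" using Suc.prems(1) Gate by auto
    show ?thesis
    proof (cases "c = b")
      case True
      then obtain f' where "f' \<in> set fs" "t \<in> set (flat d b f')" using Suc.prems(2) Gate by auto
      from IH[OF this] show ?thesis by (auto intro: le_SucI)
    next
      case False
      consider "fs = []" | x where "fs = [x]" | x y where "fs = [x, y]" using fs
        by (cases fs; cases "tl fs"; cases "tl (tl fs)") auto
      then show ?thesis
      proof cases
        case 3
        then obtain u v where "u \<in> set (flat d b x)" "v \<in> set (flat d b y)" "t = u @ v"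
          using Suc.prems(2) Gate False by auto
        then show ?thesis using IH[of x u] IH[of y v] 3 by auto
      next
        case 2
        then have "t \<in> set (flat d b x)" using Suc.prems(2) Gate False by auto
        from IH[OF _ this] 2 show ?thesis by (auto intro: order.trans)
      qed (use Suc.prems(2) Gate False in auto)
    qed
  qed (use Suc.prems le in auto)
qed

text \<open>Three flattenings with alternating polarity, applied to weft 2, 1 and 0. The first
  \<open>concat\<close> merges the conjunction ending one flattening with that opening the next, the
  second does the same for the disjunctions. The four list levels are an OR of ANDs of ORs of short
  conjunctions.\<close>

definition nf :: "nat \<Rightarrow> fm \<Rightarrow> fm list list list list" where
  "nf d f = map (\<lambda>e. map (\<lambda>c. concat (map (flat d True) c)) (concat (map (flat d False) e))) (flat d True f)"

lemma ev_nf: "ev A f \<longleftrightarrow> (\<exists>E\<in>set (nf d f). \<forall>ts\<in>set E. \<exists>t\<in>set ts. \<forall>l\<in>set t. ev A l)"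
proof -
  have T: "ev A f \<longleftrightarrow> (\<exists>t\<in>set (flat d True f). \<forall>l\<in>set t. ev A l)" for f
    using ev_flat[of True A d f] by (simp add: quant_def)
  have F: "ev A f \<longleftrightarrow> (\<forall>t\<in>set (flat d False f). \<exists>l\<in>set t. ev A l)" for f
    using ev_flat[of False A d f] by (simp add: quant_def)
  have "ev A f \<longleftrightarrow> (\<exists>e\<in>set (flat d True f). \<forall>g\<in>set e. \<forall>c\<in>set (flat d False g). \<exists>h\<in>set c.
      \<exists>t\<in>set (flat d True h). \<forall>l\<in>set t. ev A l)"
  proof -
    have G: "ev A g \<longleftrightarrow> (\<forall>c\<in>set (flat d False g). \<exists>h\<in>set c. \<exists>t\<in>set (flat d True h). \<forall>l\<in>set t. ev A l)" for g
      by (rule trans[OF F]) (intro ball_cong bex_cong refl T)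
    show ?thesis by (rule trans[OF T]) (intro ball_cong bex_cong refl G)
  qed
  also have "\<dots> \<longleftrightarrow> (\<exists>E\<in>set (nf d f). \<forall>ts\<in>set E. \<exists>t\<in>set ts. \<forall>l\<in>set t. ev A l)"
    by (simp add: nf_def)
  finally show ?thesis .
qed

lemma nf_terms:
  assumes "shape 2 d f" "E \<in> set (nf d f)" "ts \<in> set E" "t \<in> set ts"
  shows "length t \<le> 2 ^ d" "l \<in> set t \<Longrightarrow> \<exists>s x. l = Lit s x \<and> x \<in> fvars f"
proof -
  obtain e g c h where e: "e \<in> set (flat d True f)" "g \<in> set e" "c \<in> set (flat d False g)" "h \<in> set c"
    "t \<in> set (flat d True h)"
    using assms(2-) by (auto simp: nf_def)
  have "shape 1 d g" using shape_flat[of 1 d f e True g] assms(1) e by (simp add: numeral_2_eq_2)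
  then have "shape 0 d h" using shape_flat[of 0 d g c False h] e by simp
  from flat_small[OF this e(5)] show "length t \<le> 2 ^ d" by blast
  show "\<exists>s x. l = Lit s x \<and> x \<in> fvars f" if "l \<in> set t"
    using flat_small[OF \<open>shape 0 d h\<close> e(5)] that fvars_flat[OF e(5) that] fvars_flat[OF e(3,4)] fvars_flat[OF e(1,2)]
    by fastforce
qed

section \<open>Hitting sets as temporal walks\<close>

text \<open>The shift by one keeps vertex 0 free for the start.\<close>

definition positions :: "('v \<Rightarrow> bool) \<Rightarrow> 'v list \<Rightarrow> nat list" where
  "positions P vs = map fst (filter (\<lambda>z. P (snd z)) (zip (map Suc [0..<length vs]) vs))"

definition complete_edges :: "nat \<Rightarrow> nat \<Rightarrow> (nat \<times> nat \<times> nat) list" where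
  "complete_edges n L = filter (\<lambda>e. fst e \<noteq> fst (snd e))
     (List.product [0..<n] (List.product [0..<n] (map Suc [0..<L])))"

text \<open>The start vertex belongs to no target set, so all hits are paid for by moves, and there
  are at most \<open>L\<close> moves.\<close>

definition hitting_inst :: "nat \<Rightarrow> 'v list \<Rightarrow> ('v \<Rightarrow> bool) list \<Rightarrow> texp_inst" where
  "hitting_inst L vs Ps = (Suc (length vs), L, complete_edges (Suc (length vs)) L, 0, map (\<lambda>P. positions P vs) Ps)"

lemma set_positions: "set (positions P vs) = {Suc i |i. i < length vs \<and> P (vs ! i)}"
proof -
  have "zip (map Suc [0..<length vs]) vs = map (\<lambda>i. (Suc i, vs ! i)) [0..<length vs]"
    by (rule nth_equalityI) auto
  then show ?thesis by (auto simp: positions_def filter_map comp_def)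
qed

lemma set_complete_edges:
  "(u, v, t) \<in> set (complete_edges n L) \<longleftrightarrow> u < n \<and> v < n \<and> u \<noteq> v \<and> 1 \<le> t \<and> t \<le> L"
  by (auto simp: complete_edges_def image_iff)

lemma hitting_inst_valid: "texp_valid (hitting_inst L vs Ps)"
  by (auto simp: texp_valid_def hitting_inst_def set_complete_edges set_positions)

lemma sorted_wrt_bounded_length: "sorted_wrt (<) ts \<Longrightarrow> \<forall>t\<in>set ts. 1 \<le> t \<and> t \<le> (L :: nat) \<Longrightarrow> length ts \<le> L"
proof -
  assume *: "sorted_wrt (<) ts" "\<forall>t\<in>set ts. 1 \<le> t \<and> t \<le> L"
  then have "card (set ts) \<le> card {1..L}" by (intro card_mono) auto
  moreover have "distinct ts" using *(1) by (simp add: strict_sorted_iff)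
  ultimately show ?thesis by (simp add: distinct_card)
qed

text \<open>Strictly increasing times in 1..L allow at most \<open>L\<close> vertices after the
  start. Conversely, the chosen vertices are visited in any order at times 1, 2, and so on; they are
  distinct and different from the start, so each move uses an edge of a complete layer.\<close>

lemma hitting_inst_yes:
  assumes "distinct vs"
  shows "texp_yes (hitting_inst L vs Ps) \<longleftrightarrow>
    (\<exists>H. H \<subseteq> set vs \<and> card H \<le> L \<and> (\<forall>P\<in>set Ps. \<exists>v\<in>H. P v))"
proof
  assume "texp_yes (hitting_inst L vs Ps)"
  then obtain ws ts where w: "strict_walk L (complete_edges (Suc (length vs)) L) 0 ws ts"
    and hit: "\<forall>P\<in>set Ps. set ws \<inter> set (positions P vs) \<noteq> {}"
    by (auto simp: texp_yes_def hitting_inst_def)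
  define H where "H = {vs ! i |i. i < length vs \<and> Suc i \<in> set ws}"
  have w': "ws \<noteq> []" "hd ws = 0" "length ws = length ts + 1"
    using w by (simp_all add: strict_walk_def)
  have ts: "length ts \<le> L"
    using w unfolding strict_walk_def by (intro sorted_wrt_bounded_length) blast+
  have "card H \<le> card (set (tl ws))"
  proof -
    have "H \<subseteq> (\<lambda>u. vs ! (u - 1)) ` set (tl ws)"
    proof
      fix v assume "v \<in> H"
      then obtain i where i: "v = vs ! i" "Suc i \<in> set ws" by (auto simp: H_def)
      then have "Suc i \<in> set (tl ws)" using w'(1,2) by (cases ws) auto
      then show "v \<in> (\<lambda>u. vs ! (u - 1)) ` set (tl ws)" using i(1)
        by (intro image_eqI[of _ _ "Suc i"]) simp_all
    qed
    then have "card H \<le> card ((\<lambda>u. vs ! (u - 1)) ` set (tl ws))" by (intro card_mono) simp_all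
    also have "\<dots> \<le> card (set (tl ws))" by (intro card_image_le) simp
    finally show ?thesis .
  qed
  also have "\<dots> \<le> L" using card_length[of "tl ws"] w'(3) ts by simp
  finally have "card H \<le> L" .
  moreover have "\<exists>v\<in>H. P v" if "P \<in> set Ps" for P
    using bspec[OF hit that] unfolding H_def set_positions by blast
  moreover have "H \<subseteq> set vs" by (auto simp: H_def)
  ultimately show "\<exists>H. H \<subseteq> set vs \<and> card H \<le> L \<and> (\<forall>P\<in>set Ps. \<exists>v\<in>H. P v)" by blast
next
  assume "\<exists>H. H \<subseteq> set vs \<and> card H \<le> L \<and> (\<forall>P\<in>set Ps. \<exists>v\<in>H. P v)"
  then obtain H where H: "H \<subseteq> set vs" "card H \<le> L" "\<forall>P\<in>set Ps. \<exists>v\<in>H. P v" by blast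
  define us where "us = map Suc (filter (\<lambda>i. vs ! i \<in> H) [0..<length vs])"
  have us: "set us = {Suc i |i. i < length vs \<and> vs ! i \<in> H}" by (auto simp: us_def)
  have dist: "distinct us" by (auto simp: us_def distinct_map)
  have "length us = card (set us)" using dist by (simp add: distinct_card)
  also have "\<dots> = card ((\<lambda>u. vs ! (u - 1)) ` set us)"
    using assms by (intro card_image[symmetric]) (auto simp: us inj_on_def nth_eq_iff_index_eq)
  also have "\<dots> \<le> card H" using finite_subset[OF H(1)] by (intro card_mono) (auto simp: us)
  finally have len: "length us \<le> L" using H(2) by simp
  let ?ts = "[1..<Suc (length us)]"
  have "strict_walk L (complete_edges (Suc (length vs)) L) 0 (0 # us) ?ts"
    unfolding strict_walk_def
  proof (intro conjI allI impI ballI)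
    fix i assume "i < length ?ts"
    then have i: "i < length us" by (simp only: length_upt)
    have bound: "us ! j \<noteq> 0 \<and> us ! j < Suc (length vs)" if "j < length us" for j
    proof -
      have "us ! j \<in> {Suc i |i. i < length vs \<and> vs ! i \<in> H}" using nth_mem[OF that] unfolding us .
      then show ?thesis by auto
    qed
    have b: "(0 # us) ! i < Suc (length vs) \<and> (0 # us) ! i \<noteq> us ! i"
    proof (cases i)
      case 0
      then show ?thesis using bound[OF i] by simp
    next
      case (Suc j)
      then have "us ! j \<noteq> us ! i" using i nth_eq_iff_index_eq[OF dist, of j i] by simp
      moreover have "(0 # us) ! i = us ! j" using Suc by simp
      ultimately show ?thesis using Suc bound[of j] i by linarith
    qed
    have "((0 # us) ! i, (0 # us) ! Suc i, ?ts ! i) \<in> set (complete_edges (Suc (length vs)) L)"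
    proof -
      have "?ts ! i = Suc i" using i by (simp only: nth_upt)
      then show ?thesis using b bound[OF i] i len unfolding set_complete_edges nth_Cons_Suc by linarith
    qed
    then show "((0 # us) ! i, (0 # us) ! Suc i, ?ts ! i) \<in> set (complete_edges (Suc (length vs)) L) \<or>
       ((0 # us) ! Suc i, (0 # us) ! i, ?ts ! i) \<in> set (complete_edges (Suc (length vs)) L)" ..
  next
    fix t assume "t \<in> set ?ts"
    then show "1 \<le> t" "t \<le> L" using len by auto
  qed (simp_all del: upt_Suc)
  moreover have "set (0 # us) \<inter> set (positions P vs) \<noteq> {}" if P: "P \<in> set Ps" for P
  proof -
    obtain v where v: "v \<in> H" "P v" using bspec[OF H(3) P] by blast
    then have "v \<in> set vs" using H(1) by blast
    then obtain i where "i < length vs" "v = vs ! i" by (auto simp: in_set_conv_nth)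
    then have "Suc i \<in> set us" "Suc i \<in> set (positions P vs)" using v unfolding us set_positions by blast+
    then show ?thesis unfolding list.set by blast
  qed
  ultimately have "\<exists>ws ts. strict_walk L (complete_edges (Suc (length vs)) L) 0 ws ts \<and>
      (\<forall>X\<in>set (map (\<lambda>P. positions P vs) Ps). set ws \<inter> set X \<noteq> {})"
    by (rule_tac exI[of _ "0 # us"], rule_tac exI[of _ ?ts]) (simp_all del: upt_Suc)
  then show "texp_yes (hitting_inst L vs Ps)"
    unfolding texp_yes_def hitting_inst_def prod.case .
qed

section \<open>Assignments to cells\<close>

text \<open>A vertex is a list of pairs (cell, value), and its layer is the list of its cells. Hitting one
  vertex in each layer, consistently, amounts to choosing a value for every cell, and a vertex
  of the hitting set sees the values of the cells in its layer.\<close>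

type_synonym vertex = "(nat \<times> nat) list"

text \<open>Repetitions are allowed, so smaller sets of cells are represented by padded
  tuples.\<close>

definition layers :: "nat \<Rightarrow> nat \<Rightarrow> nat list list" where
  "layers q m = List.n_lists q [0..<m]"

definition vertices :: "nat \<Rightarrow> nat \<Rightarrow> nat \<Rightarrow> vertex list" where
  "vertices q m N = List.n_lists q (List.product [0..<m] [0..<N])"

text \<open>If \<^term>\<open>v\<close> is the vertex hit in layer \<^term>\<open>T\<close>, then the following set, which contains no vertex
  of \<^term>\<open>T\<close> with (c, w), forces the vertex hit in \<^term>\<open>T'\<close> to agree with (c, w) if \<^term>\<open>v\<close> contains it.\<close>

definition consistent :: "nat list \<Rightarrow> nat list \<Rightarrow> nat \<Rightarrow> nat \<Rightarrow> vertex \<Rightarrow> bool" where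
  "consistent T T' c w v \<longleftrightarrow> map fst v = T \<and> (c, w) \<notin> set v \<or>
     map fst v = T' \<and> ((c, w) \<in> set v \<or> c \<notin> set T')"

text \<open>The local condition \<open>V\<close> is built into the layer sets: only a vertex
  satisfying it can be the hit of its layer.\<close>

definition constraints :: "nat \<Rightarrow> nat \<Rightarrow> nat \<Rightarrow> (vertex \<Rightarrow> bool) \<Rightarrow> (vertex \<Rightarrow> bool) list \<Rightarrow> (vertex \<Rightarrow> bool) list" where
  "constraints q m N V Qs = map (\<lambda>T v. map fst v = T \<and> V v) (layers q m) @
     map (\<lambda>z. consistent (fst (fst z)) (snd (fst z)) (fst (snd z)) (snd (snd z)))
       (List.product (List.product (layers q m) (layers q m)) (List.product [0..<m] [0..<N])) @ Qs"

definition row :: "(nat \<Rightarrow> nat) \<Rightarrow> nat list \<Rightarrow> vertex" where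
  "row \<beta> T = map (\<lambda>c. (c, \<beta> c)) T"

lemma fst_row [simp]: "map fst (row \<beta> T) = T"
  by (simp add: row_def comp_def)

lemma set_row [simp]: "set (row \<beta> T) = (\<lambda>c. (c, \<beta> c)) ` set T"
  by (simp add: row_def)

lemma set_layers: "T \<in> set (layers q m) \<longleftrightarrow> length T = q \<and> set T \<subseteq> {..<m}"
  by (auto simp: layers_def set_n_lists atLeast0LessThan)

lemma set_vertices: "v \<in> set (vertices q m N) \<longleftrightarrow> length v = q \<and> set v \<subseteq> {..<m} \<times> {..<N}"
  by (auto simp: vertices_def set_n_lists atLeast0LessThan)

lemma distinct_layers: "distinct (layers q m)"
  by (simp add: layers_def distinct_n_lists)

lemma distinct_vertices: "distinct (vertices q m N)"
  by (simp add: vertices_def distinct_n_lists distinct_product)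

lemma length_layers: "length (layers q m) = m ^ q"
  by (simp add: layers_def length_n_lists)

lemma set_constraints:
  "set (constraints q m N V Qs) = (\<lambda>T v. map fst v = T \<and> V v) ` set (layers q m) \<union>
    {consistent T T' c w |T T' c w. T \<in> set (layers q m) \<and> T' \<in> set (layers q m) \<and> c < m \<and> w < N} \<union> set Qs"
proof -
  have "set (map (\<lambda>z. consistent (fst (fst z)) (snd (fst z)) (fst (snd z)) (snd (snd z)))
       (List.product (List.product (layers q m) (layers q m)) (List.product [0..<m] [0..<N]))) =
    {consistent T T' c w |T T' c w. T \<in> set (layers q m) \<and> T' \<in> set (layers q m) \<and> c < m \<and> w < N}"
    (is "set (map ?f _) = ?S")
  proof (intro equalityI subsetI)
    fix P assume "P \<in> set (map ?f (List.product (List.product (layers q m) (layers q m)) (List.product [0..<m] [0..<N])))"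
    then obtain T T' c w where "P = ?f ((T, T'), c, w)" "T \<in> set (layers q m)" "T' \<in> set (layers q m)" "c < m" "w < N"
      by auto
    then show "P \<in> ?S" by auto
  next
    fix P assume "P \<in> ?S"
    then obtain T T' c w where "P = ?f ((T, T'), c, w)" "T \<in> set (layers q m)" "T' \<in> set (layers q m)" "c < m" "w < N"
      by auto
    then show "P \<in> set (map ?f (List.product (List.product (layers q m) (layers q m)) (List.product [0..<m] [0..<N])))"
      unfolding set_map by (intro image_eqI[of P ?f "((T, T'), c, w)"]) auto
  qed
  then show ?thesis unfolding constraints_def set_append by (simp only: set_map Un_assoc)
qed

text \<open>The layer sets are disjoint and as many as the budget, so each layer contains exactly
  one chosen vertex. The value of cell c is read off the constant tuple of c, which is nonempty by 0
  < q and carries a single value by the assumption on \<open>V\<close>. The consistency sets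
  transport this value to every other tuple containing c.\<close>

lemma hitting_cells:
  assumes q: "0 < q" and V: "\<And>v c w w'. V v \<Longrightarrow> (c, w) \<in> set v \<Longrightarrow> (c, w') \<in> set v \<Longrightarrow> w = w'"
  shows "(\<exists>H. H \<subseteq> set (vertices q m N) \<and> card H \<le> length (layers q m) \<and>
      (\<forall>P\<in>set (constraints q m N V Qs). \<exists>v\<in>H. P v)) \<longleftrightarrow>
    (\<exists>\<beta>. (\<forall>c<m. \<beta> c < N) \<and> (\<forall>T\<in>set (layers q m). V (row \<beta> T)) \<and>
      (\<forall>Q\<in>set Qs. \<exists>T\<in>set (layers q m). Q (row \<beta> T)))"
proof
  assume "\<exists>H. H \<subseteq> set (vertices q m N) \<and> card H \<le> length (layers q m) \<and>
      (\<forall>P\<in>set (constraints q m N V Qs). \<exists>v\<in>H. P v)"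
  then obtain H where H: "H \<subseteq> set (vertices q m N)" "card H \<le> length (layers q m)"
    and hit: "\<forall>P\<in>set (constraints q m N V Qs). \<exists>v\<in>H. P v" by blast
  have "finite H" using H(1) finite_subset by blast
  have ex: "\<exists>v\<in>H. map fst v = T \<and> V v" if "T \<in> set (layers q m)" for T
  proof -
    have "(\<lambda>v. map fst v = T \<and> V v) \<in> set (constraints q m N V Qs)"
      using that unfolding set_constraints by blast
    from bspec[OF hit this] show ?thesis .
  qed
  have img: "map fst ` H = set (layers q m)"
  proof
    show "map fst ` H \<subseteq> set (layers q m)"
    proof (rule image_subsetI)
      fix v assume "v \<in> H"
      then have "length v = q" "set v \<subseteq> {..<m} \<times> {..<N}" using H(1) set_vertices by blast+
      then show "map fst v \<in> set (layers q m)" by (auto simp: set_layers)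
    qed
    show "set (layers q m) \<subseteq> map fst ` H" using ex by blast
  qed
  \<comment> \<open>The budget is tight: there are as many layers as vertices are allowed, so no
    layer contains two chosen vertices.\<close>
  have "card (map fst ` H) = card H"
    using H(2) card_image_le[OF \<open>finite H\<close>, of "map fst"] img distinct_card[OF distinct_layers, of q m] by simp
  then have inj: "inj_on (map fst) H" using \<open>finite H\<close> by (simp add: inj_on_iff_eq_card)
  define sel where "sel T = (SOME v. v \<in> H \<and> map fst v = T \<and> V v)" for T
  have sel: "sel T \<in> H \<and> map fst (sel T) = T \<and> V (sel T)" if "T \<in> set (layers q m)" for T
    unfolding sel_def by (rule someI_ex) (use ex[OF that] in blast)
  have uniq: "v = sel (map fst v)" if "v \<in> H" for v
  proof -
    have "map fst v \<in> set (layers q m)" using that img by blast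
    from sel[OF this] show ?thesis by (intro inj_onD[OF inj _ that]) auto
  qed
  have cons: "(c, w) \<in> set (sel T')"
    if T: "T \<in> set (layers q m)" "T' \<in> set (layers q m)" and cw: "(c, w) \<in> set (sel T)" "c \<in> set T'" for T T' c w
  proof -
    have "sel T \<in> set (vertices q m N)" using sel[OF T(1)] H(1) by blast
    then have "c < m" "w < N" using cw(1) by (auto simp: set_vertices)
    then have "consistent T T' c w \<in> set (constraints q m N V Qs)"
      using T unfolding set_constraints by blast
    from bspec[OF hit this] obtain v where v: "v \<in> H" "consistent T T' c w v" by blast
    then show ?thesis using uniq[OF v(1)] cw by (auto simp: consistent_def)
  qed
  let ?T = "\<lambda>c. replicate q c"
  have T: "?T c \<in> set (layers q m)" if "c < m" for c using that by (auto simp: set_layers)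
  define \<beta> where "\<beta> c = (SOME w. (c, w) \<in> set (sel (?T c)))" for c
  have \<beta>: "(c, \<beta> c) \<in> set (sel (?T c))" if "c < m" for c
  proof -
    have "c \<in> fst ` set (sel (?T c))" using sel[OF T[OF that]] q by (metis image_set in_set_replicate neq0_conv)
    then have "\<exists>w. (c, w) \<in> set (sel (?T c))" by auto
    then show ?thesis unfolding \<beta>_def by (rule someI_ex)
  qed
  have row: "sel T' = row \<beta> T'" if T': "T' \<in> set (layers q m)" for T'
  proof -
    have "w = \<beta> c" if "(c, w) \<in> set (sel T')" for c w
    proof -
      have c: "c \<in> set T'" using sel[OF T'] that by (metis fst_conv image_eqI image_set)
      then have "c < m" using T' by (auto simp: set_layers)
      then have "(c, w) \<in> set (sel (?T c))" using cons[OF T' T that] q by simp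
      then show ?thesis using V \<beta>[OF \<open>c < m\<close>] sel[OF T[OF \<open>c < m\<close>]] by blast
    qed
    then have "map (\<lambda>p. (fst p, \<beta> (fst p))) (sel T') = sel T'" by (intro map_idI) auto
    then have "map (\<lambda>c. (c, \<beta> c)) (map fst (sel T')) = sel T'" by (simp add: comp_def)
    then show ?thesis using sel[OF T'] by (simp add: row_def)
  qed
  have "\<beta> c < N" if "c < m" for c
    using \<beta>[OF that] sel[OF T[OF that]] H(1) by (fastforce simp: set_vertices)
  moreover have "V (row \<beta> T')" if "T' \<in> set (layers q m)" for T'
    using sel[OF that] row[OF that] by simp
  moreover have "\<exists>T'\<in>set (layers q m). Q (row \<beta> T')" if Q: "Q \<in> set Qs" for Q
  proof -
    obtain v where v: "v \<in> H" "Q v" using bspec[OF hit] Q unfolding set_constraints by blast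
    have l: "map fst v \<in> set (layers q m)" using v(1) img by blast
    then show ?thesis using uniq[OF v(1)] v(2) row[OF l] by metis
  qed
  ultimately show "\<exists>\<beta>. (\<forall>c<m. \<beta> c < N) \<and> (\<forall>T\<in>set (layers q m). V (row \<beta> T)) \<and>
      (\<forall>Q\<in>set Qs. \<exists>T\<in>set (layers q m). Q (row \<beta> T))" by blast
next
  assume "\<exists>\<beta>. (\<forall>c<m. \<beta> c < N) \<and> (\<forall>T\<in>set (layers q m). V (row \<beta> T)) \<and>
      (\<forall>Q\<in>set Qs. \<exists>T\<in>set (layers q m). Q (row \<beta> T))"
  then obtain \<beta> where \<beta>: "\<forall>c<m. \<beta> c < N" "\<forall>T\<in>set (layers q m). V (row \<beta> T)"
    "\<forall>Q\<in>set Qs. \<exists>T\<in>set (layers q m). Q (row \<beta> T)" by blast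
  let ?H = "row \<beta> ` set (layers q m)"
  have 1: "?H \<subseteq> set (vertices q m N)" 
  proof (intro image_subsetI)
    fix T assume "T \<in> set (layers q m)"
    then have "length T = q" "\<And>c. c \<in> set T \<Longrightarrow> c < m" by (auto simp: set_layers)
    then show "row \<beta> T \<in> set (vertices q m N)" using \<beta>(1) by (auto simp: set_vertices row_def)
  qed
  have 2: "card ?H \<le> length (layers q m)"
    using card_image_le[of "set (layers q m)" "row \<beta>"] card_length[of "layers q m"] by simp
  have 3: "\<exists>v\<in>?H. P v" if P: "P \<in> set (constraints q m N V Qs)" for P
  proof -
    consider T where "T \<in> set (layers q m)" "P = (\<lambda>v. map fst v = T \<and> V v)"
      | T T' c w where "T \<in> set (layers q m)" "T' \<in> set (layers q m)" "P = consistent T T' c w"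
      | "P \<in> set Qs"
      using P unfolding set_constraints by blast
    then show ?thesis
    proof cases
      case 2
      \<comment> \<open>If \<beta> c = w, the row of T' hits the set; otherwise the row of T
        does.\<close>
      have "P (row \<beta> T) \<or> P (row \<beta> T')" using 2(3) by (auto simp: consistent_def)
      then show ?thesis using 2 by blast
    next
      case 1
      then show ?thesis using bspec[OF \<beta>(2) 1(1)] by auto
    next
      case 3
      then show ?thesis using bspec[OF \<beta>(3) 3] by blast
    qed
  qed
  show "\<exists>H. H \<subseteq> set (vertices q m N) \<and> card H \<le> length (layers q m) \<and>
      (\<forall>P\<in>set (constraints q m N V Qs). \<exists>v\<in>H. P v)"
    by (intro exI[of _ ?H] conjI ballI 1 2 3)
qed

text \<open>Cells 1 to k hold the one-based positions of the true variables in increasing order, cells 0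
  and k + 1 hold the end markers 0 and n + 1, and cell k + 2 holds the chosen disjunct of the
  normal form. A positive literal is certified by one cell, and a negative literal by two
  consecutive cells whose values enclose its position.\<close>

definition segment :: "nat \<Rightarrow> nat \<Rightarrow> 'a list \<Rightarrow> 'a list" where
  "segment a b xs = take (b - a) (drop a xs)"

text \<open>All conditions concern at most two cells of one vertex. The clause for equal cells makes
  the vertex a partial function, as \<open>hitting_cells\<close> requires of its
  \<open>V\<close>.\<close>

definition valid :: "nat \<Rightarrow> nat \<Rightarrow> nat \<Rightarrow> vertex \<Rightarrow> bool" where
  "valid k n e v \<longleftrightarrow> (\<forall>p\<in>set v. (fst p = 0 \<longrightarrow> snd p = 0) \<and> (fst p = k + 1 \<longrightarrow> snd p = n + 1) \<and>
     (fst p = k + 2 \<longrightarrow> snd p < e) \<and>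
     (\<forall>p'\<in>set v. (fst p = fst p' \<longrightarrow> snd p = snd p') \<and>
        (fst p' = Suc (fst p) \<and> fst p \<le> k \<longrightarrow> snd p < snd p')))"

text \<open>Values are one-based positions while lists are indexed from 0. The segment from p - 1 to
  p is thus the single variable named by a cell, and the one from p to p' - 1 consists of the
  variables strictly between two consecutive cells.\<close>

definition known :: "bool list list \<Rightarrow> nat \<Rightarrow> vertex \<Rightarrow> fm \<Rightarrow> bool" where
  "known ids k v l = (case l of Gate b fs \<Rightarrow> False | Lit s x \<Rightarrow>
     if s then \<exists>p\<in>set v. 1 \<le> fst p \<and> fst p \<le> k \<and> x \<in> set (segment (snd p - 1) (snd p) ids)
     else \<exists>p\<in>set v. \<exists>p'\<in>set v. fst p' = Suc (fst p) \<and> fst p \<le> k \<and> x \<in> set (segment (snd p) (snd p' - 1) ids))"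

text \<open>Disjuncts may have different numbers of clauses. An index j beyond the clauses of the
  chosen disjunct is accepted outright, so the same family of sets serves all disjuncts.\<close>

definition accept :: "fm list list list list \<Rightarrow> bool list list \<Rightarrow> nat \<Rightarrow> nat \<Rightarrow> vertex \<Rightarrow> bool" where
  "accept NF ids k j v \<longleftrightarrow> (\<exists>p\<in>set v. fst p = k + 2 \<and>
     (case drop (snd p) NF of [] \<Rightarrow> False | E # _ \<Rightarrow>
       (case drop j E of [] \<Rightarrow> True | ts # _ \<Rightarrow> \<exists>t\<in>set ts. \<forall>l\<in>set t. known ids k v l)))"

lemma set_segment: "x \<in> set (segment a b xs) \<longleftrightarrow> (\<exists>i. a \<le> i \<and> i < b \<and> i < length xs \<and> xs ! i = x)"
proof
  assume "x \<in> set (segment a b xs)"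
  then obtain j where "j < b - a" "a + j < length xs" "xs ! (a + j) = x"
    by (auto simp: segment_def in_set_conv_nth)
  then show "\<exists>i. a \<le> i \<and> i < b \<and> i < length xs \<and> xs ! i = x" by (intro exI[of _ "a + j"]) auto
next
  assume "\<exists>i. a \<le> i \<and> i < b \<and> i < length xs \<and> xs ! i = x"
  then obtain i where "a \<le> i" "i < b" "i < length xs" "xs ! i = x" by blast
  then show "x \<in> set (segment a b xs)"
    by (auto simp: segment_def in_set_conv_nth intro!: exI[of _ "i - a"])
qed

lemma known_mono: "known ids k v l \<Longrightarrow> set v \<subseteq> set v' \<Longrightarrow> known ids k v' l"
  by (cases l) (auto simp: known_def split: if_splits; blast)+

text \<open>With q at least 2, any two cells occur together in some layer, so the local conditions
  on all rows amount to global monotonicity of the cell values.\<close>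

lemma valid_rows:
  assumes "2 \<le> q"
  shows "(\<forall>T\<in>set (layers q (k + 3)). valid k n e (row \<beta> T)) \<longleftrightarrow>
    \<beta> 0 = 0 \<and> \<beta> (k + 1) = n + 1 \<and> \<beta> (k + 2) < e \<and> (\<forall>c\<le>k. \<beta> c < \<beta> (Suc c))"
proof
  assume *: "\<forall>T\<in>set (layers q (k + 3)). valid k n e (row \<beta> T)"
  have pair: "valid k n e (row \<beta> (c # replicate (q - 1) c'))" if "c < k + 3" "c' < k + 3" for c c'
    using * assms that by (auto simp: set_layers)
  have s: "set (row \<beta> (c # replicate (q - 1) c')) = {(c, \<beta> c), (c', \<beta> c')}" for c c'
    using assms by auto
  have "\<beta> 0 = 0" using pair[of 0 0] unfolding valid_def s by simp
  moreover have "\<beta> (k + 1) = n + 1" using pair[of "k + 1" "k + 1"] unfolding valid_def s by simp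
  moreover have "\<beta> (k + 2) < e" using pair[of "k + 2" "k + 2"] unfolding valid_def s by simp
  moreover have "\<beta> c < \<beta> (Suc c)" if "c \<le> k" for c
    using pair[of c "Suc c"] that unfolding valid_def s by simp
  ultimately show "\<beta> 0 = 0 \<and> \<beta> (k + 1) = n + 1 \<and> \<beta> (k + 2) < e \<and> (\<forall>c\<le>k. \<beta> c < \<beta> (Suc c))" by blast
next
  assume "\<beta> 0 = 0 \<and> \<beta> (k + 1) = n + 1 \<and> \<beta> (k + 2) < e \<and> (\<forall>c\<le>k. \<beta> c < \<beta> (Suc c))"
  then show "\<forall>T\<in>set (layers q (k + 3)). valid k n e (row \<beta> T)"
    by (auto simp: valid_def)
qed

text \<open>Strict increase between the end markers 0 and n + 1 forces k distinct positions within
  1..n. No cell value lies strictly between those of two consecutive cells, so an enclosed variable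
  is false.\<close>

lemma cells_sound:
  assumes dist: "distinct ids" and \<beta>: "\<beta> 0 = 0" "\<beta> (k + 1) = length ids + 1" "\<And>c. c \<le> k \<Longrightarrow> \<beta> c < \<beta> (Suc c)"
    and A: "A = (\<lambda>c. ids ! (\<beta> c - 1)) ` {1..k}"
  shows "A \<subseteq> set ids" "card A = k" "known ids k (row \<beta> T) l \<Longrightarrow> ev A l"
proof -
  have mono: "\<beta> c < \<beta> c'" if "c < c'" "c' \<le> k + 1" for c c'
    using that
  proof (induction c')
    case (Suc c')
    then show ?case using \<beta>(3)[of c'] by (cases "c = c'") auto
  qed simp
  have range: "1 \<le> \<beta> c" "\<beta> c \<le> length ids" if "c \<in> {1..k}" for c
    using mono[of 0 c] mono[of c "k + 1"] \<beta>(1,2) that by auto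
  have nth: "ids ! (\<beta> c - 1) = ids ! i \<longleftrightarrow> \<beta> c = Suc i" if "c \<in> {1..k}" "i < length ids" for c i
    using range[OF that(1)] that(2) nth_eq_iff_index_eq[OF dist, of "\<beta> c - 1" i] by auto
  show "A \<subseteq> set ids" using range by (fastforce simp: A)
  have "inj_on (\<lambda>c. ids ! (\<beta> c - 1)) {1..k}"
  proof (rule inj_onI)
    fix c c' assume c: "c \<in> {1..k}" "c' \<in> {1..k}" "ids ! (\<beta> c - 1) = ids ! (\<beta> c' - 1)"
    then have "\<beta> c = \<beta> c'" using nth[OF c(1), of "\<beta> c' - 1"] range[OF c(2)] by auto
    then show "c = c'" using mono[of c c'] mono[of c' c] c(1,2) by (cases c c' rule: linorder_cases) auto
  qed
  then show "card A = k" by (simp add: A card_image)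
  assume kn: "known ids k (row \<beta> T) l"
  then obtain s x where l: "l = Lit s x" by (cases l) (auto simp: known_def)
  show "ev A l"
  proof (cases s)
    case True
    then obtain c where c: "1 \<le> c" "c \<le> k" "x \<in> set (segment (\<beta> c - 1) (\<beta> c) ids)"
      using kn by (auto simp: known_def l)
    then have "x = ids ! (\<beta> c - 1)" by (auto simp: set_segment) (metis One_nat_def Suc_diff_1 le_antisym less_Suc_eq_le neq0_conv not_less0)
    then show ?thesis using c(1,2) True by (auto simp: l A)
  next
    case False
    then obtain c where c: "c \<le> k" "x \<in> set (segment (\<beta> c) (\<beta> (Suc c) - 1) ids)"
      using kn by (auto simp: known_def l)
    then obtain i where i: "\<beta> c \<le> i" "Suc i < \<beta> (Suc c)" "i < length ids" "x = ids ! i"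
      by (auto simp: set_segment)
    have "x \<notin> A"
    proof
      assume "x \<in> A"
      then obtain c' where c': "c' \<in> {1..k}" "ids ! (\<beta> c' - 1) = ids ! i" using i(4) by (auto simp: A)
      then have "\<beta> c' = Suc i" using nth i(3) by blast
      then have "\<beta> c < \<beta> c'" "\<beta> c' < \<beta> (Suc c)" using i by auto
      then show False using mono[of c' c] mono[of "Suc c" c'] c' c(1)
        by (metis Suc_leI atLeastAtMost_iff le_Suc_eq less_irrefl less_trans linorder_neqE_nat Suc_eq_plus1 le_SucI not_less_eq)
    qed
    then show ?thesis using False by (simp add: l)
  qed
qed

lemma cells_complete:
  assumes dist: "distinct ids" and A: "A \<subseteq> set ids" "card A = k"
  shows "\<exists>\<beta>. \<beta> 0 = 0 \<and> \<beta> (k + 1) = length ids + 1 \<and> \<beta> (k + 2) = e \<and> (\<forall>c\<le>k. \<beta> c < \<beta> (Suc c)) \<and>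
    (\<forall>c\<le>k + 1. \<beta> c \<le> length ids + 1) \<and>
    (\<forall>s x. x \<in> set ids \<longrightarrow> ev A (Lit s x) \<longrightarrow> (\<exists>a b. a < k + 3 \<and> b < k + 3 \<and> known ids k (row \<beta> [a, b]) (Lit s x)))"
proof -
  let ?n = "length ids"
  define I where "I = {i. i < ?n \<and> ids ! i \<in> A}"
  have "bij_betw ((!) ids) I A"
    using A(1) dist by (auto simp: bij_betw_def inj_on_def I_def nth_eq_iff_index_eq in_set_conv_nth image_iff subset_iff; metis)
  then have "card I = k" using A(2) bij_betw_same_card by blast
  define js where "js = sorted_list_of_set I"
  have fin: "finite I" by (simp add: I_def)
  have js: "length js = k" "sorted_wrt (<) js" "set js = I"
    using \<open>card I = k\<close> fin by (simp_all add: js_def)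
  define \<beta> where "\<beta> c = (if c = 0 then 0 else if c \<le> k then Suc (js ! (c - 1)) else if c = k + 1 then ?n + 1 else e)" for c
  have jn: "js ! c < ?n" if "c < k" for c using js that nth_mem[of c js] by (auto simp: I_def)
  have step: "\<beta> c < \<beta> (Suc c)" if "c \<le> k" for c
  proof (cases "c = k")
    case True
    then show ?thesis using jn[of "k - 1"] by (auto simp: \<beta>_def)
  next
    case False
    then show ?thesis using that sorted_wrt_nth_less[OF js(2), of "c - 1" c] js(1) by (auto simp: \<beta>_def)
  qed
  have bound: "\<beta> c \<le> ?n + 1" if "c \<le> k + 1" for c
  proof (cases "1 \<le> c \<and> c \<le> k")
    case True
    then obtain c' where "c = Suc c'" "c' < k" by (cases c) auto
    then show ?thesis using jn[of c'] by (auto simp: \<beta>_def)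
  qed (use that in \<open>auto simp: \<beta>_def\<close>)
  have lit: "\<exists>a b. a < k + 3 \<and> b < k + 3 \<and> known ids k (row \<beta> [a, b]) (Lit s x)"
    if x: "x \<in> set ids" and e: "ev A (Lit s x)" for s x
  proof -
    obtain i where i: "i < ?n" "ids ! i = x" using x by (auto simp: in_set_conv_nth)
    show ?thesis
    proof (cases s)
      case True
      then have "i \<in> set js" using e i js(3) by (simp add: I_def)
      then obtain c where c: "c < k" "js ! c = i" using js(1) by (auto simp: in_set_conv_nth)
      then have "\<beta> (Suc c) = Suc i" by (simp add: \<beta>_def)
      then have "x \<in> set (segment (\<beta> (Suc c) - 1) (\<beta> (Suc c)) ids)" using i by (auto simp: set_segment)
      then show ?thesis using True c(1) by (intro exI[of _ "Suc c"]) (auto simp: known_def)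
    next
      case False
      then have "i \<notin> I" using e i by (simp add: I_def)
      have "Suc i \<le> \<beta> (k + 1)" using i by (simp add: \<beta>_def)
      \<comment> \<open>The first cell whose value reaches the position of the false variable;
        together with its predecessor it encloses that position.\<close>
      then obtain m where m: "m \<le> k + 1" "\<forall>c<m. \<not> Suc i \<le> \<beta> c" "Suc i \<le> \<beta> m"
        using ex_least_nat_le[of "\<lambda>c. Suc i \<le> \<beta> c" "k + 1"] by blast
      then obtain c where c: "m = Suc c" by (cases m) (auto simp: \<beta>_def)
      have ne: "Suc i \<noteq> \<beta> (Suc c)"
      proof (cases "Suc c \<le> k")
        case True
        then have "js ! c \<in> I" using js by (metis Suc_le_lessD nth_mem)
        then show ?thesis using True \<open>i \<notin> I\<close> by (auto simp: \<beta>_def)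
      qed (use m c i in \<open>auto simp: \<beta>_def\<close>)
      have "\<beta> c \<le> i" "Suc i < \<beta> (Suc c)" "c \<le> k" using m c ne by auto
      then have "x \<in> set (segment (\<beta> c) (\<beta> (Suc c) - 1) ids)" using i by (auto simp: set_segment)
      then show ?thesis using False \<open>c \<le> k\<close> by (intro exI[of _ c] exI[of _ "Suc c"]) (auto simp: known_def)
    qed
  qed
  have "\<beta> 0 = 0" "\<beta> (k + 1) = ?n + 1" "\<beta> (k + 2) = e" by (simp_all add: \<beta>_def)
  then show ?thesis using step bound lit by (intro exI[of _ \<beta>]) blast
qed

text \<open>\<open>N\<close> must exceed the end marker, which is one more than the number of
  variables, and all indices of disjuncts. \<open>J\<close> bounds the number of clauses in every
  disjunct, so each clause of the chosen one is tested by some set.\<close>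

lemma cells_nf:
  assumes dist: "distinct ids" and q: "2 \<le> q"
    and NF: "\<And>E ts t. E \<in> set NF \<Longrightarrow> ts \<in> set E \<Longrightarrow> t \<in> set ts \<Longrightarrow>
      2 * length t < q \<and> (\<forall>l\<in>set t. \<exists>s x. l = Lit s x \<and> x \<in> set ids)"
    and N: "length ids + 2 \<le> N" "length NF \<le> N" and J: "\<And>E. E \<in> set NF \<Longrightarrow> length E \<le> J"
  shows "(\<exists>\<beta>. (\<forall>c<k + 3. \<beta> c < N) \<and> (\<forall>T\<in>set (layers q (k + 3)). valid k (length ids) (length NF) (row \<beta> T)) \<and>
      (\<forall>Q\<in>set (map (accept NF ids k) [0..<J]). \<exists>T\<in>set (layers q (k + 3)). Q (row \<beta> T))) \<longleftrightarrow>
    (\<exists>A \<subseteq> set ids. card A = k \<and> (\<exists>E\<in>set NF. \<forall>ts\<in>set E. \<exists>t\<in>set ts. \<forall>l\<in>set t. ev A l))"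
  (is "?L \<longleftrightarrow> ?R")
proof
  assume ?L
  then obtain \<beta> where \<beta>: "\<beta> 0 = 0" "\<beta> (k + 1) = length ids + 1" "\<beta> (k + 2) < length NF" "\<And>c. c \<le> k \<Longrightarrow> \<beta> c < \<beta> (Suc c)"
    and acc: "\<forall>j<J. \<exists>T\<in>set (layers q (k + 3)). accept NF ids k j (row \<beta> T)"
    unfolding valid_rows[OF q] by auto
  define A where "A = (\<lambda>c. ids ! (\<beta> c - 1)) ` {1..k}"
  note sound = cells_sound[OF dist \<beta>(1,2,4) A_def]
  define E where "E = NF ! \<beta> (k + 2)"
  have E: "E \<in> set NF" using \<beta>(3) by (simp add: E_def)
  have "\<exists>t\<in>set ts. \<forall>l\<in>set t. ev A l" if ts: "ts \<in> set E" for ts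
  proof -
    obtain j where j: "j < length E" "ts = E ! j" using ts by (auto simp: in_set_conv_nth)
    then have "j < J" using J[OF E] by simp
    then obtain T where T: "accept NF ids k j (row \<beta> T)" using acc by blast
    have "drop (\<beta> (k + 2)) NF = E # drop (Suc (\<beta> (k + 2))) NF" "drop j E = ts # drop (Suc j) E"
      using \<beta>(3) j by (simp_all add: E_def Cons_nth_drop_Suc)
    then obtain t where "t \<in> set ts" "\<forall>l\<in>set t. known ids k (row \<beta> T) l"
      using T by (auto simp: accept_def)
    then show ?thesis using sound(3) by blast
  qed
  then show ?R using sound(1,2) E by blast
next
  assume ?R
  then obtain A E where A: "A \<subseteq> set ids" "card A = k" and E: "E \<in> set NF" "\<forall>ts\<in>set E. \<exists>t\<in>set ts. \<forall>l\<in>set t. ev A l"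
    by blast
  obtain e where e: "e < length NF" "NF ! e = E" using E(1) by (auto simp: in_set_conv_nth)
  obtain \<beta> where \<beta>: "\<beta> 0 = 0" "\<beta> (k + 1) = length ids + 1" "\<beta> (k + 2) = e" "\<forall>c\<le>k. \<beta> c < \<beta> (Suc c)"
    "\<forall>c\<le>k + 1. \<beta> c \<le> length ids + 1"
    and lit: "\<And>s x. x \<in> set ids \<Longrightarrow> ev A (Lit s x) \<Longrightarrow> \<exists>a b. a < k + 3 \<and> b < k + 3 \<and> known ids k (row \<beta> [a, b]) (Lit s x)"
    using cells_complete[OF dist A, of e] by blast
  have "\<forall>T\<in>set (layers q (k + 3)). valid k (length ids) (length NF) (row \<beta> T)"
    unfolding valid_rows[OF q] using \<beta> e(1) by simp
  moreover have "\<beta> c < N" if "c < k + 3" for c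
  proof (cases "c \<le> k + 1")
    case True
    then show ?thesis using \<beta>(5) N(1) by fastforce
  next
    case False
    then have "c = k + 2" using that by simp
    then show ?thesis using \<beta>(3) e(1) N(2) by simp
  qed
  moreover have "\<exists>T\<in>set (layers q (k + 3)). accept NF ids k j (row \<beta> T)" for j
  proof -
    have dN: "drop e NF = E # drop (Suc e) NF" using e by (metis Cons_nth_drop_Suc)
    show ?thesis
    proof (cases "j < length E")
      case False
      then have "accept NF ids k j (row \<beta> (replicate q (k + 2)))"
        using q dN \<beta>(3) by (auto simp: accept_def)
      then show ?thesis by (intro bexI[of _ "replicate q (k + 2)"]) (auto simp: set_layers)
    next
      case True
      define ts where "ts = E ! j"
      have ts: "ts \<in> set E" and dE: "drop j E = ts # drop (Suc j) E"
        using True by (simp_all add: ts_def Cons_nth_drop_Suc)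
      obtain t where t: "t \<in> set ts" "\<forall>l\<in>set t. ev A l" using E(2) ts by blast
      have "\<forall>l\<in>set t. \<exists>ab. fst ab < k + 3 \<and> snd ab < k + 3 \<and> known ids k (row \<beta> [fst ab, snd ab]) l"
      proof
        fix l assume l: "l \<in> set t"
        then obtain s x where "l = Lit s x" "x \<in> set ids" using NF[OF E(1) ts t(1)] by blast
        then obtain a b where "a < k + 3" "b < k + 3" "known ids k (row \<beta> [a, b]) l" using lit t(2) l by blast
        then show "\<exists>ab. fst ab < k + 3 \<and> snd ab < k + 3 \<and> known ids k (row \<beta> [fst ab, snd ab]) l"
          by (intro exI[of _ "(a, b)"]) simp
      qed
      then obtain g where g: "\<forall>l\<in>set t. fst (g l) < k + 3 \<and> snd (g l) < k + 3 \<and> known ids k (row \<beta> [fst (g l), snd (g l)]) l"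
        by metis
      \<comment> \<open>Two certifying cells for each literal of the satisfied term. The padding
        consists of the cell that names the disjunct, and 2 * length t < q guarantees that it
        occurs.\<close>
      define T where "T = concat (map (\<lambda>l. [fst (g l), snd (g l)]) t) @ replicate (q - 2 * length t) (k + 2)"
      have len: "length (concat (map (\<lambda>l. [fst (g l), snd (g l)]) t)) = 2 * length t"
        by (induction t) auto
      have lt: "2 * length t < q" using NF[OF E(1) ts t(1)] by blast
      have "T \<in> set (layers q (k + 3))" using len lt g by (auto simp: T_def set_layers)
      moreover have "known ids k (row \<beta> T) l" if "l \<in> set t" for l
        by (rule known_mono[of _ _ "row \<beta> [fst (g l), snd (g l)]"]) (use g that in \<open>auto simp: T_def\<close>)
      moreover have "k + 2 \<in> set T" using lt by (simp add: T_def)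
      ultimately show ?thesis using dN dE \<beta>(3) t(1)
        by (intro bexI[of _ T]) (auto simp: accept_def intro!: bexI[of _ "k + 2"])
    qed
  qed
  ultimately show ?L by (intro exI[of _ \<beta>]) simp
qed

section \<open>Parsing circuits\<close>

definition canonical :: "bool list \<Rightarrow> bool" where
  "canonical bs \<longleftrightarrow> (case rev bs of [] \<Rightarrow> True | b # _ \<Rightarrow> b)"

text \<open>Written as one step of an iteration so that \<open>ptime_funpow_inc\<close> applies;
  correctness is shown for the equivalent recursion \<open>token_rec\<close>. The state holds the
  bits read so far, the rest and the outcome, and an empty rest makes it idle.\<close>

definition tok_step :: "bool list \<times> bool list \<times> (bool list \<times> bool list) option \<Rightarrow>
    bool list \<times> bool list \<times> (bool list \<times> bool list) option" where
  "tok_step s = (case fst (snd s) of [] \<Rightarrow> ([], [], snd (snd s)) | b # ys \<Rightarrow>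
     (case ys of [] \<Rightarrow> ([], [], None) | c # zs \<Rightarrow>
       if b = c then (fst s @ [b, c], zs, None)
       else if c \<and> canonical (fst s) then ([], [], Some (fst s @ [b, c], zs)) else ([], [], None)))"

definition token :: "bool list \<Rightarrow> (bool list \<times> bool list) option" where
  "token xs = snd (snd ((tok_step ^^ length xs) ([], xs, None)))"

fun token_rec :: "bool list \<Rightarrow> bool list \<Rightarrow> (bool list \<times> bool list) option" where
  "token_rec acc (b # c # zs) = (if b = c then token_rec (acc @ [b, c]) zs
     else if c \<and> canonical acc then Some (acc @ [b, c], zs) else None)"
| "token_rec acc _ = None"

lemma tok_step_done: "(tok_step ^^ n) ([], [], out) = ([], [], out)"
  by (induction n) (auto simp: tok_step_def)

lemma token_eq_rec: "token xs = token_rec [] xs"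
proof -
  have "snd (snd ((tok_step ^^ n) (acc, xs, None))) = token_rec acc xs" if "length xs \<le> n" for n acc
    using that
  proof (induction acc xs arbitrary: n rule: token_rec.induct)
    case (1 acc b c zs)
    then obtain n' where n: "n = Suc n'" "length zs \<le> n'" by (cases n) auto
    show ?case using 1 n(2)
      by (simp add: n(1) funpow_Suc_right tok_step_def[of "(acc, b # c # zs, None)"] tok_step_done del: funpow.simps)
  next
    case ("2_1" acc)
    have "tok_step (acc, [], None) = ([], [], None)" by (simp add: tok_step_def)
    then show ?case by (cases n) (simp_all add: funpow_Suc_right tok_step_done del: funpow.simps(2))
  next
    case ("2_2" acc v)
    then obtain n' where n: "n = Suc n'" by (cases n) auto
    show ?case
      by (simp add: n funpow_Suc_right tok_step_def[of "(acc, [v], None)"] tok_step_done del: funpow.simps)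
  qed
  then show ?thesis by (simp add: token_def)
qed

abbreviation double :: "bool list \<Rightarrow> bool list" where
  "double bs \<equiv> concat (map (\<lambda>b. [b, b]) bs)"

lemma canonical_Nil [simp]: "canonical []"
  and canonical_snoc [simp]: "canonical (bs @ [b]) \<longleftrightarrow> b"
  by (simp_all add: canonical_def)

lemma canonical_double [simp]: "canonical (double bs) \<longleftrightarrow> canonical bs"
proof (cases bs rule: rev_cases)
  case (snoc cs b)
  then have "double bs = (double cs @ [b]) @ [b]" by simp
  then show ?thesis using canonical_snoc snoc by metis
qed simp

lemma canonical_Cons: "bs \<noteq> [] \<Longrightarrow> canonical (b # bs) \<longleftrightarrow> canonical bs"
  by (metis append_butlast_last_id append_Cons canonical_snoc)

lemma enc_nat_double: "\<exists>bs. canonical bs \<and> (bs = [] \<longleftrightarrow> n = 0) \<and> enc_nat n = double bs @ [False, True]"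
proof (induction n rule: enc_nat.induct)
  case 1
  then show ?case by (intro exI[of _ "[]"]) simp
next
  case (2 n)
  then obtain bs where *: "canonical bs \<and> (bs = [] \<longleftrightarrow> Suc n div 2 = 0) \<and>
      enc_nat (Suc n div 2) = double bs @ [False, True]" ..
  note bs = conjunct1[OF *] conjunct1[OF conjunct2[OF *]] conjunct2[OF conjunct2[OF *]]
  have "canonical (odd (Suc n) # bs)"
  proof (cases "bs = []")
    case True
    then have "n = 0" using bs(2) by auto
    then show ?thesis using True by (simp add: canonical_def)
  qed (use bs(1) canonical_Cons in blast)
  then show ?case using bs(3) by (intro exI[of _ "odd (Suc n) # bs"]) simp
qed

lemma double_enc_nat: "canonical bs \<Longrightarrow> \<exists>n. (bs = [] \<longleftrightarrow> n = 0) \<and> enc_nat n = double bs @ [False, True]"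
proof (induction bs)
  case Nil
  show ?case by (intro exI[of _ 0]) simp
next
  case (Cons b bs)
  show ?case
  proof (cases "bs = []")
    case True
    then have b using Cons.prems by (simp add: canonical_def)
    then show ?thesis using True by (intro exI[of _ "Suc 0"]) simp
  next
    case False
    then obtain n where n: "n \<noteq> 0" "enc_nat n = double bs @ [False, True]"
      using Cons canonical_Cons by blast
    obtain m where m: "2 * n + of_bool b = Suc m" using n(1) by (cases n) auto
    have "Suc m div 2 = n" "odd (Suc m) = b" unfolding m[symmetric] by auto
    then have "enc_nat (Suc m) = double (b # bs) @ [False, True]" using n(2) by simp
    then show ?thesis by (intro exI[of _ "Suc m"]) simp
  qed
qed

lemma token_rec_Some:
  "token_rec acc xs = Some (w, r) \<longleftrightarrow>
    (\<exists>bs. xs = double bs @ [False, True] @ r \<and> w = acc @ double bs @ [False, True] \<and> canonical (acc @ double bs))"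
proof (induction acc xs rule: token_rec.induct)
  case (1 acc b c zs)
  show ?case
  proof (cases "b = c")
    case True
    have *: "(b # b # zs = double bs @ [False, True] @ r) \<longleftrightarrow> (\<exists>bs'. bs = b # bs' \<and> zs = double bs' @ [False, True] @ r)" for bs
      by (cases bs) auto
    have "(\<exists>bs. b # b # zs = double bs @ [False, True] @ r \<and> w = acc @ double bs @ [False, True] \<and> canonical (acc @ double bs)) \<longleftrightarrow>
      (\<exists>bs. zs = double bs @ [False, True] @ r \<and> w = (acc @ [b, b]) @ double bs @ [False, True] \<and>
        canonical ((acc @ [b, b]) @ double bs))" (is "(\<exists>bs. ?P bs) \<longleftrightarrow> (\<exists>bs. ?Q bs)")
    proof
      assume "\<exists>bs. ?P bs"
      then obtain bs where bs: "?P bs" ..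
      then obtain bs' where "bs = b # bs'" "zs = double bs' @ [False, True] @ r" using * by blast
      then show "\<exists>bs. ?Q bs" using bs by (intro exI[of _ bs']) simp
    next
      assume "\<exists>bs. ?Q bs"
      then obtain bs where "?Q bs" ..
      then show "\<exists>bs. ?P bs" by (intro exI[of _ "b # bs"]) simp
    qed
    with 1[OF True] True show ?thesis by simp
  next
    case False
    have "(b # c # zs = double bs @ [False, True] @ r) \<longleftrightarrow> bs = [] \<and> \<not> b \<and> c \<and> zs = r" for bs
      using False by (cases bs) auto
    then show ?thesis using False by auto
  qed
next
  case ("2_1" acc)
  then show ?case by auto
next
  case ("2_2" acc v)
  have "\<not> [v] = double bs @ [False, True] @ r" for bs by (cases bs) auto
  then show ?case by simp
qed

text \<open>The image of \<open>enc_nat\<close> consists of the doubled canonical bit strings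
  followed by False, True, which is precisely what \<open>token_rec\<close> accepts.\<close>

lemma token_Some: "token xs = Some (w, r) \<longleftrightarrow> (\<exists>i. w = enc_nat i \<and> xs = enc_nat i @ r)"
proof
  assume "token xs = Some (w, r)"
  then obtain bs where bs: "xs = double bs @ [False, True] @ r" "w = double bs @ [False, True]" "canonical bs"
    by (auto simp: token_eq_rec token_rec_Some)
  obtain i where "enc_nat i = double bs @ [False, True]" using double_enc_nat[OF bs(3)] by blast
  then show "\<exists>i. w = enc_nat i \<and> xs = enc_nat i @ r" using bs(1,2) by (intro exI[of _ i]) simp
next
  assume "\<exists>i. w = enc_nat i \<and> xs = enc_nat i @ r"
  then obtain i where i: "w = enc_nat i" "xs = enc_nat i @ r" by blast
  obtain bs where "canonical bs" "enc_nat i = double bs @ [False, True]" using enc_nat_double by blast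
  then show "token xs = Some (w, r)" unfolding token_eq_rec token_rec_Some i
    by (intro exI[of _ bs]) simp
qed

lemma token_enc_nat [simp]: "token (enc_nat i @ r) = Some (enc_nat i, r)"
  unfolding token_Some by blast

text \<open>The number of parsed children is encoded and compared with the announced fan-in, rather
  than decoding the latter, which in a malformed input may be exponentially large.\<close>

definition many_step :: "(bool list \<Rightarrow> (fm \<times> bool list) option) \<Rightarrow> bool list \<Rightarrow> fm list \<times> bool list \<times> bool \<Rightarrow>
    fm list \<times> bool list \<times> bool" where
  "many_step p m s = (if snd (snd s) \<and> enc_nat (length (fst s)) \<noteq> m then
     (case p (fst (snd s)) of None \<Rightarrow> (fst s, fst (snd s), False) | Some y \<Rightarrow> (fst s @ [fst y], snd y, True)) else s)"

text \<open>Each successful parse consumes at least one bit, so as many rounds as the input has bits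
  are enough.\<close>

definition many :: "(bool list \<Rightarrow> (fm \<times> bool list) option) \<Rightarrow> bool list \<Rightarrow> bool list \<Rightarrow> (fm list \<times> bool list) option" where
  "many p m xs = (let s = (many_step p m ^^ length xs) ([], xs, True) in
     if snd (snd s) \<and> enc_nat (length (fst s)) = m then Some (fst s, fst (snd s)) else None)"

fun chain :: "(bool list \<Rightarrow> (fm \<times> bool list) option) \<Rightarrow> bool list \<Rightarrow> fm list \<Rightarrow> bool list \<Rightarrow> bool" where
  "chain p xs [] r \<longleftrightarrow> xs = r"
| "chain p xs (f # fs) r \<longleftrightarrow> (\<exists>y. p xs = Some (f, y) \<and> chain p y fs r)"

lemma chain_snoc: "chain p xs (fs @ [f]) r \<longleftrightarrow> (\<exists>y. chain p xs fs y \<and> p y = Some (f, r))"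
  by (induction fs arbitrary: xs) auto

lemma many_Some:
  assumes p: "\<And>xs f r. p xs = Some (f, r) \<Longrightarrow> length r < length xs"
  shows "many p (enc_nat n) xs = Some (fs, r) \<longleftrightarrow> length fs = n \<and> chain p xs fs r"
proof
  have inv: "chain p xs (fst ((many_step p m ^^ i) ([], xs, True))) (fst (snd ((many_step p m ^^ i) ([], xs, True))))" for m i
    by (induction i) (auto simp: many_step_def chain_snoc split: option.split)
  assume "many p (enc_nat n) xs = Some (fs, r)"
  then show "length fs = n \<and> chain p xs fs r"
    using inv[where m="enc_nat n" and i="length xs"] prefix_free_inj[OF prefix_free_nat]
    by (auto simp: many_def Let_def split: if_splits)
next
  have fixed: "(many_step p (enc_nat n) ^^ N) (acc, r, True) = (acc, r, True)" if "length acc = n" for N acc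
    using that by (induction N) (auto simp: many_step_def)
  have steps: "(many_step p (enc_nat n) ^^ N) (acc, xs, True) = (acc @ fs, r, True)"
    if "chain p xs fs r" "length acc + length fs = n" "length fs \<le> N" for acc N
    using that
  proof (induction fs arbitrary: xs acc N)
    case Nil
    then show ?case using fixed by simp
  next
    case (Cons f fs)
    then obtain y where y: "p xs = Some (f, y)" "chain p y fs r" by auto
    obtain N' where N: "N = Suc N'" using Cons.prems(3) by (cases N) auto
    have "many_step p (enc_nat n) (acc, xs, True) = (acc @ [f], y, True)"
      using y(1) Cons.prems(2) by (simp add: many_step_def prefix_free_inj[OF prefix_free_nat])
    then show ?case using Cons.IH[OF y(2), of "acc @ [f]" N'] Cons.prems(2,3)
      by (simp add: N funpow_Suc_right del: funpow.simps)
  qed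
  have len: "length fs \<le> length xs" if "chain p xs fs r" for xs
    using that
  proof (induction fs arbitrary: xs)
    case (Cons f fs)
    then obtain y where y: "p xs = Some (f, y)" "chain p y fs r" by auto
    show ?case using p[OF y(1)] Cons.IH[OF y(2)] by simp
  qed simp
  assume "length fs = n \<and> chain p xs fs r"
  then have c: "chain p xs fs r" "length fs = n" by auto
  from steps[OF c(1), of "[]" "length xs"] len[OF c(1)] c(2)
  show "many p (enc_nat n) xs = Some (fs, r)" by (simp add: many_def Let_def)
qed

definition leaf :: "bool \<Rightarrow> bool list \<Rightarrow> (fm \<times> bool list) option" where
  "leaf s xs = (case token xs of None \<Rightarrow> None | Some y \<Rightarrow> Some (Lit s (fst y), snd y))"

definition large :: "bool list \<Rightarrow> bool" where
  "large m \<longleftrightarrow> m \<noteq> enc_nat 0 \<and> m \<noteq> enc_nat 1 \<and> m \<noteq> enc_nat 2"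

text \<open>\<open>p\<close> parses the inputs of a small gate, \<open>p'\<close> those of a large
  gate, where one unit of weft has been spent.\<close>

definition gate :: "(bool list \<Rightarrow> (fm \<times> bool list) option) \<Rightarrow> (bool list \<Rightarrow> (fm \<times> bool list) option) \<Rightarrow> bool \<Rightarrow>
    bool list \<Rightarrow> (fm \<times> bool list) option" where
  "gate p p' b xs = (case token xs of None \<Rightarrow> None | Some y \<Rightarrow>
     (case (if large (fst y) then many p' (fst y) (snd y) else many p (fst y) (snd y)) of
        None \<Rightarrow> None | Some z \<Rightarrow> Some (Gate b (fst z), snd z)))"

text \<open>The recursion is over the depth bound, so that for fixed d the parser is a fixed
  composition of polynomial-time functions. It checks depth and weft on the way and produces the
  negation normal form directly.\<close>

primrec parse :: "nat \<Rightarrow> nat \<Rightarrow> bool \<Rightarrow> bool list \<Rightarrow> (fm \<times> bool list) option" where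
  "parse 0 w s xs = (case token xs of None \<Rightarrow> None | Some y \<Rightarrow>
     if fst y = enc_nat 0 then leaf s (snd y) else None)"
| "parse (Suc d) w s xs = (case token xs of None \<Rightarrow> None | Some y \<Rightarrow>
     if fst y = enc_nat 0 then leaf s (snd y)
     else if fst y = enc_nat 1 then parse d w (\<not> s) (snd y)
     else if fst y = enc_nat 2 \<or> fst y = enc_nat 3 then
       gate (parse d w s) (if w = 0 then (\<lambda>_. None) else parse d (w - 1) s)
         (if fst y = enc_nat 2 then \<not> s else s) (snd y)
     else None)"

text \<open>Weft and depth as budgets spent on the way down, to match the recursion of
  \<open>parse\<close>; \<open>cshape_iff\<close> relates them to the bottom-up definitions.\<close>

fun cshape :: "nat \<Rightarrow> nat \<Rightarrow> circ \<Rightarrow> bool" where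
  "cshape w d (Inp i) = True"
| "cshape w d (NotG c) = (d > 0 \<and> cshape w (d - 1) c)"
| "cshape w d (AndG cs) = (d > 0 \<and> (length cs > 2 \<longrightarrow> w > 0) \<and>
     (\<forall>c\<in>set cs. cshape (if length cs > 2 then w - 1 else w) (d - 1) c))"
| "cshape w d (OrG cs) = (d > 0 \<and> (length cs > 2 \<longrightarrow> w > 0) \<and>
     (\<forall>c\<in>set cs. cshape (if length cs > 2 then w - 1 else w) (d - 1) c))"

lemma fold_max_eq_0: "fold max xs 0 = 0 \<longleftrightarrow> (\<forall>x\<in>set xs. x = (0 :: nat))"
  using fold_max_le[of xs 0 0] by simp

lemma cshape_iff: "cshape w d C \<longleftrightarrow> circ_weft C \<le> w \<and> circ_depth C \<le> d"
proof (induction w d C rule: cshape.induct)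
  case (2 w d c)
  then show ?case by (cases d) auto
next
  case (3 w d cs)
  then show ?case by (cases d; cases w) (auto simp: fold_max_le fold_max_eq_0)
next
  case (4 w d cs)
  then show ?case by (cases d; cases w) (auto simp: fold_max_le fold_max_eq_0)
qed simp

lemma shape_nnf: "cshape w d C \<Longrightarrow> shape w d (nnf s C)"
proof (induction w d C arbitrary: s rule: cshape.induct)
  case (2 w d c)
  then show ?case using shape_mono[of w "d - 1" "nnf (\<not> s) c" d] by simp
qed auto

lemma enc_circ_ne: "enc_circ C \<noteq> []"
proof -
  have "enc_nat i \<noteq> []" for i by (cases i) auto
  then show ?thesis by (cases C) auto
qed

lemma chain_Some:
  assumes p: "\<And>xs f r. p xs = Some (f, r) \<longleftrightarrow> (\<exists>C. xs = enc_circ C @ r \<and> f = nnf s C \<and> R C)"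
  shows "chain p xs fs r \<longleftrightarrow> (\<exists>Cs. xs = concat (map enc_circ Cs) @ r \<and> fs = map (nnf s) Cs \<and> (\<forall>C\<in>set Cs. R C))"
proof (induction fs arbitrary: xs)
  case Nil
  then show ?case by auto
next
  case (Cons f fs)
  show ?case
  proof
    assume "chain p xs (f # fs) r"
    then obtain y where "p xs = Some (f, y)" "chain p y fs r" by auto
    then obtain C Cs where "xs = enc_circ C @ y" "f = nnf s C" "R C"
      "y = concat (map enc_circ Cs) @ r" "fs = map (nnf s) Cs" "\<forall>C\<in>set Cs. R C"
      unfolding p Cons.IH by blast
    then show "\<exists>Cs. xs = concat (map enc_circ Cs) @ r \<and> f # fs = map (nnf s) Cs \<and> (\<forall>C\<in>set Cs. R C)"
      by (intro exI[of _ "C # Cs"]) auto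
  next
    assume "\<exists>Cs. xs = concat (map enc_circ Cs) @ r \<and> f # fs = map (nnf s) Cs \<and> (\<forall>C\<in>set Cs. R C)"
    then obtain Ds where Ds: "xs = concat (map enc_circ Ds) @ r" "f # fs = map (nnf s) Ds" "\<forall>C\<in>set Ds. R C"
      by (elim exE conjE)
    obtain C Cs where "Ds = C # Cs" using Ds(2) by (cases Ds) auto
    with Ds have *: "xs = concat (map enc_circ (C # Cs)) @ r" "f # fs = map (nnf s) (C # Cs)" "\<forall>C\<in>set (C # Cs). R C"
      by simp_all
    have "p xs = Some (f, concat (map enc_circ Cs) @ r)" unfolding p using * by (intro exI[of _ C]) simp
    moreover have "chain p (concat (map enc_circ Cs) @ r) fs r" unfolding Cons.IH using * by (intro exI[of _ Cs]) simp
    ultimately show "chain p xs (f # fs) r" by auto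
  qed
qed

lemma large_enc_nat: "large (enc_nat n) \<longleftrightarrow> 2 < n"
  unfolding large_def prefix_free_inj[OF prefix_free_nat] by auto

lemma gate_Some:
  assumes p: "\<And>xs f r. p xs = Some (f, r) \<longleftrightarrow> (\<exists>C. xs = enc_circ C @ r \<and> f = nnf s C \<and> R C)"
    and p': "\<And>xs f r. p' xs = Some (f, r) \<longleftrightarrow> (\<exists>C. xs = enc_circ C @ r \<and> f = nnf s C \<and> R' C)"
  shows "gate p p' b xs = Some (f, r) \<longleftrightarrow> (\<exists>Cs. xs = enc_nat (length Cs) @ concat (map enc_circ Cs) @ r \<and>
     f = Gate b (map (nnf s) Cs) \<and> (\<forall>C\<in>set Cs. if 2 < length Cs then R' C else R C))"
proof -
  have len: "length r < length xs" if "\<exists>C. xs = enc_circ C @ r \<and> f = nnf s C \<and> R C" for xs f r and R :: "circ \<Rightarrow> bool"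
    using that enc_circ_ne by auto
  have m: "many p (enc_nat n) ys = Some (fs, r) \<longleftrightarrow> length fs = n \<and>
      (\<exists>Cs. ys = concat (map enc_circ Cs) @ r \<and> fs = map (nnf s) Cs \<and> (\<forall>C\<in>set Cs. R C))" for n ys fs r
    unfolding chain_Some[OF p, symmetric] by (rule many_Some) (rule len[OF p[THEN iffD1]])
  have m': "many p' (enc_nat n) ys = Some (fs, r) \<longleftrightarrow> length fs = n \<and>
      (\<exists>Cs. ys = concat (map enc_circ Cs) @ r \<and> fs = map (nnf s) Cs \<and> (\<forall>C\<in>set Cs. R' C))" for n ys fs r
    unfolding chain_Some[OF p', symmetric] by (rule many_Some) (rule len[OF p'[THEN iffD1]])
  have mm: "(if 2 < n then many p' (enc_nat n) ys else many p (enc_nat n) ys) = Some (fs, r) \<longleftrightarrow>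
      (\<exists>Cs. length Cs = n \<and> ys = concat (map enc_circ Cs) @ r \<and> fs = map (nnf s) Cs \<and>
        (\<forall>C\<in>set Cs. if 2 < length Cs then R' C else R C))" for n ys fs r
  proof (cases "2 < n")
    case True
    then show ?thesis using m'[of n ys fs r] by (auto simp del: enc_nat.simps)
  next
    case False
    then show ?thesis using m[of n ys fs r] by (auto simp del: enc_nat.simps)
  qed
  show ?thesis
  proof
    assume g: "gate p p' b xs = Some (f, r)"
    then obtain m ys where t: "token xs = Some (m, ys)" by (cases "token xs") (auto simp: gate_def)
    with g obtain fs where 1: "f = Gate b fs" "(if large m then many p' m ys else many p m ys) = Some (fs, r)"
      unfolding gate_def t option.case fst_conv snd_conv
      by (cases "if large m then many p' m ys else many p m ys") auto
    then obtain n where n: "m = enc_nat n" "xs = enc_nat n @ ys" using t unfolding token_Some by blast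
    from 1 show "\<exists>Cs. xs = enc_nat (length Cs) @ concat (map enc_circ Cs) @ r \<and>
       f = Gate b (map (nnf s) Cs) \<and> (\<forall>C\<in>set Cs. if 2 < length Cs then R' C else R C)"
      unfolding n large_enc_nat mm by auto
  next
    assume "\<exists>Cs. xs = enc_nat (length Cs) @ concat (map enc_circ Cs) @ r \<and>
       f = Gate b (map (nnf s) Cs) \<and> (\<forall>C\<in>set Cs. if 2 < length Cs then R' C else R C)"
    then obtain Cs where Cs: "xs = enc_nat (length Cs) @ concat (map enc_circ Cs) @ r"
      "f = Gate b (map (nnf s) Cs)" "\<forall>C\<in>set Cs. if 2 < length Cs then R' C else R C" by blast
    have T: "(if 2 < length Cs then many p' (enc_nat (length Cs)) (concat (map enc_circ Cs) @ r)
      else many p (enc_nat (length Cs)) (concat (map enc_circ Cs) @ r)) = Some (map (nnf s) Cs, r)"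
      unfolding mm using Cs(3) by blast
    show "gate p p' b xs = Some (f, r)"
      unfolding Cs(1,2) gate_def token_enc_nat option.case fst_conv snd_conv large_enc_nat T ..
  qed
qed

lemma leaf_Some: "leaf s xs = Some (f, r) \<longleftrightarrow> (\<exists>i. xs = enc_nat i @ r \<and> f = Lit s (enc_nat i))"
proof -
  have "leaf s xs = Some (f, r) \<longleftrightarrow> (\<exists>w. token xs = Some (w, r) \<and> f = Lit s w)"
    by (auto simp: leaf_def split: option.split)
  then show ?thesis unfolding token_Some by blast
qed

lemma parse_Some:
  "parse d w s xs = Some (f, r) \<longleftrightarrow> (\<exists>C. xs = enc_circ C @ r \<and> f = nnf s C \<and> cshape w d C)"
proof (induction d arbitrary: w s xs f r)
  case 0
  show ?case
  proof
    assume "parse 0 w s xs = Some (f, r)"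
    then obtain y where "token xs = Some (enc_nat 0, y)" "leaf s y = Some (f, r)"
      by (auto simp del: enc_nat.simps split: option.splits if_splits)
    then have "xs = enc_nat 0 @ y" "leaf s y = Some (f, r)"
      unfolding token_Some prefix_free_inj[OF prefix_free_nat] by auto
    then obtain i where "xs = enc_circ (Inp i) @ r" "f = nnf s (Inp i)" unfolding leaf_Some by auto
    then show "\<exists>C. xs = enc_circ C @ r \<and> f = nnf s C \<and> cshape w 0 C" by (metis cshape.simps(1))
  next
    assume "\<exists>C. xs = enc_circ C @ r \<and> f = nnf s C \<and> cshape w 0 C"
    then obtain C where C: "xs = enc_circ C @ r" "f = nnf s C" "cshape w 0 C" by blast
    then obtain i where i: "C = Inp i" by (cases C) auto
    have "token xs = Some (enc_nat 0, enc_nat i @ r)" unfolding C(1) i enc_circ.simps append_assoc by (rule token_enc_nat)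
    then show "parse 0 w s xs = Some (f, r)" using C(2) i by (auto simp: leaf_Some simp del: enc_nat.simps)
  qed
next
  case (Suc d)
  let ?p' = "if w = 0 then (\<lambda>_. None) else parse d (w - 1) s"
  have p': "?p' xs = Some (f, r) \<longleftrightarrow> (\<exists>C. xs = enc_circ C @ r \<and> f = nnf s C \<and> (w > 0 \<and> cshape (w - 1) d C))" for xs f r
    using Suc.IH[of "w - 1" s xs f r] by auto
  have gate: "gate (parse d w s) ?p' b xs = Some (f, r) \<longleftrightarrow>
     (\<exists>Cs. xs = enc_nat (length Cs) @ concat (map enc_circ Cs) @ r \<and>
     f = Gate b (map (nnf s) Cs) \<and> (\<forall>C\<in>set Cs. if 2 < length Cs then w > 0 \<and> cshape (w - 1) d C else cshape w d C))" for b xs f r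
    by (rule gate_Some[OF Suc.IH p'])
  have sh: "(\<forall>C\<in>set Cs. if 2 < length Cs then w > 0 \<and> cshape (w - 1) d C else cshape w d C) \<longleftrightarrow>
     (length Cs > 2 \<longrightarrow> w > 0) \<and> (\<forall>c\<in>set Cs. cshape (if length Cs > 2 then w - 1 else w) d c)" for Cs
    by (cases Cs) auto
  have inj: "enc_nat a = enc_nat b \<longleftrightarrow> a = b" for a b by (rule prefix_free_inj[OF prefix_free_nat])
  show ?case
  proof
    assume pr: "parse (Suc d) w s xs = Some (f, r)"
    then obtain m y where t: "token xs = Some (m, y)" by (cases "token xs") auto
    then obtain i where i: "m = enc_nat i" and tok: "xs = enc_nat i @ y" unfolding token_Some by blast
    have *: "(if i = 0 then leaf s y else if i = 1 then parse d w (\<not> s) y else if i = 2 \<or> i = 3 then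
        gate (parse d w s) ?p' (if i = 2 then \<not> s else s) y else None) = Some (f, r)"
      using pr unfolding parse.simps t option.case fst_conv snd_conv i inj .
    consider "i = 0" | "i = 1" | "i = 2" | "i = 3" using * by (auto split: if_splits)
    then show "\<exists>C. xs = enc_circ C @ r \<and> f = nnf s C \<and> cshape w (Suc d) C"
    proof cases
      case 1
      with * obtain j where "y = enc_nat j @ r" "f = Lit s (enc_nat j)" by (auto simp: leaf_Some)
      then show ?thesis using tok 1 by (intro exI[of _ "Inp j"]) simp
    next
      case 2
      with * have "parse d w (\<not> s) y = Some (f, r)" by simp
      then obtain C where "y = enc_circ C @ r" "f = nnf (\<not> s) C" "cshape w d C" unfolding Suc.IH by blast
      then show ?thesis using tok 2 by (intro exI[of _ "NotG C"]) (simp del: enc_nat.simps)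
    next
      case 3
      with * have "gate (parse d w s) ?p' (\<not> s) y = Some (f, r)" by simp
      then obtain Cs where "y = enc_nat (length Cs) @ concat (map enc_circ Cs) @ r" "f = Gate (\<not> s) (map (nnf s) Cs)"
        "(length Cs > 2 \<longrightarrow> w > 0) \<and> (\<forall>c\<in>set Cs. cshape (if length Cs > 2 then w - 1 else w) d c)"
        unfolding gate sh by blast
      then show ?thesis using tok 3 by (intro exI[of _ "AndG Cs"]) (simp del: enc_nat.simps)
    next
      case 4
      with * have "gate (parse d w s) ?p' s y = Some (f, r)" by simp
      then obtain Cs where "y = enc_nat (length Cs) @ concat (map enc_circ Cs) @ r" "f = Gate s (map (nnf s) Cs)"
        "(length Cs > 2 \<longrightarrow> w > 0) \<and> (\<forall>c\<in>set Cs. cshape (if length Cs > 2 then w - 1 else w) d c)"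
        unfolding gate sh by blast
      then show ?thesis using tok 4 by (intro exI[of _ "OrG Cs"]) (simp del: enc_nat.simps)
    qed
  next
    assume "\<exists>C. xs = enc_circ C @ r \<and> f = nnf s C \<and> cshape w (Suc d) C"
    then obtain C where C: "xs = enc_circ C @ r" "f = nnf s C" "cshape w (Suc d) C" by blast
    have parse: "parse (Suc d) w s xs = (if i = 0 then leaf s y else if i = 1 then parse d w (\<not> s) y
        else if i = 2 \<or> i = 3 then gate (parse d w s) ?p' (if i = 2 then \<not> s else s) y else None)"
      if "xs = enc_nat i @ y" for i y
      unfolding that parse.simps token_enc_nat option.case fst_conv snd_conv inj ..
    show "parse (Suc d) w s xs = Some (f, r)"
    proof (cases C)
      case (Inp i)
      have "leaf s (enc_nat i @ r) = Some (f, r)"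
        unfolding leaf_Some using C(2) Inp by (intro exI[of _ i]) simp
      then show ?thesis using C(1) Inp parse[of 0 "enc_nat i @ r"] by (simp del: parse.simps enc_nat.simps)
    next
      case (NotG c)
      have "parse d w (\<not> s) (enc_circ c @ r) = Some (f, r)" unfolding Suc.IH using C NotG by auto
      then show ?thesis using C(1) NotG parse[of 1 "enc_circ c @ r"] by (simp del: parse.simps enc_nat.simps)
    next
      case (AndG Cs)
      let ?y = "enc_nat (length Cs) @ concat (map enc_circ Cs) @ r"
      have "gate (parse d w s) ?p' (\<not> s) ?y = Some (f, r)"
        unfolding gate sh using C(2,3) AndG by (intro exI[of _ Cs]) simp
      then show ?thesis using C(1) AndG parse[of 2 ?y] by (simp del: parse.simps enc_nat.simps)
    next
      case (OrG Cs)
      let ?y = "enc_nat (length Cs) @ concat (map enc_circ Cs) @ r"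
      have "gate (parse d w s) ?p' s ?y = Some (f, r)"
        unfolding gate sh using C(2,3) OrG by (intro exI[of _ Cs]) simp
      then show ?thesis using C(1) OrG parse[of 3 ?y] by (simp del: parse.simps enc_nat.simps)
    qed
  qed
qed

section \<open>The reduction and its running time\<close>

instantiation fm :: data
begin
primrec encode_fm :: "fm \<Rightarrow> tree" where
  "encode_fm (Lit s x) = Nd Lf (Nd (encode s) (encode x))"
| "encode_fm (Gate b fs) = Nd (Nd Lf Lf) (Nd (encode b) (tree_list (map encode_fm fs)))"
instance ..
end

lemma encode_Gate: "encode (Gate b fs) = Nd (Nd Lf Lf) (Nd (encode b) (encode fs))"
  by (simp add: encode_list_def)

lemma ptime_is_gate: "ptime (\<lambda>f. case f of Lit s x \<Rightarrow> False | Gate b fs \<Rightarrow> True)"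
  by (rule ptimeI[OF timed_fst']) (auto intro!: polyb_intros split: fm.split)

lemma ptime_Lit [ptime_intros]: "ptime f \<Longrightarrow> ptime g \<Longrightarrow> ptime (\<lambda>x. Lit (f x) (g x))"
proof -
  assume "ptime f" "ptime g"
  then have fg: "ptime (\<lambda>x. ((), f x, g x))" by (intro ptime_intros)
  have "ptime (\<lambda>p :: unit \<times> bool \<times> bool list. Lit (fst (snd p)) (snd (snd p)))" by (rule ptime_recode) auto
  from ptime_o[OF this fg] show ?thesis by simp
qed

text \<open>A gate has the code of the triple of \<^term>\<open>Some ()\<close> and its two components.\<close>

lemma ptime_Gate [ptime_intros]: "ptime f \<Longrightarrow> ptime g \<Longrightarrow> ptime (\<lambda>x. Gate (f x) (g x))"
proof -
  assume "ptime f" "ptime g"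
  then have fg: "ptime (\<lambda>x. (Some (), f x, g x))" by (intro ptime_intros)
  have "ptime (\<lambda>p :: unit option \<times> bool \<times> fm list. if fst p \<noteq> None then Gate (fst (snd p)) (snd (snd p)) else Gate True [])"
  proof (rule ptime_if_on)
    show "ptime (\<lambda>p :: unit option \<times> bool \<times> fm list. fst p \<noteq> None)"
      by (rule ptime_o[OF ptime_is_node]) (auto intro: ptime_intros)
    have "timed {p :: unit option \<times> bool \<times> fm list. fst p \<noteq> None} (\<lambda>p. Gate (fst (snd p)) (snd (snd p))) (\<lambda>_. 1)"
      by (rule timed_recode) (auto simp: encode_Gate simp del: encode_fm.simps)
    then show "timed {p :: unit option \<times> bool \<times> fm list. fst p \<noteq> None} (\<lambda>p. Gate (fst (snd p)) (snd (snd p))) (\<lambda>x. 60 * sz x)"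
      by (rule timed_mono) (use sz_pos in \<open>auto simp: Suc_le_eq\<close>)
  qed
  from ptime_o[OF this fg] show ?thesis by simp
qed

lemma ptime_case_fm [ptime_intros]:
  assumes l: "ptime l" and a: "ptime (\<lambda>z. a (fst z) (fst (snd z)) (snd (snd z)))"
    and g: "ptime (\<lambda>z. g (fst z) (fst (snd z)) (snd (snd z)))"
  shows "ptime (\<lambda>x. case l x of Lit s y \<Rightarrow> a x s y | Gate b fs \<Rightarrow> g x b fs)"
proof -
  let ?gate = "\<lambda>f. case f of Lit s x \<Rightarrow> False | Gate b fs \<Rightarrow> True"
  let ?L = "\<lambda>f. case f of Lit s x \<Rightarrow> (s, x) | Gate b fs \<Rightarrow> (True, [])"
  let ?G = "\<lambda>f. case f of Lit s x \<Rightarrow> (True, []) | Gate b fs \<Rightarrow> (b, fs)"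
  have "ptime (\<lambda>f. if \<not> ?gate f then ?L f else (True, []))"
    by (rule ptime_if_on[OF ptime_not[OF ptime_is_gate] timed_snd']) (auto split: fm.splits)
  also have "(\<lambda>f. if \<not> ?gate f then ?L f else (True, [])) = ?L" by (auto split: fm.split)
  finally have L: "ptime ?L" .
  have "ptime (\<lambda>f. if ?gate f then ?G f else (True, []))"
    by (rule ptime_if_on[OF ptime_is_gate timed_snd']) (auto simp: encode_Gate simp del: encode_fm.simps split: fm.splits)
  also have "(\<lambda>f. if ?gate f then ?G f else (True, [])) = ?G" by (auto split: fm.split)
  finally have G: "ptime ?G" .
  have "ptime (\<lambda>x. if ?gate (l x) then g x (fst (?G (l x))) (snd (?G (l x))) else a x (fst (?L (l x))) (snd (?L (l x))))"
    by (intro ptime_if ptime_o[OF ptime_is_gate l] ptime_3[OF a] ptime_3[OF g] ptime_id ptime_fst ptime_snd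
      ptime_o[OF G l] ptime_o[OF L l])
  also have "(\<lambda>x. if ?gate (l x) then g x (fst (?G (l x))) (snd (?G (l x))) else a x (fst (?L (l x))) (snd (?L (l x)))) =
      (\<lambda>x. case l x of Lit s y \<Rightarrow> a x s y | Gate b fs \<Rightarrow> g x b fs)"
    by (auto split: fm.split)
  finally show ?thesis .
qed

lemma sz_bool: "sz (b :: bool) \<le> 3"
  by (cases b) auto

text \<open>Division by two in unary: a toggling bit is flipped m times, and every second flip
  increments the quotient.\<close>

lemma ptime_half: "ptime (\<lambda>m :: nat. (m div 2, odd m))"
proof -
  let ?f = "\<lambda>s :: nat \<times> bool. (if snd s then Suc (fst s) else fst s, \<not> snd s)"
  have "ptime (\<lambda>m :: nat. (?f ^^ m) (0, False))"
    by (rule ptime_funpow_inc[where B="\<lambda>_. 5"]) (auto intro!: ptime_intros polyb_intros)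
  moreover have "(?f ^^ m) (0, False) = (m div 2, odd m)" for m
    by (induction m) (auto simp: div_Suc even_Suc_div_two odd_Suc_div_two)
  ultimately show ?thesis by simp
qed

lemma ptime_enc_nat [ptime_intros]: "ptime f \<Longrightarrow> ptime (\<lambda>x. enc_nat (f x))"
proof (rule ptime_o[of enc_nat])
  let ?f = "\<lambda>s :: nat \<times> bool list. if fst s = 0 then s
     else (fst (fst s div 2, odd (fst s)), snd s @ [snd (fst s div 2, odd (fst s)), snd (fst s div 2, odd (fst s))])"
  have inc: "sz (?f s) \<le> sz s + 8" for s
  proof -
    have "sz (snd s @ [b, b]) \<le> sz (snd s) + 8" for b
      using sz_append[of "snd s" "[b, b]"] sz_bool[of b] by simp
    from this[of "odd (fst s)"] show ?thesis by (cases s) auto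
  qed
  have "ptime (\<lambda>n. (?f ^^ n) (n, []))"
    by (rule ptime_funpow_inc[where B="\<lambda>_. 8", OF _ _ _ _ inc])
      (intro ptime_intros polyb_intros ptime_o[OF ptime_half])+
  then have "ptime (\<lambda>n. snd ((?f ^^ n) (n, [])) @ [False, True])" by (intro ptime_intros)
  moreover have "m \<le> N \<Longrightarrow> snd ((?f ^^ N) (m, acc)) @ [False, True] = acc @ enc_nat m" for m N acc
  proof (induction N arbitrary: m acc)
    case (Suc N)
    have z: "(?f ^^ N) (0, acc) = (0, acc)" for N acc by (induction N) auto
    show ?case
    proof (cases m)
      case 0
      then show ?thesis using z[of "Suc N" acc] by (simp del: funpow.simps)
    next
      case (Suc m')
      then have "m div 2 \<le> N" using Suc.prems by simp
      from Suc.IH[OF this, of "acc @ [odd m, odd m]"] show ?thesis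
        using \<open>m = Suc m'\<close> by (simp add: funpow_Suc_right del: funpow.simps)
    qed
  qed simp
  ultimately show "ptime enc_nat" by simp
qed

lemma ptime_canonical [ptime_intros]: "ptime f \<Longrightarrow> ptime (\<lambda>x. canonical (f x))"
  unfolding canonical_def by (intro ptime_intros)

lemma ptime_token [ptime_intros]: "ptime f \<Longrightarrow> ptime (\<lambda>x. token (f x))"
proof (rule ptime_o[of token])
  have "sz (tok_step s) \<le> sz s + 30" for s
  proof -
    have "sz (fst s @ [b, c]) \<le> sz (fst s) + 8" for b c
      using sz_append[of "fst s" "[b, c]"] sz_bool[of b] sz_bool[of c] by simp
    note snoc = this
    obtain acc xs out where s: "s = (acc, xs, out)" by (metis prod_cases3)
    show ?thesis
    proof (cases xs)
      case Nil
      then show ?thesis using sz_pos[of acc] by (simp add: s tok_step_def)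
    next
      case (Cons b ys)
      show ?thesis
      proof (cases ys)
        case Nil
        then show ?thesis using Cons by (simp add: s tok_step_def)
      next
        case (Cons c zs)
        then show ?thesis using \<open>xs = b # ys\<close> snoc[of True True] snoc[of False True] snoc[of False False] sz_pos[of out]
          by (cases b; cases c) (simp_all add: s tok_step_def)
      qed
    qed
  qed
  then have "ptime (\<lambda>xs. snd (snd ((tok_step ^^ length xs) ([], xs, None))))"
    by (intro ptime_snd ptime_funpow_inc[where B="\<lambda>_. 30"] polyb_intros ptime_intros)
      (auto simp: tok_step_def intro!: ptime_intros)
  moreover have "token = (\<lambda>xs. snd (snd ((tok_step ^^ length xs) ([], xs, None))))"
    by (simp add: fun_eq_iff token_def)
  ultimately show "ptime token" by simp
qed

text \<open>The unread rest is a suffix and hence no larger than the input. This serves as the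
  invariant in \<open>ptime_many\<close>: every child is parsed from something no larger than the
  original input, so its size has a common polynomial bound.\<close>

definition suffix_parser :: "(bool list \<Rightarrow> (fm \<times> bool list) option) \<Rightarrow> bool" where
  "suffix_parser p \<longleftrightarrow> ptime p \<and> (\<forall>xs f r. p xs = Some (f, r) \<longrightarrow> (\<exists>u. xs = u @ r))"

lemma ptime_many:
  assumes "suffix_parser p"
  shows "ptime (\<lambda>z. many p (fst z) (snd z))"
proof -
  have p: "ptime p" and suf: "\<And>xs f r. p xs = Some (f, r) \<Longrightarrow> \<exists>u. xs = u @ r"
    using assms by (auto simp: suffix_parser_def)
  obtain c where c: "\<And>xs. sz (p xs) \<le> (sz xs + 1) ^ c" using ptime_sz[OF p] unfolding polyb_def by blast
  let ?B = "\<lambda>z :: bool list \<times> bool list. (sz z + 1) ^ c + 10"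
  let ?P = "\<lambda>(z :: bool list \<times> bool list) (s :: fm list \<times> bool list \<times> bool). sz (fst (snd s)) \<le> sz (snd z)"
  have inv: "?P z (many_step p (fst z) s) \<and> sz (many_step p (fst z) s) \<le> sz s + ?B z" if P: "?P z s" for z s
  proof (cases "p (fst (snd s))")
    case None
    then show ?thesis using P by (cases s) (auto simp: many_step_def)
  next
    case (Some y)
    obtain u where u: "fst (snd s) = u @ snd y" using suf[of "fst (snd s)" "fst y" "snd y"] Some by auto
    have r: "sz (snd y) \<le> sz (fst (snd s))" unfolding u using sz_append[of u "snd y"] sz_pos[of u] by simp
    have "sz (p (fst (snd s))) \<le> (sz (fst (snd s)) + 1) ^ c" by (rule c)
    also have "\<dots> \<le> (sz z + 1) ^ c"
      using P by (intro power_mono) (cases z, auto)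
    finally have "sz y \<le> (sz z + 1) ^ c" using Some by simp
    then have "sz (fst s @ [fst y]) \<le> sz (fst s) + (sz z + 1) ^ c + 2"
      using sz_append[of "fst s" "[fst y]"] by (cases y) simp
    then show ?thesis using r P Some sz_bool[of "snd (snd s)"] sz_pos[of "snd (snd s)"]
      by (cases s) (auto simp: many_step_def)
  qed
  have "ptime (\<lambda>z. (many_step p (fst z) ^^ length (snd z)) ([], snd z, True))"
  proof (rule ptime_funpow_inv[where B="?B" and P="?P"])
    show "ptime (\<lambda>x. many_step p (fst (fst x)) (snd x))"
      unfolding many_step_def by (intro ptime_intros ptime_o[OF p])
    show "?P z (many_step p (fst z) s) \<and> sz (many_step p (fst z) s) \<le> sz s + ?B z" if "?P z s" for z s
      using that by (rule inv)
  qed ((intro ptime_intros polyb_intros | simp)+)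
  then show ?thesis unfolding many_def Let_def by (intro ptime_intros)
qed

lemma ptime_leaf [ptime_intros]: "ptime f \<Longrightarrow> ptime (\<lambda>x. leaf s (f x))"
  unfolding leaf_def by (intro ptime_intros)

lemma ptime_gate:
  assumes p: "suffix_parser p" "suffix_parser p'"
  shows "ptime (gate p p' b)"
proof -
  have "ptime (\<lambda>xs. gate p p' b xs)"
    unfolding gate_def large_def
    by (intro ptime_intros ptime_2[OF ptime_many[OF p(1)]] ptime_2[OF ptime_many[OF p(2)]])
  then show ?thesis .
qed

lemma suffix_parser_parse: "suffix_parser (parse d w s)"
proof (induction d arbitrary: w s)
  case 0
  have "ptime (\<lambda>xs. parse 0 w s xs)" unfolding parse.simps by (intro ptime_intros)
  then show ?case by (auto simp: suffix_parser_def parse_Some simp del: parse.simps)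
next
  case (Suc d)
  have "suffix_parser (\<lambda>_. None)" by (auto simp: suffix_parser_def ptime_const)
  then have "suffix_parser (if w = 0 then (\<lambda>_. None) else parse d (w - 1) s)" using Suc by simp
  note gate = ptime_gate[OF Suc this]
  have split: "gate p p' (if c then \<not> s else s) xs = (if c then gate p p' (\<not> s) xs else gate p p' s xs)" for p p' c xs
    by simp
  have p: "ptime (parse d w (\<not> s))" using Suc by (simp add: suffix_parser_def)
  have "ptime (\<lambda>xs. parse (Suc d) w s xs)" unfolding parse.simps split
    by (intro ptime_intros ptime_o[OF p] ptime_o[OF gate])
  then show ?case by (auto simp: suffix_parser_def parse_Some simp del: parse.simps)
qed

lemma ptime_flat: "ptime (flat d b)"
proof (induction d)
  case 0
  have "ptime (\<lambda>f. flat 0 b f)" unfolding flat.simps by (intro ptime_intros)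
  then show ?case .
next
  case (Suc d)
  have "ptime (\<lambda>f. flat (Suc d) b f)" unfolding flat.simps
    by (intro ptime_intros ptime_o[OF Suc.IH])
  then show ?case .
qed

lemma ptime_nf: "ptime (nf d)"
proof -
  have "ptime (\<lambda>f. nf d f)" unfolding nf_def by (intro ptime_intros ptime_o[OF ptime_flat])
  then show ?thesis .
qed

text \<open>Depth-bounded like \<open>parse\<close> and \<open>flat\<close>, so that polynomial time
  follows by induction on the constant d.\<close>

primrec var_list :: "nat \<Rightarrow> fm \<Rightarrow> bool list list" where
  "var_list 0 f = (case f of Lit s x \<Rightarrow> [x] | Gate b fs \<Rightarrow> [])"
| "var_list (Suc d) f = (case f of Lit s x \<Rightarrow> [x] | Gate b fs \<Rightarrow> concat (map (var_list d) fs))"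

lemma set_var_list: "shape w d f \<Longrightarrow> set (var_list d f) = fvars f"
proof (induction d arbitrary: w f)
  case 0
  then show ?case by (cases f) auto
next
  case (Suc d)
  show ?case
  proof (cases f)
    case (Gate b fs)
    have "set (var_list d g) = fvars g" if "g \<in> set fs" for g
      using Suc.prems Gate that by (intro Suc.IH[of "if length fs > 2 then w - 1 else w"]) auto
    then show ?thesis using Gate by auto
  qed auto
qed

definition variables :: "nat \<Rightarrow> fm \<Rightarrow> bool list list" where
  "variables d f = fold List.insert (var_list d f) []"

lemma variables: "set (variables d f) = set (var_list d f)" "distinct (variables d f)"
proof -
  have "set (fold List.insert xs ys) = set xs \<union> set ys" "distinct ys \<Longrightarrow> distinct (fold List.insert xs ys)"
    for xs ys :: "bool list list"
    by (induction xs arbitrary: ys) auto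
  then show "set (variables d f) = set (var_list d f)" "distinct (variables d f)" by (simp_all add: variables_def)
qed

lemma ptime_variables: "ptime (variables d)"
proof -
  have v: "ptime (var_list d)"
  proof (induction d)
    case 0
    have "ptime (\<lambda>f. var_list 0 f)" unfolding var_list.simps by (intro ptime_intros)
    then show ?case .
  next
    case (Suc d)
    have "ptime (\<lambda>f. var_list (Suc d) f)" unfolding var_list.simps by (intro ptime_intros ptime_o[OF Suc.IH])
    then show ?case .
  qed
  have "ptime (\<lambda>f. fold (\<lambda>x xs. if x \<in> set xs then xs else x # xs) (var_list d f) [])"
    by (rule ptime_fold_inc[where B="\<lambda>f. sz (var_list d f) + 1"])
      (auto intro!: ptime_intros polyb_intros polyb_Suc v ptime_sz[OF v] dest!: sz_mem)
  moreover have "variables d = (\<lambda>f. fold (\<lambda>x xs. if x \<in> set xs then xs else x # xs) (var_list d f) [])"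
    by (simp add: fun_eq_iff variables_def List.insert_def[abs_def])
  ultimately show ?thesis by simp
qed

section \<open>The constructed instance and its correctness\<close>

definition target :: "nat \<Rightarrow> nat \<Rightarrow> bool list list \<Rightarrow> fm list list list list \<Rightarrow> texp_inst" where
  "target q k ids NF = (let N = length ids + 2 + length NF in
     hitting_inst (length (layers q (k + 3))) (vertices q (k + 3) N)
       (constraints q (k + 3) N (valid k (length ids) (length NF)) (map (accept NF ids k) [0..<length (concat NF)])))"

text \<open>Everything unfolds to list operations and comparisons covered by the rules. The tuple
  length q lies outside the argument of the function, as \<open>ptime_n_lists\<close>
  demands.\<close>

lemma ptime_target: "ptime (\<lambda>z. enc_texp (target q (fst z) (fst (snd z)) (snd (snd z))))"
  unfolding target_def Let_def hitting_inst_def enc_texp_def prod.case constraints_def map_append map_map comp_def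
    consistent_def valid_def accept_def known_def segment_def layers_def vertices_def positions_def
    complete_edges_def enc_list_def
  by (intro ptime_intros)

text \<open>Strings that encode no circuit of weft 2 and depth d are sent to the empty string, which
  encodes no instance because \<open>enc_nat\<close> never yields an empty code.\<close>

definition reduction :: "nat \<Rightarrow> bool list \<times> nat \<Rightarrow> bool list \<times> nat" where
  "reduction d z = (case parse d 2 True (fst z) of None \<Rightarrow> ([], 0) | Some y \<Rightarrow>
     if snd y = [] then
       (enc_texp (target (2 * 2 ^ d + 1) (snd z) (variables d (fst y)) (nf d (fst y))),
        length (layers (2 * 2 ^ d + 1) (snd z + 3)))
     else ([], 0))"

lemma ptime_reduction: "ptime (reduction d)"
proof -
  have p: "ptime (parse d 2 True)" using suffix_parser_parse by (simp add: suffix_parser_def)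
  note t = ptime_3[where f="\<lambda>k ids NF. enc_texp (target (2 * 2 ^ d + 1) k ids NF)", OF ptime_target]
  have "ptime (\<lambda>z. reduction d z)"
    unfolding reduction_def layers_def
    by (intro ptime_intros ptime_o[OF p] t ptime_o[OF ptime_variables] ptime_o[OF ptime_nf])
  then show ?thesis .
qed

lemma snd_reduction_le: "snd (reduction d (x, k)) \<le> (k + 3) ^ (2 * 2 ^ d + 1)"
  by (simp add: reduction_def length_layers split: option.split)

lemma target_yes:
  assumes "shape 2 d f"
  shows "texp_yes (target (2 * 2 ^ d + 1) k (variables d f) (nf d f)) \<longleftrightarrow> (\<exists>A \<subseteq> fvars f. card A = k \<and> ev A f)"
proof -
  let ?q = "2 * 2 ^ d + 1 :: nat" and ?ids = "variables d f" and ?NF = "nf d f"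
  let ?N = "length ?ids + 2 + length ?NF"
  have ids: "set ?ids = fvars f" using variables(1) set_var_list[OF assms] by simp
  have "(1 :: nat) \<le> 2 ^ d" by simp
  then have q: "2 \<le> ?q" by simp
  have "texp_yes (target ?q k ?ids ?NF) \<longleftrightarrow>
    (\<exists>H. H \<subseteq> set (vertices ?q (k + 3) ?N) \<and> card H \<le> length (layers ?q (k + 3)) \<and>
      (\<forall>P\<in>set (constraints ?q (k + 3) ?N (valid k (length ?ids) (length ?NF))
        (map (accept ?NF ?ids k) [0..<length (concat ?NF)])). \<exists>v\<in>H. P v))"
    unfolding target_def Let_def by (rule hitting_inst_yes[OF distinct_vertices])
  also have "\<dots> \<longleftrightarrow> (\<exists>\<beta>. (\<forall>c<k + 3. \<beta> c < ?N) \<and>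
      (\<forall>T\<in>set (layers ?q (k + 3)). valid k (length ?ids) (length ?NF) (row \<beta> T)) \<and>
      (\<forall>Q\<in>set (map (accept ?NF ?ids k) [0..<length (concat ?NF)]). \<exists>T\<in>set (layers ?q (k + 3)). Q (row \<beta> T)))"
    by (rule hitting_cells) (fastforce simp: valid_def)+
  also have "\<dots> \<longleftrightarrow> (\<exists>A \<subseteq> set ?ids. card A = k \<and> (\<exists>E\<in>set ?NF. \<forall>ts\<in>set E. \<exists>t\<in>set ts. \<forall>l\<in>set t. ev A l))"
  proof (rule cells_nf[OF variables(2) q])
    fix E ts t assume *: "E \<in> set ?NF" "ts \<in> set E" "t \<in> set ts"
    show "2 * length t < ?q \<and> (\<forall>l\<in>set t. \<exists>s x. l = Lit s x \<and> x \<in> set ?ids)"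
      using nf_terms[OF assms *] unfolding ids by auto
  next
    fix E assume "E \<in> set ?NF"
    then show "length E \<le> length (concat ?NF)"
      by (simp add: length_concat member_le_sum_list)
  qed simp_all
  also have "\<dots> \<longleftrightarrow> (\<exists>A \<subseteq> fvars f. card A = k \<and> ev A f)"
    unfolding ids ev_nf[symmetric] ..
  finally show ?thesis .
qed

lemma reduction_correct: "(x, k) \<in> WCS 2 d \<longleftrightarrow> reduction d (x, k) \<in> SetTEXP_L"
proof -
  have ne: "([], 0) \<notin> SetTEXP_L"
  proof -
    have "enc_nat n @ v \<noteq> []" for n v by (cases n) auto
    then show ?thesis by (auto simp: SetTEXP_L_def enc_texp_def)
  qed
  show ?thesis
  proof (cases "\<exists>f. parse d 2 True x = Some (f, [])")
    case True
    then obtain f where f: "parse d 2 True x = Some (f, [])" by blast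
    then obtain C where C: "x = enc_circ C" "f = nnf True C" "cshape 2 d C" unfolding parse_Some by auto
    let ?I = "target (2 * 2 ^ d + 1) k (variables d f) (nf d f)"
    have "(x, k) \<in> WCS 2 d \<longleftrightarrow> (\<exists>A \<subseteq> fvars f. card A = k \<and> ev A f)"
    proof
      \<comment> \<open>Membership may be witnessed by another circuit \<open>C'\<close> with the
        same code; parsing shows that both have the same normal form.\<close>
      assume "(x, k) \<in> WCS 2 d"
      then obtain C' where C': "x = enc_circ C'" "cshape 2 d C'" "weighted_sat C' k"
        by (auto simp: WCS_def cshape_iff)
      then have "parse d 2 True x = Some (nnf True C', [])" unfolding parse_Some by auto
      then show "\<exists>A \<subseteq> fvars f. card A = k \<and> ev A f" using C'(3) f by (simp add: weighted_sat_nnf)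
    next
      assume "\<exists>A \<subseteq> fvars f. card A = k \<and> ev A f"
      then show "(x, k) \<in> WCS 2 d" using C by (auto simp: WCS_def cshape_iff weighted_sat_nnf)
    qed
    also have "\<dots> \<longleftrightarrow> texp_yes ?I"
      using target_yes[OF shape_nnf[OF C(3), of True], of k] C(2) by simp
    also have "\<dots> \<longleftrightarrow> reduction d (x, k) \<in> SetTEXP_L"
    proof -
      have I: "fst (snd ?I) = length (layers (2 * 2 ^ d + 1) (k + 3))" "texp_valid ?I"
        by (simp_all add: target_def hitting_inst_valid Let_def) (simp add: hitting_inst_def)
      have mem: "(enc_texp I, fst (snd I)) \<in> SetTEXP_L \<longleftrightarrow> texp_valid I \<and> texp_yes I" for I
      proof
        assume "(enc_texp I, fst (snd I)) \<in> SetTEXP_L"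
        then obtain J where "enc_texp I = enc_texp J" "texp_valid J" "texp_yes J"
          unfolding SetTEXP_L_def mem_Collect_eq by (elim exE conjE Pair_inject)
        then show "texp_valid I \<and> texp_yes I" unfolding enc_texp_inj by (simp only: simp_thms)
      next
        assume "texp_valid I \<and> texp_yes I"
        then show "(enc_texp I, fst (snd I)) \<in> SetTEXP_L"
          unfolding SetTEXP_L_def mem_Collect_eq by (intro exI[of _ I]) (simp only: simp_thms)
      qed
      have "reduction d (x, k) = (enc_texp ?I, length (layers (2 * 2 ^ d + 1) (k + 3)))"
        using f by (simp add: reduction_def)
      also have "\<dots> = (enc_texp ?I, fst (snd ?I))" by (simp only: I)
      finally show ?thesis by (simp only: mem I(2) simp_thms)
    qed
    finally show ?thesis .
  next
    case False
    then have "reduction d (x, k) = ([], 0)" by (auto simp: reduction_def split: option.split)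
    moreover have "(x, k) \<notin> WCS 2 d"
    proof
      assume "(x, k) \<in> WCS 2 d"
      then obtain C where "x = enc_circ C" "cshape 2 d C" by (auto simp: WCS_def cshape_iff)
      then have "parse d 2 True x = Some (nnf True C, [])" unfolding parse_Some by auto
      then show False using False by blast
    qed
    ultimately show ?thesis using ne by simp
  qed
qed

section \<open>Simulating a Turing machine\<close>

fun write_move :: "nat \<times> nat \<times> dir \<Rightarrow> nat list \<times> nat list \<Rightarrow> config" where
  "write_move (q, b, MoveL) z = (case fst z of [] \<Rightarrow> (q, [], 0 # b # tl (snd z)) | e # ls \<Rightarrow> (q, ls, e # b # tl (snd z)))"
| "write_move (q, b, MoveR) z = (q, b # fst z, tl (snd z))"
| "write_move (q, b, Stay) z = (q, fst z, b # tl (snd z))"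

text \<open>The machine is an arbitrary function, but only finitely many of its values matter. They
  are hard-wired into a chain of case distinctions over the table of state and symbol pairs.\<close>

fun lookup_step :: "tm \<Rightarrow> (nat \<times> nat) list \<Rightarrow> config \<Rightarrow> config" where
  "lookup_step M [] c = c"
| "lookup_step M (k # ks) c = (if (fst c, case snd (snd c) of [] \<Rightarrow> 0 | b # _ \<Rightarrow> b) = k
     then write_move (M (fst k) (snd k)) (snd c) else lookup_step M ks c)"

lemma tm_step_write_move:
  "q \<noteq> 1 \<Longrightarrow> tm_step M (q, ls, rs) = write_move (M q (case rs of [] \<Rightarrow> 0 | b # _ \<Rightarrow> b)) (ls, rs)"
  by (cases "M q (case rs of [] \<Rightarrow> 0 | b # _ \<Rightarrow> b)"; cases "snd (snd (M q (case rs of [] \<Rightarrow> 0 | b # _ \<Rightarrow> b)))")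
    (auto simp: tm_step_def Let_def split: list.splits)

lemma lookup_step_eq:
  "(q, case rs of [] \<Rightarrow> 0 | b # _ \<Rightarrow> b) \<in> set ks \<Longrightarrow> q \<noteq> 1 \<Longrightarrow> lookup_step M ks (q, ls, rs) = tm_step M (q, ls, rs)"
  by (induction ks) (auto simp: tm_step_write_move)

lemma ptime_write_move: "ptime (write_move m)"
proof -
  obtain q b d where m: "m = (q, b, d)" by (metis prod_cases3)
  have "ptime (\<lambda>z. write_move m z)"
    unfolding m by (cases d) (simp_all, intro ptime_intros, intro ptime_intros, intro ptime_intros)
  then show ?thesis .
qed

lemma ptime_eq_key: "ptime f \<Longrightarrow> ptime g \<Longrightarrow> ptime (\<lambda>x. (f x, g x) = (k :: nat \<times> nat))"
proof -
  assume "ptime f" "ptime g"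
  then have "ptime (\<lambda>x. f x = fst k \<and> g x = snd k)" by (intro ptime_intros)
  then show ?thesis by (simp add: prod_eq_iff)
qed

lemma ptime_lookup_step: "ptime (lookup_step M ks)"
proof (induction ks)
  case Nil
  have "ptime (\<lambda>c. lookup_step M [] c)" unfolding lookup_step.simps by (rule ptime_id)
  then show ?case .
next
  case (Cons k ks)
  have "ptime (\<lambda>c. lookup_step M (k # ks) c)" unfolding lookup_step.simps
    by (intro ptime_if ptime_eq_key ptime_o[OF ptime_write_move] ptime_o[OF Cons] ptime_intros)
  then show ?case .
qed

lemma sz_write_move: "sz (write_move (q, b, d) (ls, rs)) \<le> sz (q', ls, rs) + 2 * q + 2 * b + 10"
proof -
  have "sz (tl rs) \<le> sz rs" by (cases rs) auto
  then show ?thesis by (cases d; cases ls) auto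
qed

lemma tm_steps_halted: "(tm_step M ^^ n) (1, ls, rs) = (1, ls, rs)"
  by (induction n) (auto simp: tm_step_def)

text \<open>The step count \<tau> need be neither polynomial nor known to the program: the loop
  simply runs until state 1 occurs. What is polynomial is the bound \<open>B\<close> in the input
  together with \<tau> x, because each simulated step adds at most a constant \<open>K\<close> to
  the size of the configuration.\<close>

lemma simulate:
  fixes init :: "'a::data \<Rightarrow> nat list"
  assumes M: "tm_valid M" and init: "ptime init" "\<And>x. set (init x) \<subseteq> {1, 2, 3}"
    and halts: "\<And>x. \<exists>t \<le> \<tau> x. halts_with M t (init x) (out x)"
  shows "\<exists>T B. timed UNIV out T \<and> polyb B \<and> (\<forall>x. T x \<le> B (x, \<tau> x))"
proof -
  obtain NQ NS where N: "2 \<le> NQ" "4 \<le> NS" "\<And>q a. q < NQ \<Longrightarrow> a < NS \<Longrightarrow> fst (M q a) < NQ \<and> fst (snd (M q a)) < NS"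
    using M unfolding tm_valid_def by blast
  define G where "G = lookup_step M (List.product [0..<NQ] [0..<NS])"
  define ok where "ok c \<longleftrightarrow> fst c < NQ \<and> set (fst (snd c)) \<union> set (snd (snd c)) \<subseteq> {..<NS}" for c :: config
  define K where "K = 2 * NQ + 2 * NS + 10"
  let ?b = "\<lambda>c :: config. fst c \<noteq> 1"
  have head: "(case rs of [] \<Rightarrow> 0 | b # _ \<Rightarrow> b) < NS" if "set rs \<subseteq> {..<NS}" for rs :: "nat list"
    using that N(2) by (cases rs) auto
  have G: "G c = tm_step M c \<and> ok (G c) \<and> sz (G c) \<le> sz c + K" if c: "ok c" "?b c" for c
  proof -
    obtain q ls rs where c': "c = (q, ls, rs)" by (metis prod_cases3)
    let ?a = "case rs of [] \<Rightarrow> 0 | b # _ \<Rightarrow> b"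
    have 1: "q < NQ" "q \<noteq> 1" "set ls \<subseteq> {..<NS}" "set rs \<subseteq> {..<NS}" using c by (auto simp: c' ok_def)
    then have a: "?a < NS" using head by blast
    obtain q' b d where m: "M q ?a = (q', b, d)" by (metis prod_cases3)
    have b: "q' < NQ" "b < NS" using N(3)[OF 1(1) a] m by auto
    have eq: "G c = tm_step M c" unfolding G_def c' using 1 a by (intro lookup_step_eq) auto
    have w: "tm_step M c = write_move (q', b, d) (ls, rs)" unfolding c' tm_step_write_move[OF 1(2)] m ..
    have tl: "set (tl rs) \<subseteq> {..<NS}" using 1(4) by (cases rs) auto
    have "ok (write_move (q', b, d) (ls, rs))"
      using b 1(3) tl N(2) by (cases d; cases ls) (auto simp: ok_def)
    moreover have "sz (write_move (q', b, d) (ls, rs)) \<le> sz c + K"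
      using sz_write_move[of q' b d ls rs q] b unfolding c' K_def by linarith
    ultimately show ?thesis using eq w by simp
  qed
  let ?c0 = "\<lambda>x. (0, [], init x) :: config"
  have run: "\<exists>n \<le> \<tau> x. (\<forall>i<n. ?b ((G ^^ i) (?c0 x))) \<and> \<not> ?b ((G ^^ n) (?c0 x)) \<and>
      (\<forall>i\<le>n. sz ((G ^^ i) (?c0 x)) \<le> sz (?c0 x) + i * K) \<and>
      takeWhile (\<lambda>a. a \<noteq> 0) (snd (snd ((G ^^ n) (?c0 x)))) = out x" for x
  proof -
    obtain t where t: "t \<le> \<tau> x" "fst ((tm_step M ^^ t) (?c0 x)) = 1"
      "takeWhile (\<lambda>a. a \<noteq> 0) (snd (snd ((tm_step M ^^ t) (?c0 x)))) = out x"
      using halts[of x] by (auto simp: halts_with_def tm_run_def)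
    \<comment> \<open>The loop stops at the first halting configuration, which the machine never
      leaves; hence the output at time t is already present at the least such time.\<close>
    define n where "n = (LEAST i. fst ((tm_step M ^^ i) (?c0 x)) = 1)"
    have n: "fst ((tm_step M ^^ n) (?c0 x)) = 1" "n \<le> t"
      unfolding n_def by (rule LeastI[of _ t], rule t(2), rule Least_le, rule t(2))
    have before: "fst ((tm_step M ^^ i) (?c0 x)) \<noteq> 1" if "i < n" for i
      using not_less_Least[OF that[unfolded n_def]] .
    have "ok (?c0 x)" using init(2)[of x] N(1,2) by (auto simp: ok_def subset_iff)
    then have sim: "i \<le> n \<Longrightarrow> (G ^^ i) (?c0 x) = (tm_step M ^^ i) (?c0 x) \<and> ok ((G ^^ i) (?c0 x)) \<and>
        sz ((G ^^ i) (?c0 x)) \<le> sz (?c0 x) + i * K" for i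
    proof (induction i)
      case (Suc i)
      then have IH: "(G ^^ i) (?c0 x) = (tm_step M ^^ i) (?c0 x)" "ok ((G ^^ i) (?c0 x))"
        "sz ((G ^^ i) (?c0 x)) \<le> sz (?c0 x) + i * K" using Suc_leD by blast+
      have "?b ((G ^^ i) (?c0 x))" using before[of i] Suc.prems IH(1) by simp
      note step = G[OF IH(2) this]
      have "sz (G ((G ^^ i) (?c0 x))) \<le> sz (?c0 x) + Suc i * K"
        using conjunct2[OF conjunct2[OF step]] IH(3) unfolding mult_Suc by linarith
      moreover have "G ((G ^^ i) (?c0 x)) = tm_step M ((tm_step M ^^ i) (?c0 x))"
        using conjunct1[OF step] unfolding IH(1) .
      ultimately show ?case unfolding funpow.simps comp_apply using conjunct1[OF conjunct2[OF step]] by blast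
    qed simp
    have "(tm_step M ^^ t) (?c0 x) = (tm_step M ^^ n) (?c0 x)"
    proof -
      obtain q ls rs where c: "(tm_step M ^^ n) (?c0 x) = (q, ls, rs)" by (rule prod_cases3)
      then have "q = 1" using n(1) by simp
      have "(tm_step M ^^ (t - n + n)) (?c0 x) = (tm_step M ^^ (t - n)) ((tm_step M ^^ n) (?c0 x))"
        unfolding funpow_add comp_apply ..
      then show ?thesis using n(2) unfolding c \<open>q = 1\<close> tm_steps_halted by simp
    qed
    then have "takeWhile (\<lambda>a. a \<noteq> 0) (snd (snd ((G ^^ n) (?c0 x)))) = out x" using t(3) sim[of n] by simp
    moreover have "\<forall>i<n. ?b ((G ^^ i) (?c0 x))" using before sim by simp
    moreover have "\<not> ?b ((G ^^ n) (?c0 x))" using n(1) sim[of n] by simp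
    moreover have "\<forall>i\<le>n. sz ((G ^^ i) (?c0 x)) \<le> sz (?c0 x) + i * K" using sim by blast
    ultimately show ?thesis using n(2) t(1) by (meson order.trans)
  qed
  \<comment> \<open>\<open>timed_while\<close> wants result and time as functions of the start
    configuration, so the number of rounds is defined from it.\<close>
  define nn where "nn c = (LEAST i. \<not> ?b ((G ^^ i) c))" for c
  have nn: "nn (?c0 x) \<le> \<tau> x \<and> (\<forall>i<nn (?c0 x). ?b ((G ^^ i) (?c0 x))) \<and> \<not> ?b ((G ^^ nn (?c0 x)) (?c0 x)) \<and>
      (\<forall>i\<le>nn (?c0 x). sz ((G ^^ i) (?c0 x)) \<le> sz (?c0 x) + i * K) \<and>
      takeWhile (\<lambda>a. a \<noteq> 0) (snd (snd ((G ^^ nn (?c0 x)) (?c0 x)))) = out x" for x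
  proof -
    obtain n where n: "n \<le> \<tau> x" "\<forall>i<n. ?b ((G ^^ i) (?c0 x))" "\<not> ?b ((G ^^ n) (?c0 x))"
      "\<forall>i\<le>n. sz ((G ^^ i) (?c0 x)) \<le> sz (?c0 x) + i * K"
      "takeWhile (\<lambda>a. a \<noteq> 0) (snd (snd ((G ^^ n) (?c0 x)))) = out x" using run[of x] by blast
    have "nn (?c0 x) = n" unfolding nn_def
      by (rule Least_equality) (use n(2,3) in \<open>auto simp: not_less[symmetric]\<close>)
    then show ?thesis using n by simp
  qed
  have "ptime G" unfolding G_def by (rule ptime_lookup_step)
  then obtain Tg where g: "timed UNIV G Tg" "polyb Tg" unfolding ptime_def by blast
  have "ptime ?b" by (intro ptime_intros)
  then obtain Tb where b: "timed UNIV ?b Tb" "polyb Tb" unfolding ptime_def by blast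
  let ?R = "\<lambda>c. Tb c + Tg c + 120 * sz c"
  have "polyb ?R" by (intro polyb_intros b g)
  then obtain e where e: "\<And>c. ?R c \<le> (sz c + 1) ^ e" unfolding polyb_def by blast
  let ?F = "\<lambda>c. (G ^^ nn c) c" and ?T = "\<lambda>c. \<Sum>i\<le>nn c. ?R ((G ^^ i) c)"
  have loop: "timed (range ?c0) ?F ?T"
    by (rule timed_while[OF b(1) timed_mono[OF g(1)]]) (use nn in \<open>auto intro!: exI[of _ "nn _"]\<close>)
  have "ptime ?c0" by (intro ptime_intros init)
  then obtain T0 where 0: "timed UNIV ?c0 T0" "polyb T0" unfolding ptime_def by blast
  let ?post = "\<lambda>c :: config. takeWhile (\<lambda>a. a \<noteq> 0) (snd (snd c))"
  have "ptime ?post" by (intro ptime_intros)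
  then obtain T2 where 2: "timed UNIV ?post T2" "polyb T2" unfolding ptime_def by blast
  obtain e2 where e2: "\<And>c. T2 c \<le> (sz c + 1) ^ e2" using 2(2) unfolding polyb_def by blast
  have "timed UNIV (\<lambda>x. ?F (?c0 x)) (\<lambda>x. T0 x + ?T (?c0 x) + 1)"
    by (rule timed_o[OF 0(1) loop]) auto
  then have "timed UNIV (\<lambda>x. ?post (?F (?c0 x))) (\<lambda>x. (T0 x + ?T (?c0 x) + 1) + T2 (?F (?c0 x)) + 1)"
    by (rule timed_o[OF _ 2(1)]) auto
  moreover have "(\<lambda>x. ?post (?F (?c0 x))) = out" using nn by auto
  ultimately have out: "timed UNIV out (\<lambda>x. (T0 x + ?T (?c0 x) + 1) + T2 (?F (?c0 x)) + 1)" by simp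
  \<comment> \<open>A bound on the size of every configuration in the run: the initial size plus
    \<open>K\<close> for each of at most \<tau> x steps.\<close>
  let ?S = "\<lambda>z :: 'a \<times> nat. sz (?c0 (fst z)) + snd z * K + 1"
  let ?B = "\<lambda>z :: 'a \<times> nat. (T0 (fst z) + Suc (snd z) * ?S z ^ e + 1) + ?S z ^ e2 + 1"
  have f: "polyb (\<lambda>z :: 'a \<times> nat. sz (fst z))" by (intro ptime_sz ptime_intros)
  have s: "polyb (\<lambda>z :: 'a \<times> nat. snd z)" by (rule polyb_le[OF polyb_sz]) (auto simp: case_prod_beta split: prod.splits)
  have "polyb ?B"
    by (intro polyb_intros polyb_Suc s polyb_comp[OF 0(2) f] polyb_comp[OF ptime_sz[OF \<open>ptime ?c0\<close>] f])
  moreover have "(T0 x + ?T (?c0 x) + 1) + T2 (?F (?c0 x)) + 1 \<le> ?B (x, \<tau> x)" for x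
  proof -
    have S: "sz ((G ^^ i) (?c0 x)) + 1 \<le> ?S (x, \<tau> x)" if "i \<le> nn (?c0 x)" for i
    proof -
      have "sz ((G ^^ i) (?c0 x)) \<le> sz (?c0 x) + i * K" using nn that by blast
      also have "i * K \<le> \<tau> x * K" using that nn[of x] by (intro mult_le_mono1) linarith
      finally show ?thesis by simp
    qed
    have "?T (?c0 x) \<le> (\<Sum>i\<le>nn (?c0 x). ?S (x, \<tau> x) ^ e)"
      by (intro sum_mono order.trans[OF e] power_mono S) auto
    also have "\<dots> = Suc (nn (?c0 x)) * ?S (x, \<tau> x) ^ e" by simp
    also have "\<dots> \<le> Suc (\<tau> x) * ?S (x, \<tau> x) ^ e" using nn[of x] by (intro mult_le_mono1) simp
    finally have 1: "?T (?c0 x) \<le> Suc (\<tau> x) * ?S (x, \<tau> x) ^ e" .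
    have 2: "T2 (?F (?c0 x)) \<le> ?S (x, \<tau> x) ^ e2"
      by (intro order.trans[OF e2] power_mono S) auto
    show ?thesis using 1 2 unfolding fst_conv snd_conv by linarith
  qed
  ultimately show ?thesis using out by (intro exI conjI) (assumption, assumption, blast)
qed

section \<open>Composition of fpt reductions\<close>

definition decode_pair :: "nat list \<Rightarrow> bool list \<times> nat" where
  "decode_pair w = (map (\<lambda>a. a = 2) (takeWhile (\<lambda>a. a \<noteq> 3) w), length (tl (dropWhile (\<lambda>a. a \<noteq> 3) w)))"

lemma decode_code_pair: "decode_pair (code_pair p) = p"
proof -
  have "takeWhile (\<lambda>a. a \<noteq> 3) (map bit x @ 3 # v) = map bit x" "dropWhile (\<lambda>a. a \<noteq> 3) (map bit x @ 3 # v) = 3 # v" for x v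
    by (induction x) auto
  moreover have "map (\<lambda>a. a = (2 :: nat)) (map bit x) = x" for x by (induction x) auto
  ultimately show ?thesis by (cases p) (simp add: decode_pair_def code_pair_def del: map_map)
qed

lemma ptime_decode_pair: "ptime decode_pair"
proof -
  have "ptime (\<lambda>w. decode_pair w)" unfolding decode_pair_def by (intro ptime_intros)
  then show ?thesis .
qed

lemma set_code_pair: "set (code_pair p) \<subseteq> {1, 2, 3}"
  by (auto simp: code_pair_def)

lemma ptime_code_pair: "ptime code_pair"
proof -
  have "ptime (\<lambda>p. map (\<lambda>b. if b then 2 else 1) (fst p) @ 3 # map (\<lambda>_. 1 :: nat) [0..<snd p])"
    by (intro ptime_intros)
  then show ?thesis by (simp add: code_pair_def[abs_def] map_replicate_const)
qed

text \<open>The output is at most as long as input size plus time, so post-processing by a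
  polynomial-time function keeps the bound polynomial in the input and \<tau>.\<close>

lemma timed_post:
  assumes h: "ptime h" and out: "timed UNIV (out :: 'a::data \<Rightarrow> 'b::data) T" and B: "polyb B" "\<And>x. T x \<le> B (x, \<tau> x)"
  shows "\<exists>T B. timed UNIV (\<lambda>x. h (out x)) T \<and> polyb B \<and> (\<forall>x. T x \<le> B (x, \<tau> x :: nat))"
proof -
  obtain Th where Th: "timed UNIV h Th" "polyb Th" using h unfolding ptime_def by blast
  obtain c where c: "\<And>y. Th y \<le> (sz y + 1) ^ c" using Th(2) unfolding polyb_def by blast
  have "timed UNIV (\<lambda>x. h (out x)) (\<lambda>x. T x + Th (out x) + 1)" by (rule timed_o[OF out Th(1)]) simp
  moreover have "polyb (\<lambda>z :: 'a \<times> nat. B z + (sz (fst z) + B z + 1) ^ c + 1)"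
    by (intro polyb_intros B ptime_sz ptime_intros)
  moreover have "T x + Th (out x) + 1 \<le> B (x, \<tau> x) + (sz (fst (x, \<tau> x)) + B (x, \<tau> x) + 1) ^ c + 1" for x
  proof -
    have "sz (out x) \<le> sz x + T x" by (rule timed_size[OF out UNIV_I])
    then have "(sz (out x) + 1) ^ c \<le> (sz x + B (x, \<tau> x) + 1) ^ c" using B(2)[of x] by (intro power_mono) simp_all
    then show ?thesis using c[of "out x"] B(2)[of x] by simp
  qed
  ultimately show ?thesis by blast
qed

text \<open>Composed reductions need computable bounds again. No bound on the time to compute f is
  required: some halting time is picked for each k, and \<open>simulate\<close> turns the given
  machine into a program.\<close>

lemma computable_nat_ptime:
  assumes f: "computable_nat f" and h: "ptime h"
  shows "computable_nat (\<lambda>k. h (k, f k))"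
proof -
  obtain M where M: "tm_valid M" "\<And>k. \<exists>t. halts_with M t (code_pair ([], k)) (code_pair ([], f k))"
    using f unfolding computable_nat_def by blast
  then obtain \<tau> where \<tau>: "\<And>k. halts_with M (\<tau> k) (code_pair ([], k)) (code_pair ([], f k))" by metis
  have "ptime (\<lambda>k. code_pair ([], k))" by (intro ptime_o[OF ptime_code_pair] ptime_intros)
  then obtain T where T: "timed UNIV (\<lambda>k. code_pair ([], f k)) T"
    using simulate[OF M(1), of "\<lambda>k. code_pair ([], k)" \<tau> "\<lambda>k. code_pair ([], f k)"] \<tau> set_code_pair by blast
  have "ptime (\<lambda>w. snd (decode_pair w))" by (intro ptime_intros ptime_decode_pair)
  then obtain Td where Td: "timed UNIV (\<lambda>w. snd (decode_pair w)) Td" unfolding ptime_def by blast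
  have "timed UNIV (\<lambda>k. snd (decode_pair (code_pair ([], f k)))) (\<lambda>k. T k + Td (code_pair ([], f k)) + 1)"
    by (rule timed_o[OF T Td]) simp
  then have 1: "timed UNIV f (\<lambda>k. T k + Td (code_pair ([], f k)) + 1)" by (simp add: decode_code_pair)
  have "timed UNIV (\<lambda>k :: nat. k) (\<lambda>_. 1)" by (rule timed_recode) simp
  note 2 = timed_pair[OF this 1]
  have "ptime (\<lambda>p. ([] :: bool list, h p))" by (intro ptime_intros h)
  then obtain Th where Th: "timed UNIV (\<lambda>p. ([] :: bool list, h p)) Th" unfolding ptime_def by blast
  note 3 = timed_o[OF 2 Th subset_UNIV]
  have "ptime (snd :: bool list \<times> nat \<Rightarrow> nat)" using ptime_snd[OF ptime_id] .
  \<comment> \<open>Machines read a string and a number. The program discards the string, and the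
    run is finally considered on the empty string.\<close>
  then obtain Ts where Ts: "timed UNIV (snd :: bool list \<times> nat \<Rightarrow> nat) Ts" unfolding ptime_def by blast
  obtain M' where M': "tm_valid M'" and
    run: "\<And>x k. \<exists>n. halts_with M' n (code_pair (x, k)) (code_pair ([], h (snd (x, k), f (snd (x, k)))))"
    using timed_halts_with[OF timed_o[OF Ts 3 subset_UNIV]] by blast
  from run have "\<exists>n. halts_with M' n (code_pair ([], k)) (code_pair ([], h (k, f k)))" for k
    unfolding snd_conv .
  with M' show ?thesis unfolding computable_nat_def by blast
qed

text \<open>A power with constant exponent is obtained as the number of lists of that
  length.\<close>

lemma ptime_power [ptime_intros]: "ptime f \<Longrightarrow> ptime (\<lambda>x. f x ^ c :: nat)"
proof -
  assume "ptime f"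
  then have "ptime (\<lambda>x. length (List.n_lists c [0..<f x]))" by (intro ptime_intros)
  then show ?thesis by (simp add: length_n_lists)
qed

lemma sz_bits: "sz (x :: bool list) \<le> 4 * length x + 1"
  using sz_list_le[of x 3] sz_bool by (simp add: mult.commute)

theorem theorem6:
  shows "W_hard 2 SetTEXP_L"
  unfolding W_hard_def
proof
  fix P assume "P \<in> W_class 2"
  then obtain d R where R: "fpt_reduction R P (WCS 2 d)" unfolding W_class_def fpt_reducible_def by blast
  then obtain M f c g where M: "tm_valid M" and f: "computable_nat f" and g: "computable_nat g"
    and time: "\<And>x k. \<exists>t \<le> f k * (length x + 1) ^ c. halts_with M t (code_pair (x, k)) (code_pair (R (x, k)))"
    and par: "\<And>x k. snd (R (x, k)) \<le> g k" and R: "\<And>x k. (x, k) \<in> P \<longleftrightarrow> R (x, k) \<in> WCS 2 d"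
    unfolding fpt_reduction_def by blast
  let ?\<tau> = "\<lambda>z. f (snd z) * (length (fst z) + 1) ^ c"
  let ?R = "\<lambda>z. reduction d (R z)"
  obtain T B where "timed UNIV (\<lambda>z. code_pair (R z)) T" "polyb B" "\<And>z. T z \<le> B (z, ?\<tau> z)"
    using simulate[OF M ptime_code_pair set_code_pair, of ?\<tau> "\<lambda>z. code_pair (R z)"] time by auto
  moreover have "ptime (\<lambda>w. reduction d (decode_pair w))" by (intro ptime_o[OF ptime_reduction] ptime_decode_pair)
  ultimately obtain T B where T: "timed UNIV ?R T" and B: "polyb B" "\<And>z. T z \<le> B (z, ?\<tau> z)"
    using timed_post[of "\<lambda>w. reduction d (decode_pair w)" "\<lambda>z. code_pair (R z)" T B ?\<tau>]
    by (auto simp: decode_code_pair)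
  obtain M' where M': "tm_valid M'" and run: "\<And>x k. \<exists>n \<le> 40 * (150 * (sz (x, k) + T (x, k)))\<^sup>2.
      halts_with M' n (code_pair (x, k)) (code_pair (?R (x, k)))"
    using timed_halts_with[OF T] by blast
  \<comment> \<open>The total machine time, a polynomial in the input paired with the step count of
    the given reduction.\<close>
  let ?C = "\<lambda>z. 40 * (150 * (sz (fst z) + B z))\<^sup>2"
  have "polyb ?C" by (intro polyb_intros B ptime_sz ptime_intros)
  then obtain e where e: "\<And>z. ?C z \<le> (sz z + 1) ^ e" unfolding polyb_def by blast
  \<comment> \<open>The pair of input and step count has size at most 2 * f k * l ^ c + 2 * k + 4 *
    l + 5, where l is the length of x plus one. Bounding each power of l by l ^ (c + 1) separates
    the factor for k, with 9 = 4 + 5; the doublings are written as sums to stay within the rules for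
    \<open>ptime\<close>.\<close>
  let ?h = "\<lambda>p :: nat \<times> nat. (snd p + snd p + fst p + fst p + 9) ^ e"
  have "ptime ?h" by (intro ptime_intros)
  then have fcomp: "computable_nat (\<lambda>k. ?h (k, f k))" by (rule computable_nat_ptime[OF f])
  have bound: "40 * (150 * (sz (x, k) + T (x, k)))\<^sup>2 \<le> ?h (k, f k) * (length x + 1) ^ ((c + 1) * e)" for x k
  proof -
    let ?l = "length x + 1" and ?n = "?\<tau> (x, k)"
    have "40 * (150 * (sz (x, k) + T (x, k)))\<^sup>2 \<le> ?C ((x, k), ?n)"
      using B(2)[of "(x, k)"] by (intro mult_le_mono2 power_mono) simp_all
    also have "\<dots> \<le> (sz ((x, k), ?n) + 1) ^ e" by (rule e)
    also have "\<dots> \<le> ((f k + f k + k + k + 9) * ?l ^ (c + 1)) ^ e"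
    proof (intro power_mono)
      have "?l ^ 1 \<le> ?l ^ (c + 1)" by (intro power_increasing) simp_all
      then have l1: "?l \<le> ?l ^ (c + 1)" by (simp only: power_one_right)
      have l2: "?l ^ c \<le> ?l ^ (c + 1)" by (intro power_increasing) auto
      have "sz ((x, k), ?n) + 1 \<le> 2 * (f k * ?l ^ c) + 2 * k + 4 * ?l + 5"
        using sz_bits[of x] by simp
      also have "\<dots> \<le> 2 * (f k * ?l ^ (c + 1)) + 2 * k * ?l ^ (c + 1) + 4 * ?l ^ (c + 1) + 5 * ?l ^ (c + 1)"
      proof (intro add_mono mult_le_mono2)
        show "?l ^ c \<le> ?l ^ (c + 1)" "?l \<le> ?l ^ (c + 1)" by (fact l2 l1)+
        have "1 \<le> ?l ^ (c + 1)" by (intro one_le_power) simp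
        then show "2 * k \<le> 2 * k * ?l ^ (c + 1)" "5 \<le> 5 * ?l ^ (c + 1)"
          using mult_le_mono2[of 1 "?l ^ (c + 1)"] unfolding mult_1_right by blast+
      qed
      also have "\<dots> = (f k + f k + k + k + 9) * ?l ^ (c + 1)" by (simp only: distrib_right mult_2)
      finally show "sz ((x, k), ?n) + 1 \<le> (f k + f k + k + k + 9) * ?l ^ (c + 1)" .
    qed simp
    also have "\<dots> = ?h (k, f k) * ?l ^ ((c + 1) * e)"
      by (simp only: power_mult_distrib power_mult fst_conv snd_conv)
    finally show ?thesis .
  qed
  \<comment> \<open>The new lifetime is (k' + 3) ^ q for the parameter k' produced by the given
    reduction, and k' is at most g k.\<close>
  let ?g = "\<lambda>p :: nat \<times> nat. (snd p + 3) ^ (2 * 2 ^ d + 1)"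
  have "ptime ?g" by (intro ptime_intros)
  then have gcomp: "computable_nat (\<lambda>k. ?g (k, g k))" by (rule computable_nat_ptime[OF g])
  have "fpt_reduction ?R P SetTEXP_L"
    unfolding fpt_reduction_def
  proof (intro conjI allI)
    fix x k
    show "(x, k) \<in> P \<longleftrightarrow> ?R (x, k) \<in> SetTEXP_L"
      unfolding R using reduction_correct[of "fst (R (x, k))" "snd (R (x, k))" d] by simp
  next
    have "\<exists>t \<le> ?h (k, f k) * (length x + 1) ^ ((c + 1) * e). halts_with M' t (code_pair (x, k)) (code_pair (?R (x, k)))" for x k
      using run[of x k] bound[of x k] by (meson order.trans)
    then show "\<exists>M f c. tm_valid M \<and> computable_nat f \<and>
        (\<forall>x k. \<exists>t \<le> f k * (length x + 1) ^ c. halts_with M t (code_pair (x, k)) (code_pair (?R (x, k))))"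
      using M' fcomp by blast
  next
    have "snd (?R (x, k)) \<le> ?g (k, g k)" for x k
    proof -
      have "snd (?R (x, k)) \<le> (snd (R (x, k)) + 3) ^ (2 * 2 ^ d + 1)"
        using snd_reduction_le[of d "fst (R (x, k))" "snd (R (x, k))"] by simp
      also have "\<dots> \<le> ?g (k, g k)" using par[of x k] unfolding snd_conv by (intro power_mono) simp_all
      finally show ?thesis .
    qed
    then show "\<exists>g. computable_nat g \<and> (\<forall>x k. snd (?R (x, k)) \<le> g k)" using gcomp by blast
  qed
  then show "fpt_reducible P SetTEXP_L" unfolding fpt_reducible_def by blast
qed

end
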